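(* Let $C_4$ denote the cycle on $4$ vertices. There is an algorithm which, given an undirected graph $G=(V,E)$ on $n$ vertices of tree-width at most $t$ together with a nice tree decomposition of $G$ of width at most $t$ having $O(n)$ nodes, decides in time $2^{O(t^2)}\cdot n$ whether $V$ can be partitioned into two non-empty sets $A, B$ such that neither of the induced subgraphs $G[A]$ and $G[B]$ contains $C_4$ as a subgraph.
   Context: A tree decomposition of $G=(V,E)$ is a pair $(T,\{X_i : i\in I\})$ with $T$ a tree on node set $I$ and bags $X_i\subseteq V$ such that every vertex lies in some bag, every edge has both endpoints in some bag, and for each vertex $v$ the nodes whose bags contain $v$ induce a connected subtree of $T$; its width is $\max_i |X_i|-1$, and the tree-width of $G$ is the minimum width over all tree decompositions. A nice tree decomposition is a rooted tree decomposition in which every node is a leaf node (empty bag), an introduce node (one child, bag equals the child's bag plus one vertex), a forget node (one child, bag equals the child's bag minus one vertex), or a join node (two children with bags equal to its own). For $S\subseteq V$, $G[S]$ is the induced subgraph on $S$. *)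

theory Defs
  imports Complex_Main "HOL-Library.Landau_Symbols"
begin

section \<open>Undirected graphs\<close>

record 'a ugraph =
  verts :: "'a set"
  edges :: "'a set set"

definition simple_graph :: "'a ugraph \<Rightarrow> bool" where
  "simple_graph G \<longleftrightarrow> finite (verts G) \<and>
     (\<forall>e\<in>edges G. \<exists>u v. u \<in> verts G \<and> v \<in> verts G \<and> u \<noteq> v \<and> e = {u, v})"

definition induced :: "'a ugraph \<Rightarrow> 'a set \<Rightarrow> 'a ugraph" where
  "induced G S = \<lparr>verts = verts G \<inter> S, edges = {e \<in> edges G. e \<subseteq> S}\<rparr>"

text \<open>Not necessarily induced: \<open>G\<close> may have further edges between the vertices of the copy of \<open>H\<close>.\<close>

definition contains_subgraph :: "'a ugraph \<Rightarrow> 'b ugraph \<Rightarrow> bool" where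
  "contains_subgraph G H \<longleftrightarrow>
     (\<exists>f. inj_on f (verts H) \<and> f ` verts H \<subseteq> verts G \<and> (\<forall>e\<in>edges H. f ` e \<in> edges G))"

definition cycle_graph :: "nat \<Rightarrow> nat ugraph" where
  "cycle_graph k = \<lparr>verts = {..<k}, edges = {{i, Suc i mod k} | i. i < k}\<rparr>"

definition walk :: "'a ugraph \<Rightarrow> 'a list \<Rightarrow> bool" where
  "walk G p \<longleftrightarrow> p \<noteq> [] \<and> set p \<subseteq> verts G \<and> successively (\<lambda>u v. {u, v} \<in> edges G) p"

definition connected_graph :: "'a ugraph \<Rightarrow> bool" where
  "connected_graph G \<longleftrightarrow> verts G \<noteq> {} \<and>
     (\<forall>u\<in>verts G. \<forall>v\<in>verts G. \<exists>p. walk G p \<and> hd p = u \<and> last p = v)"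

definition tree :: "'a ugraph \<Rightarrow> bool" where
  "tree T \<longleftrightarrow> simple_graph T \<and> connected_graph T \<and>
     (\<forall>k\<ge>3. \<not> contains_subgraph T (cycle_graph k))"

section \<open>Tree decompositions\<close>

definition tree_decomposition :: "'a ugraph \<Rightarrow> 'i ugraph \<Rightarrow> ('i \<Rightarrow> 'a set) \<Rightarrow> bool" where
  "tree_decomposition G T X \<longleftrightarrow> tree T \<and>
     (\<forall>i\<in>verts T. X i \<subseteq> verts G) \<and>
     (\<forall>v\<in>verts G. \<exists>i\<in>verts T. v \<in> X i) \<and>
     (\<forall>e\<in>edges G. \<exists>i\<in>verts T. e \<subseteq> X i) \<and>
     (\<forall>v\<in>verts G. connected_graph (induced T {i \<in> verts T. v \<in> X i}))"

text \<open>The width is an integer, as it is \<open>-1\<close> if all bags are empty.\<close>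

definition width :: "'i ugraph \<Rightarrow> ('i \<Rightarrow> 'a set) \<Rightarrow> int" where
  "width T X = int (Max ((\<lambda>i. card (X i)) ` verts T)) - 1"

text \<open>Decomposition trees are finite, so natural numbers suffice as their nodes.\<close>

definition treewidth :: "'a ugraph \<Rightarrow> int" where
  "treewidth G = (LEAST w. \<exists>(T :: nat ugraph) X. tree_decomposition G T X \<and> w = width T X)"

text \<open>The children of node \<open>i\<close> are the nodes \<open>j\<close> whose path from the root \<open>r\<close> has \<open>i\<close> as its
  last node before \<open>j\<close>.\<close>

definition children :: "'i ugraph \<Rightarrow> 'i \<Rightarrow> 'i \<Rightarrow> 'i set" where
  "children T r i = {j. \<exists>p. walk T (p @ [i, j]) \<and> distinct (p @ [i, j]) \<and> hd (p @ [i, j]) = r}"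

definition leaf_node :: "'i ugraph \<Rightarrow> 'i \<Rightarrow> ('i \<Rightarrow> 'a set) \<Rightarrow> 'i \<Rightarrow> bool" where
  "leaf_node T r X i \<longleftrightarrow> children T r i = {} \<and> X i = {}"

definition introduce_node :: "'i ugraph \<Rightarrow> 'i \<Rightarrow> ('i \<Rightarrow> 'a set) \<Rightarrow> 'i \<Rightarrow> bool" where
  "introduce_node T r X i \<longleftrightarrow>
     (\<exists>j v. children T r i = {j} \<and> v \<notin> X j \<and> X i = insert v (X j))"

definition forget_node :: "'i ugraph \<Rightarrow> 'i \<Rightarrow> ('i \<Rightarrow> 'a set) \<Rightarrow> 'i \<Rightarrow> bool" where
  "forget_node T r X i \<longleftrightarrow>
     (\<exists>j v. children T r i = {j} \<and> v \<in> X j \<and> X i = X j - {v})"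

definition join_node :: "'i ugraph \<Rightarrow> 'i \<Rightarrow> ('i \<Rightarrow> 'a set) \<Rightarrow> 'i \<Rightarrow> bool" where
  "join_node T r X i \<longleftrightarrow>
     (\<exists>j k. j \<noteq> k \<and> children T r i = {j, k} \<and> X j = X i \<and> X k = X i)"

definition nice_tree_decomposition ::
    "'a ugraph \<Rightarrow> 'i ugraph \<Rightarrow> 'i \<Rightarrow> ('i \<Rightarrow> 'a set) \<Rightarrow> bool" where
  "nice_tree_decomposition G T r X \<longleftrightarrow> tree_decomposition G T X \<and> r \<in> verts T \<and>
     (\<forall>i\<in>verts T. leaf_node T r X i \<or> introduce_node T r X i \<or>
                  forget_node T r X i \<or> join_node T r X i)"

section \<open>Random access machines\<close>

text \<open>
  Algorithms are programs for a uniform-cost random access machine with finitely many registers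
  (those the program mentions) and an unbounded memory, both holding natural numbers. Control flow
  is structured instead of given by jumps. The only arithmetic operations are addition and
  truncated subtraction: multiplication at unit cost would make the machine unreasonably powerful.
  Every operation in an expression and every command executed is charged one time unit.
\<close>

datatype exp = Const nat | Reg nat | Plus exp exp | Minus exp exp | Load exp

datatype com =
    Skip
  | Assign nat exp
  | Store exp exp
  | Seq com com
  | If exp com com
  | While exp com

record state =
  regs :: "nat \<Rightarrow> nat"
  mem :: "nat \<Rightarrow> nat"

primrec val :: "exp \<Rightarrow> state \<Rightarrow> nat" where
  "val (Const k) s = k"
| "val (Reg x) s = regs s x"
| "val (Plus a b) s = val a s + val b s"
| "val (Minus a b) s = val a s - val b s"
| "val (Load a) s = mem s (val a s)"

primrec cost :: "exp \<Rightarrow> nat" where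
  "cost (Const k) = 1"
| "cost (Reg x) = 1"
| "cost (Plus a b) = cost a + cost b + 1"
| "cost (Minus a b) = cost a + cost b + 1"
| "cost (Load a) = cost a + 1"

text \<open>\<open>exec c s \<tau> s'\<close>: started in \<open>s\<close>, program \<open>c\<close> halts in state \<open>s'\<close> after \<open>\<tau>\<close> time units.
  Conditions are true iff they are nonzero; \<open>Store a b\<close> writes the value of \<open>b\<close> to address \<open>a\<close>.\<close>

inductive exec :: "com \<Rightarrow> state \<Rightarrow> nat \<Rightarrow> state \<Rightarrow> bool" where
  Skip: "exec Skip s 1 s"
| Assign: "exec (Assign x a) s (cost a + 1) (s\<lparr>regs := (regs s)(x := val a s)\<rparr>)"
| Store: "exec (Store a b) s (cost a + cost b + 1) (s\<lparr>mem := (mem s)(val a s := val b s)\<rparr>)"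
| Seq: "\<lbrakk>exec c s i s'; exec d s' j s''\<rbrakk> \<Longrightarrow> exec (Seq c d) s (i + j + 1) s''"
| If_true: "\<lbrakk>val a s \<noteq> 0; exec c s i s'\<rbrakk> \<Longrightarrow> exec (If a c d) s (cost a + i + 1) s'"
| If_false: "\<lbrakk>val a s = 0; exec d s i s'\<rbrakk> \<Longrightarrow> exec (If a c d) s (cost a + i + 1) s'"
| While_false: "val a s = 0 \<Longrightarrow> exec (While a c) s (cost a + 1) s"
| While_true: "\<lbrakk>val a s \<noteq> 0; exec c s i s'; exec (While a c) s' j s''\<rbrakk>
    \<Longrightarrow> exec (While a c) s (cost a + i + j + 1) s''"

lemma exec_deterministic:
  "exec c s i s' \<Longrightarrow> exec c s j s'' \<Longrightarrow> j = i \<and> s'' = s'"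
proof (induction arbitrary: j s'' rule: exec.induct)
  case (Seq c s i s' d k t)
  from Seq.prems obtain i1 s1 j1
    where "exec c s i1 s1" "exec d s1 j1 s''" "j = i1 + j1 + 1"
    by (cases rule: exec.cases) simp
  with Seq.IH show ?case by metis
next
  case (If_true a s c i s' d)
  from If_true.prems If_true.hyps obtain i1
    where "exec c s i1 s''" "j = cost a + i1 + 1"
    by (cases rule: exec.cases) simp_all
  with If_true.IH show ?case by metis
next
  case (If_false a s d i s' c)
  from If_false.prems If_false.hyps obtain i1
    where "exec d s i1 s''" "j = cost a + i1 + 1"
    by (cases rule: exec.cases) simp_all
  with If_false.IH show ?case by metis
next
  case (While_true a s c i s' k t)
  from While_true.prems While_true.hyps obtain i1 s1 j1
    where "exec c s i1 s1" "exec (While a c) s1 j1 s''" "j = cost a + i1 + j1 + 1"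
    by (cases rule: exec.cases) simp_all
  with While_true.IH show ?case by metis
qed (erule exec.cases; simp)+

section \<open>Input format\<close>

text \<open>Compressed rows: the offsets at which the rows start (and the last one ends), relative to the
  beginning of the concatenation of all rows, followed by this concatenation.\<close>

definition rows :: "nat list list \<Rightarrow> nat list" where
  "rows ls = map (\<lambda>i. length (concat (take i ls))) [0..<Suc (length ls)] @ concat ls"

text \<open>Vertices and nodes are numbered from \<open>0\<close>, in any order. The input consists of the numbers of
  vertices and nodes, the root, the adjacency list of each vertex, the list of children of each
  node, and the bag of each node; all lists are in any order.\<close>

definition encodes ::
    "nat list \<Rightarrow> nat ugraph \<Rightarrow> nat ugraph \<Rightarrow> nat \<Rightarrow> (nat \<Rightarrow> nat set) \<Rightarrow> bool" where
  "encodes xs G T r X \<longleftrightarrow>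
     (\<exists>adj chs bags.
        xs = [length adj, length chs, r] @ rows adj @ rows chs @ rows bags \<and>
        verts G = {..<length adj} \<and>
        (\<forall>v\<in>verts G. distinct (adj ! v) \<and> set (adj ! v) = {u. {u, v} \<in> edges G}) \<and>
        verts T = {..<length chs} \<and> length bags = length chs \<and>
        (\<forall>i\<in>verts T. distinct (chs ! i) \<and> set (chs ! i) = children T r i \<and>
                     distinct (bags ! i) \<and> set (bags ! i) = X i))"

definition initial_state :: "nat list \<Rightarrow> state" where
  "initial_state xs =
     \<lparr>regs = (\<lambda>_. 0), mem = (\<lambda>a. if a < length xs then xs ! a else 0)\<rparr>"

text \<open>The answer is delivered in register \<open>0\<close>.\<close>

definition answers_within :: "com \<Rightarrow> nat list \<Rightarrow> real \<Rightarrow> bool \<Rightarrow> bool" where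
  "answers_within P xs b ans \<longleftrightarrow>
     (\<exists>\<tau> s. exec P (initial_state xs) \<tau> s \<and> real \<tau> \<le> b \<and> regs s 0 = (if ans then 1 else 0))"

section \<open>The decision problem\<close>

definition C4_free_bipartition :: "'a ugraph \<Rightarrow> bool" where
  "C4_free_bipartition G \<longleftrightarrow>
     (\<exists>A B. A \<union> B = verts G \<and> A \<inter> B = {} \<and> A \<noteq> {} \<and> B \<noteq> {} \<and>
        \<not> contains_subgraph (induced G A) (cycle_graph 4) \<and>
        \<not> contains_subgraph (induced G B) (cycle_graph 4))"

end

theory Submission
  imports Defs
begin

text \<open>
  A colouring of the vertices with two colours has no monochromatic \<open>C\<^sub>4\<close> iff any two vertices of the
  same colour have at most one common neighbour of this colour. In a rooted tree decomposition it
  therefore suffices to remember, at each node, the colouring of the bag and the set of pairs of bag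
  vertices that already have such a common neighbour strictly below the bag. With bags of size at
  most \<open>k\<close> there are \<open>S = 2 ^ (k + k\<^sup>2)\<close> such states, and the states realizable at a node are
  found from those at its (at most two) children by exhaustive search, in time polynomial in \<open>S\<close>.
  With at least two vertices, both colour classes can be made non-empty: if one of them is empty,
  any vertex may change its colour.

  The search is a bounded first-order formula over the states. It is written in an expression
  language with bounded sums, whose compilation to the machine takes time polynomial in the
  common bound of all sums.
\<close>

text \<open>One bit per pair is enough: once a pair has a common neighbour of its colour, a second
  one already completes a forbidden \<open>C\<^sub>4\<close>, so no count beyond one has to be kept.
  The bits may overstate the truth. A mark in excess only makes later conditions harder to meet, so
  soundness asks for one implication, while completeness uses the states whose bits are exact.

  Any fixed power of \<open>S\<close> is affordable, since \<open>S ^ K\<close> is still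
  \<open>2 ^ O(t\<^sup>2)\<close>. This is why quantifiers, products and single bits may all be
  computed by exhaustive sums on a machine that only adds and subtracts. The numbers of vertices and
  nodes leave no such freedom: adjacency must be looked up at a cost independent of them, children
  must be treated before parents without recursion, and the adjacency lists must have linear total
  length for fixed width. The last holds because each edge lies in a bag, which gives at most
  \<open>k\<^sup>2\<close> ordered pairs per node.\<close>

section \<open>Machine executions with a time bound and a postcondition\<close>

definition runs :: "com \<Rightarrow> state \<Rightarrow> nat \<Rightarrow> (state \<Rightarrow> bool) \<Rightarrow> bool" where
  "runs c s t Q \<longleftrightarrow> (\<exists>\<tau> s'. exec c s \<tau> s' \<and> \<tau> \<le> t \<and> Q s')"

lemma runs_mono: "runs c s t Q \<Longrightarrow> t \<le> t' \<Longrightarrow> (\<And>s'. Q s' \<Longrightarrow> Q' s') \<Longrightarrow> runs c s t' Q'"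
  unfolding runs_def by (meson le_trans)

lemma runs_Seq: "runs c s t (\<lambda>s'. runs d s' t' Q) \<Longrightarrow> runs (Seq c d) s (t + t' + 1) Q"
  unfolding runs_def by (fastforce intro: exec.Seq)

lemma runs_Assign: "Q (s\<lparr>regs := (regs s)(x := val a s)\<rparr>) \<Longrightarrow> runs (Assign x a) s (cost a + 1) Q"
  unfolding runs_def by (blast intro: exec.Assign)

lemma runs_Store:
  "Q (s\<lparr>mem := (mem s)(val a s := val b s)\<rparr>) \<Longrightarrow> runs (Store a b) s (cost a + cost b + 1) Q"
  unfolding runs_def by (blast intro: exec.Store)

text \<open>With an equation as postcondition, \<open>runs_mono\<close> leaves the final state as a
  rewrite rule instead of a higher-order unification problem.\<close>

lemma runs_Assign_eq:
  "runs (Assign x a) s (cost a + 1) (\<lambda>s'. s' = s\<lparr>regs := (regs s)(x := val a s)\<rparr>)"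
  by (rule runs_Assign) (rule refl)

lemma runs_Store_eq:
  "runs (Store a b) s (cost a + cost b + 1) (\<lambda>s'. s' = s\<lparr>mem := (mem s)(val a s := val b s)\<rparr>)"
  by (rule runs_Store) (rule refl)

lemma runs_If:
  "(val a s \<noteq> 0 \<Longrightarrow> runs c s t Q) \<Longrightarrow> (val a s = 0 \<Longrightarrow> runs d s t Q) \<Longrightarrow>
   runs (If a c d) s (cost a + t + 1) Q"
  unfolding runs_def by (cases "val a s = 0") (fastforce intro: exec.If_true exec.If_false)+

text \<open>Truncated subtraction makes the condition nonzero exactly while the counter is below the
  limit. The 4 in each summand and the last 4 are the price of one test: 3 for the expression, 1 for
  the command.\<close>

lemma runs_count_loop:
  assumes inv: "\<And>v s. I v s \<Longrightarrow> regs s x = v \<and> regs s l = n"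
    and step: "\<And>v s. v < n \<Longrightarrow> I v s \<Longrightarrow> runs c s (b v) (I (Suc v))"
    and init: "I 0 s"
  shows "runs (While (Minus (Reg l) (Reg x)) c) s ((\<Sum>v<n. b v + 4) + 4) (I n)"
proof -
  \<comment> \<open>The induction runs downwards from \<open>n\<close>, because the time still to be
    spent at counter value \<open>v\<close> is the sum over \<open>v..<n\<close>.\<close>
  have "\<forall>s. I v s \<longrightarrow> runs (While (Minus (Reg l) (Reg x)) c) s ((\<Sum>u\<in>{v..<n}. b u + 4) + 4) (I n)"
    if "v \<le> n" for v
    using that
  proof (induction rule: inc_induct)
    case base
    show ?case
    proof (intro allI impI)
      fix s assume "I n s"
      then show "runs (While (Minus (Reg l) (Reg x)) c) s ((\<Sum>u\<in>{n..<n}. b u + 4) + 4) (I n)"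
        using inv[of n s] exec.While_false[of "Minus (Reg l) (Reg x)" s c]
        by (fastforce simp: runs_def)
    qed
  next
    case (step v)
    show ?case
    proof (intro allI impI)
      fix s assume I: "I v s"
      from assms(2)[OF step(2) I] obtain i s' where 1: "exec c s i s'" "i \<le> b v" "I (Suc v) s'"
        by (auto simp: runs_def)
      with step.IH obtain j s'' where
        2: "exec (While (Minus (Reg l) (Reg x)) c) s' j s''"
          "j \<le> (\<Sum>u\<in>{Suc v..<n}. b u + 4) + 4" "I n s''"
        by (auto simp: runs_def)
      have "val (Minus (Reg l) (Reg x)) s \<noteq> 0"
        using inv[OF I] step by simp
      from exec.While_true[OF this 1(1) 2(1)] 1(2) 2(2,3) step(2)
      show "runs (While (Minus (Reg l) (Reg x)) c) s ((\<Sum>u\<in>{v..<n}. b u + 4) + 4) (I n)"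
        unfolding runs_def by (fastforce simp: sum.atLeast_Suc_lessThan)
    qed
  qed
  from this[of 0] init show ?thesis by (simp add: atLeast0LessThan)
qed

section \<open>Expressions with bounded sums\<close>

text \<open>Registers from \<open>nvar\<close> on are scratch space of the compiler. All sums range below the
  value of the one register \<open>lreg\<close>, so that the time of an expression depends on that
  value only.\<close>

abbreviation nvar :: nat where "nvar \<equiv> 100"
abbreviation lreg :: nat where "lreg \<equiv> 2"

datatype fx = C nat | V nat | Add fx fx | Sub fx fx | Ld fx | Ite fx fx fx | Sum nat fx

primrec eval :: "fx \<Rightarrow> (nat \<Rightarrow> nat) \<Rightarrow> (nat \<Rightarrow> nat) \<Rightarrow> nat" where
  "eval (C k) \<rho> \<mu> = k"
| "eval (V x) \<rho> \<mu> = \<rho> x"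
| "eval (Add a b) \<rho> \<mu> = eval a \<rho> \<mu> + eval b \<rho> \<mu>"
| "eval (Sub a b) \<rho> \<mu> = eval a \<rho> \<mu> - eval b \<rho> \<mu>"
| "eval (Ld a) \<rho> \<mu> = \<mu> (eval a \<rho> \<mu>)"
| "eval (Ite c a b) \<rho> \<mu> = (if eval c \<rho> \<mu> \<noteq> 0 then eval a \<rho> \<mu> else eval b \<rho> \<mu>)"
| "eval (Sum x a) \<rho> \<mu> = (\<Sum>v<\<rho> lreg. eval a (\<rho>(x := v)) \<mu>)"

text \<open>Keeping summation variables different from \<open>lreg\<close> makes the common bound
  constant inside all sums, so that \<open>tc\<close> can take it as a number.\<close>

primrec wfx :: "fx \<Rightarrow> bool" where
  "wfx (C k) \<longleftrightarrow> True"
| "wfx (V x) \<longleftrightarrow> x < nvar"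
| "wfx (Add a b) \<longleftrightarrow> wfx a \<and> wfx b"
| "wfx (Sub a b) \<longleftrightarrow> wfx a \<and> wfx b"
| "wfx (Ld a) \<longleftrightarrow> wfx a"
| "wfx (Ite c a b) \<longleftrightarrow> wfx c \<and> wfx a \<and> wfx b"
| "wfx (Sum x a) \<longleftrightarrow> x < nvar \<and> x \<noteq> lreg \<and> wfx a"

text \<open>Registers are used as a stack: the value goes to \<open>d\<close>, and everything above
  \<open>d\<close> is free. For a sum, \<open>d\<close> holds the total, \<open>d + 1\<close> the
  counter, \<open>d + 2\<close> the saved value of the summation variable, and the body works from
  \<open>d + 3\<close> on.\<close>

primrec cmp :: "fx \<Rightarrow> nat \<Rightarrow> com" where
  "cmp (C k) d = Assign d (Const k)"
| "cmp (V x) d = Assign d (Reg x)"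
| "cmp (Add a b) d =
     Seq (cmp a d) (Seq (cmp b (d + 1)) (Assign d (Plus (Reg d) (Reg (d + 1)))))"
| "cmp (Sub a b) d =
     Seq (cmp a d) (Seq (cmp b (d + 1)) (Assign d (Minus (Reg d) (Reg (d + 1)))))"
| "cmp (Ld a) d = Seq (cmp a d) (Assign d (Load (Reg d)))"
| "cmp (Ite c a b) d = Seq (cmp c d) (If (Reg d) (cmp a d) (cmp b d))"
| "cmp (Sum x a) d =
     Seq (Assign d (Const 0)) (Seq (Assign (d + 1) (Const 0)) (Seq (Assign (d + 2) (Reg x))
      (Seq (While (Minus (Reg lreg) (Reg (d + 1)))
             (Seq (Assign x (Reg (d + 1))) (Seq (cmp a (d + 3))
               (Seq (Assign d (Plus (Reg d) (Reg (d + 3))))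
                 (Assign (d + 1) (Plus (Reg (d + 1)) (Const 1)))))))
        (Assign x (Reg (d + 2))))))"

text \<open>Only an upper bound: both branches of \<open>Ite\<close> are charged, which removes any
  dependence on the state other than through \<open>B\<close>.\<close>

primrec tc :: "fx \<Rightarrow> nat \<Rightarrow> nat" where
  "tc (C k) B = 2"
| "tc (V x) B = 2"
| "tc (Add a b) B = tc a B + tc b B + 6"
| "tc (Sub a b) B = tc a B + tc b B + 6"
| "tc (Ld a) B = tc a B + 4"
| "tc (Ite c a b) B = tc c B + tc a B + tc b B + 3"
| "tc (Sum x a) B = B * (tc a B + 17) + 16"

text \<open>Being zero on the scratch registers makes the environments before and after compiled
  code equal as functions, although the scratch contents differ.\<close>

definition named :: "state \<Rightarrow> nat \<Rightarrow> nat" where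
  "named s = (\<lambda>x. if x < nvar then regs s x else 0)"

lemma named_eqI: "(\<And>x. x < nvar \<Longrightarrow> regs s x = regs s' x) \<Longrightarrow> named s = named s'"
  by (auto simp: named_def)

text \<open>The induction needs all registers below \<open>d\<close> preserved, not only the named
  ones: a first operand waits in scratch register \<open>d\<close> while the second is computed from
  \<open>d + 1\<close> on.\<close>

lemma cmp_correct:
  assumes "wfx e" "nvar \<le> d"
  shows "runs (cmp e d) s (tc e (regs s lreg))
    (\<lambda>s'. regs s' d = eval e (named s) (mem s) \<and> (\<forall>x<d. regs s' x = regs s x) \<and> mem s' = mem s)"
  using assms
proof (induction e arbitrary: d s)
  case (C k)
  show ?case
    unfolding cmp.simps by (rule runs_mono[OF runs_Assign_eq]) auto
next
  case (V x)
  then show ?case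
    unfolding cmp.simps by (intro runs_mono[OF runs_Assign_eq]) (auto simp: named_def)
next
  case (Add a b)
  show ?case unfolding cmp.simps
  proof (rule runs_mono[OF runs_Seq[OF runs_mono[OF Add.IH(1) order.refl]] _ iffD1[OF refl]])
    fix s' :: state assume s': "regs s' d = eval a (named s) (mem s) \<and> (\<forall>x<d. regs s' x = regs s x) \<and> mem s' = mem s"
    with Add.prems have n: "named s' = named s" "regs s' lreg = regs s lreg"
      by (auto intro!: named_eqI)
    show "runs (Seq (cmp b (d + 1)) (Assign d (Plus (Reg d) (Reg (d + 1))))) s' (tc b (regs s lreg) + 4 + 1)
      (\<lambda>s'. regs s' d = eval (Add a b) (named s) (mem s) \<and> (\<forall>x<d. regs s' x = regs s x) \<and> mem s' = mem s)"
      using Add.prems s' n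
      by (intro runs_Seq runs_mono[OF Add.IH(2)] runs_mono[OF runs_Assign_eq]) auto
  qed (use Add.prems in auto)
next
  case (Sub a b)
  show ?case unfolding cmp.simps
  proof (rule runs_mono[OF runs_Seq[OF runs_mono[OF Sub.IH(1) order.refl]] _ iffD1[OF refl]])
    fix s' :: state assume s': "regs s' d = eval a (named s) (mem s) \<and> (\<forall>x<d. regs s' x = regs s x) \<and> mem s' = mem s"
    with Sub.prems have n: "named s' = named s" "regs s' lreg = regs s lreg"
      by (auto intro!: named_eqI)
    show "runs (Seq (cmp b (d + 1)) (Assign d (Minus (Reg d) (Reg (d + 1))))) s' (tc b (regs s lreg) + 4 + 1)
      (\<lambda>s'. regs s' d = eval (Sub a b) (named s) (mem s) \<and> (\<forall>x<d. regs s' x = regs s x) \<and> mem s' = mem s)"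
      using Sub.prems s' n
      by (intro runs_Seq runs_mono[OF Sub.IH(2)] runs_mono[OF runs_Assign_eq]) auto
  qed (use Sub.prems in auto)
next
  case (Ld a)
  show ?case unfolding cmp.simps
    apply (rule runs_mono[OF runs_Seq])
      apply (rule runs_mono[OF Ld.IH order.refl])
    using Ld.prems apply simp
    using Ld.prems apply simp
      apply (rule runs_mono[OF runs_Assign_eq order.refl])
      apply auto
    done
next
  case (Ite c a b)
  show ?case unfolding cmp.simps
  proof (rule runs_mono[OF runs_Seq[OF runs_mono[OF Ite.IH(1) order.refl]] _ iffD1[OF refl]])
    fix s' :: state assume s': "regs s' d = eval c (named s) (mem s) \<and> (\<forall>x<d. regs s' x = regs s x) \<and> mem s' = mem s"
    with Ite.prems have n: "named s' = named s" "regs s' lreg = regs s lreg"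
      by (auto intro!: named_eqI)
    show "runs (If (Reg d) (cmp a d) (cmp b d)) s' (cost (Reg d) + (tc a (regs s lreg) + tc b (regs s lreg)) + 1)
      (\<lambda>s'. regs s' d = eval (Ite c a b) (named s) (mem s) \<and> (\<forall>x<d. regs s' x = regs s x) \<and> mem s' = mem s)"
      using Ite.prems s' n
      by (intro runs_If) (rule runs_mono[OF Ite.IH(2)] runs_mono[OF Ite.IH(3)]; auto)+
  qed (use Ite.prems in auto)
next
  case (Sum x a)
  let ?n = "regs s lreg"
  let ?f = "\<lambda>v. eval a ((named s)(x := v)) (mem s)"
  let ?W = "While (Minus (Reg lreg) (Reg (d + 1)))
             (Seq (Assign x (Reg (d + 1))) (Seq (cmp a (d + 3))
               (Seq (Assign d (Plus (Reg d) (Reg (d + 3))))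
                 (Assign (d + 1) (Plus (Reg (d + 1)) (Const 1))))))"
  \<comment> \<open>The summation variable \<open>x\<close> is exempt from preservation during the
    loop; its old value waits in \<open>d + 2\<close> and is restored at the end.\<close>
  define I where "I v (s' :: state) \<longleftrightarrow> regs s' d = (\<Sum>u<v. ?f u) \<and> regs s' (d + 1) = v \<and>
    regs s' (d + 2) = regs s x \<and> (\<forall>y<d. y \<noteq> x \<longrightarrow> regs s' y = regs s y) \<and> mem s' = mem s" for v s'
  have step: "runs (Seq (Assign x (Reg (d + 1))) (Seq (cmp a (d + 3))
               (Seq (Assign d (Plus (Reg d) (Reg (d + 3))))
                 (Assign (d + 1) (Plus (Reg (d + 1)) (Const 1)))))) s' (tc a ?n + 13) (I (Suc v))"
    if "I v s'" for v and s' :: state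
  proof -
    let ?s = "s'\<lparr>regs := (regs s')(x := regs s' (d + 1))\<rparr>"
    have n: "named ?s = (named s)(x := v)" "regs ?s lreg = regs s lreg"
      using Sum.prems that by (auto simp: I_def named_def)
    have "runs (Seq (Assign x (Reg (d + 1))) (Seq (cmp a (d + 3))
               (Seq (Assign d (Plus (Reg d) (Reg (d + 3))))
                 (Assign (d + 1) (Plus (Reg (d + 1)) (Const 1))))))
         s' (2 + (tc a ?n + (4 + 4 + 1) + 1) + 1) (I (Suc v))"
      using Sum.prems that n
      apply (intro runs_Seq)
      apply (rule runs_mono[OF runs_Assign[where Q="\<lambda>s''. s'' = ?s"]])
        apply simp
       apply simp
      apply (rule runs_Seq)
      apply (rule runs_mono[OF Sum.IH])
         apply simp
        apply simp
       apply (simp add: n[simplified])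
      apply (rule runs_Seq)
      apply (rule runs_mono[OF runs_Assign_eq])
       apply simp
      apply (rule runs_mono[OF runs_Assign_eq])
       apply simp
      apply (auto simp: I_def n[simplified] fun_upd_def)
      done
    then show ?thesis by (rule runs_mono) auto
  qed
  have loop: "runs ?W s' ((\<Sum>v<?n. tc a ?n + 13 + 4) + 4) (I ?n)" if "I 0 s'" for s' :: state
    by (rule runs_count_loop[OF _ step that]) (use Sum.prems in \<open>auto simp: I_def\<close>)
  have "runs (cmp (Sum x a) d) s (2 + (2 + (2 + (((\<Sum>v<?n. tc a ?n + 13 + 4) + 4) + 2 + 1) + 1) + 1) + 1)
     (\<lambda>s'. regs s' d = eval (Sum x a) (named s) (mem s) \<and> (\<forall>x<d. regs s' x = regs s x) \<and> mem s' = mem s)"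
    unfolding cmp.simps
    apply (rule runs_Seq, rule runs_mono[OF runs_Assign_eq], simp)+
    apply (rule runs_Seq)
    apply (rule runs_mono[OF loop order.refl])
    using Sum.prems apply (simp add: I_def)
    apply (rule runs_mono[OF runs_Assign_eq])
     apply simp
    using Sum.prems apply (auto simp: I_def named_def)
    done
  then show ?case by (rule runs_mono) auto
qed

text \<open>The base absorbs every overhead in \<open>tc\<close>, so each constructor costs at most
  one more factor; for sums this is \<open>B + (17 * B + 16) \<le> 18 * (B + 1)\<close>. The
  exponent depends on the expression alone, so a fixed formula takes time polynomial in the
  bound.\<close>

lemma tc_bound: "tc e B \<le> (18 * (B + 1)) ^ Suc (size e)"
proof (induction e)
  case (Sum x a)
  let ?X = "18 * (B + 1)"
  have "tc (Sum x a) B \<le> B * (?X ^ Suc (size a) + 17) + 16" using Sum by simp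
  also have "\<dots> = B * ?X ^ Suc (size a) + (17 * B + 16)"
    by (simp only: distrib_left)
  also have "\<dots> \<le> B * ?X ^ Suc (size a) + (17 * B + 16) * ?X ^ Suc (size a)"
    using mult_le_mono2[of 1 "?X ^ Suc (size a)" "17 * B + 16"]
    by (simp only: add_le_cancel_left mult_1_right) simp
  also have "\<dots> \<le> ?X * ?X ^ Suc (size a)"
    unfolding distrib_right[symmetric] by (rule mult_right_mono) auto
  finally show ?case by simp
next
  case (Add a b)
  let ?X = "18 * (B + 1)"
  have "?X ^ Suc (size a) \<le> ?X ^ Suc (size a + size b)" "?X ^ Suc (size b) \<le> ?X ^ Suc (size a + size b)"
    "1 \<le> ?X ^ Suc (size a + size b)"
    by (rule power_increasing; simp)+ simp
  then have "tc (Add a b) B \<le> 8 * ?X ^ Suc (size a + size b)"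
    unfolding tc.simps using Add.IH by linarith
  also have "\<dots> \<le> ?X * ?X ^ Suc (size a + size b)" by (rule mult_right_mono) auto
  finally show ?case by simp
next
  case (Sub a b)
  let ?X = "18 * (B + 1)"
  have "?X ^ Suc (size a) \<le> ?X ^ Suc (size a + size b)" "?X ^ Suc (size b) \<le> ?X ^ Suc (size a + size b)"
    "1 \<le> ?X ^ Suc (size a + size b)"
    by (rule power_increasing; simp)+ simp
  then have "tc (Sub a b) B \<le> 8 * ?X ^ Suc (size a + size b)"
    unfolding tc.simps using Sub.IH by linarith
  also have "\<dots> \<le> ?X * ?X ^ Suc (size a + size b)" by (rule mult_right_mono) auto
  finally show ?case by simp
next
  case (Ld a)
  let ?X = "18 * (B + 1)"
  have "1 \<le> ?X ^ Suc (size a)" by simp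
  then have "tc (Ld a) B \<le> 5 * ?X ^ Suc (size a)"
    unfolding tc.simps using Ld.IH by linarith
  also have "\<dots> \<le> ?X * ?X ^ Suc (size a)" by (rule mult_right_mono) auto
  finally show ?case by simp
next
  case (Ite c a b)
  let ?X = "18 * (B + 1)" and ?n = "Suc (size c + size a + size b)"
  have "?X ^ Suc (size c) \<le> ?X ^ ?n" "?X ^ Suc (size a) \<le> ?X ^ ?n" "?X ^ Suc (size b) \<le> ?X ^ ?n"
    "1 \<le> ?X ^ ?n"
    by (rule power_increasing; simp)+ simp
  then have "tc (Ite c a b) B \<le> 6 * ?X ^ ?n"
    unfolding tc.simps using Ite.IH by linarith
  also have "\<dots> \<le> ?X * ?X ^ ?n" by (rule mult_right_mono) auto
  finally show ?case by simp
qed simp_all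

section \<open>Programs with counting loops\<close>

text \<open>Sums all run up to the one bound in \<open>lreg\<close>. A \<open>For\<close> loop has a
  limit of its own, so that vertices, adjacency lists and nodes can be traversed in linear
  time.\<close>

datatype st = Asg nat fx | Sto fx fx | Sq st st | For nat fx st

type_synonym conf = "(nat \<Rightarrow> nat) \<times> (nat \<Rightarrow> nat)"

definition setv :: "nat \<Rightarrow> nat \<Rightarrow> conf \<Rightarrow> conf" where
  "setv x v \<sigma> = ((fst \<sigma>)(x := v), snd \<sigma>)"

primrec run :: "st \<Rightarrow> conf \<Rightarrow> conf" where
  "run (Asg x e) \<sigma> = setv x (eval e (fst \<sigma>) (snd \<sigma>)) \<sigma>"
| "run (Sto a e) \<sigma> =
     (fst \<sigma>, (snd \<sigma>)(eval a (fst \<sigma>) (snd \<sigma>) := eval e (fst \<sigma>) (snd \<sigma>)))"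
| "run (Sq p q) \<sigma> = run q (run p \<sigma>)"
| "run (For x e p) \<sigma> = fold (\<lambda>v \<sigma>. run p (setv x v \<sigma>)) [0..<eval e (fst \<sigma>) (snd \<sigma>)] \<sigma>"

text \<open>The cost follows the actual configurations of the run, so iterations may differ in cost.
  The total over all adjacency lists is bounded in this way.\<close>

primrec tm :: "st \<Rightarrow> conf \<Rightarrow> nat" where
  "tm (Asg x e) \<sigma> = tc e (fst \<sigma> lreg) + 3"
| "tm (Sto a e) \<sigma> = tc a (fst \<sigma> lreg) + tc e (fst \<sigma> lreg) + 5"
| "tm (Sq p q) \<sigma> = tm p \<sigma> + tm q (run p \<sigma>) + 1"
| "tm (For x e p) \<sigma> = tc e (fst \<sigma> lreg) + 8 +
     (\<Sum>v<eval e (fst \<sigma>) (snd \<sigma>).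
        tm p (setv x v (fold (\<lambda>v \<sigma>. run p (setv x v \<sigma>)) [0..<v] \<sigma>)) + 12)"

primrec wfs :: "st \<Rightarrow> bool" where
  "wfs (Asg x e) \<longleftrightarrow> x < nvar \<and> wfx e"
| "wfs (Sto a e) \<longleftrightarrow> wfx a \<and> wfx e"
| "wfs (Sq p q) \<longleftrightarrow> wfs p \<and> wfs q"
| "wfs (For x e p) \<longleftrightarrow> x < nvar \<and> wfx e \<and> wfs p"

primrec cs :: "st \<Rightarrow> nat \<Rightarrow> com" where
  "cs (Asg x e) d = Seq (cmp e d) (Assign x (Reg d))"
| "cs (Sto a e) d = Seq (cmp a d) (Seq (cmp e (d + 1)) (Store (Reg d) (Reg (d + 1))))"
| "cs (Sq p q) d = Seq (cs p d) (cs q d)"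
| "cs (For x e p) d =
     Seq (cmp e d) (Seq (Assign (d + 1) (Const 0))
      (While (Minus (Reg d) (Reg (d + 1)))
        (Seq (Assign x (Reg (d + 1))) (Seq (cs p (d + 2))
          (Assign (d + 1) (Plus (Reg (d + 1)) (Const 1)))))))"

text \<open>Named registers may now change; the protected ones are the scratch registers below
  \<open>d\<close>, which hold the limits and counters of enclosing loops.\<close>

lemma cs_correct:
  assumes "wfs p" "nvar \<le> d"
  shows "runs (cs p d) s (tm p (named s, mem s))
    (\<lambda>s'. (named s', mem s') = run p (named s, mem s) \<and> (\<forall>x<d. nvar \<le> x \<longrightarrow> regs s' x = regs s x))"
  using assms
proof (induction p arbitrary: d s)
  case (Asg x e)
  then have l: "named s lreg = regs s lreg" by (simp add: named_def)
  have "runs (cs (Asg x e) d) s (tc e (regs s lreg) + 2 + 1)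
    (\<lambda>s'. (named s', mem s') = run (Asg x e) (named s, mem s) \<and> (\<forall>x<d. nvar \<le> x \<longrightarrow> regs s' x = regs s x))"
    unfolding cs.simps
    apply (rule runs_Seq)
    apply (rule runs_mono[OF cmp_correct order.refl])
    using Asg.prems apply simp
    using Asg.prems apply simp
    apply (rule runs_mono[OF runs_Assign_eq])
     apply simp
    using Asg.prems apply (auto simp: named_def setv_def fun_eq_iff)
    done
  with l show ?case by (auto elim!: runs_mono)
next
  case (Sto a e)
  then have l: "named s lreg = regs s lreg" by (simp add: named_def)
  have "runs (cs (Sto a e) d) s (tc a (regs s lreg) + (tc e (regs s lreg) + 3 + 1) + 1)
    (\<lambda>s'. (named s', mem s') = run (Sto a e) (named s, mem s) \<and> (\<forall>x<d. nvar \<le> x \<longrightarrow> regs s' x = regs s x))"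
    unfolding cs.simps
  proof (rule runs_Seq, rule runs_mono[OF cmp_correct order.refl])
    fix s' :: state assume s': "regs s' d = eval a (named s) (mem s) \<and> (\<forall>x<d. regs s' x = regs s x) \<and> mem s' = mem s"
    with Sto.prems have n: "named s' = named s" "regs s' lreg = regs s lreg"
      by (auto intro!: named_eqI)
    show "runs (Seq (cmp e (d + 1)) (Store (Reg d) (Reg (d + 1)))) s' (tc e (regs s lreg) + 3 + 1)
      (\<lambda>s'. (named s', mem s') = run (Sto a e) (named s, mem s) \<and> (\<forall>x<d. nvar \<le> x \<longrightarrow> regs s' x = regs s x))"
      apply (rule runs_Seq)
      apply (rule runs_mono[OF cmp_correct])
      using Sto.prems apply simp
      using Sto.prems apply simp
       apply (simp add: n)
      apply (rule runs_mono[OF runs_Store_eq])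
       apply simp
      using s' Sto.prems n apply (auto simp: named_def fun_eq_iff)
      done
  qed (use Sto.prems in auto)
  with l show ?case by (auto elim!: runs_mono)
next
  case (Sq p q)
  show ?case
    unfolding cs.simps tm.simps
    apply (rule runs_Seq)
    apply (rule runs_mono[OF Sq.IH(1) order.refl])
    using Sq.prems apply simp
    using Sq.prems apply simp
    apply (rule runs_mono[OF Sq.IH(2)])
    using Sq.prems apply simp
    using Sq.prems apply simp
     apply simp
    apply auto
    done
next
  case (For x e p)
  let ?\<sigma> = "(named s, mem s)"
  let ?n = "eval e (named s) (mem s)"
  let ?\<tau> = "\<lambda>v. fold (\<lambda>v \<sigma>. run p (setv x v \<sigma>)) [0..<v] ?\<sigma>"
  define I where "I v (s' :: state) \<longleftrightarrow> regs s' d = ?n \<and> regs s' (d + 1) = v \<and>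
    (named s', mem s') = ?\<tau> v \<and> (\<forall>y<d. nvar \<le> y \<longrightarrow> regs s' y = regs s y)" for v s'
  have l: "named s lreg = regs s lreg" by (simp add: named_def)
  have step: "runs (Seq (Assign x (Reg (d + 1))) (Seq (cs p (d + 2))
          (Assign (d + 1) (Plus (Reg (d + 1)) (Const 1))))) s'
       (2 + (tm p (setv x v (?\<tau> v)) + 4 + 1) + 1) (I (Suc v))"
    if I: "I v s'" for v and s' :: state
  proof -
    let ?s = "s'\<lparr>regs := (regs s')(x := regs s' (d + 1))\<rparr>"
    have n: "(named ?s, mem ?s) = setv x v (?\<tau> v)"
    proof -
      have "named ?s = (named s')(x := v)"
        using For.prems that by (auto simp: I_def named_def)
      then show ?thesis using I by (simp add: I_def setv_def prod_eq_iff)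
    qed
    have nu: "named (s\<lparr>regs := (regs s)(Suc d := u)\<rparr>) = named s" for s :: state and u
      using For.prems by (auto simp: named_def)
    show ?thesis
      apply (rule runs_Seq)
      apply (rule runs_mono[OF runs_Assign[where Q="\<lambda>s''. s'' = ?s"]])
        apply simp
       apply simp
      apply (rule runs_Seq)
      apply (rule runs_mono[OF For.IH])
      using For.prems apply simp
      using For.prems apply simp
       apply (simp only: n order.refl)
      apply (rule runs_mono[OF runs_Assign_eq])
       apply simp
      using I For.prems n apply (auto simp: I_def nu)
      done
  qed
  have loop: "runs (While (Minus (Reg d) (Reg (d + 1)))
        (Seq (Assign x (Reg (d + 1))) (Seq (cs p (d + 2))
          (Assign (d + 1) (Plus (Reg (d + 1)) (Const 1)))))) s'
     ((\<Sum>v<?n. 2 + (tm p (setv x v (?\<tau> v)) + 4 + 1) + 1 + 4) + 4) (I ?n)" if "I 0 s'" for s' :: state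
    by (rule runs_count_loop[OF _ step that]) (auto simp: I_def)
  have "runs (cs (For x e p) d) s (tc e (regs s lreg) + (2 +
     ((\<Sum>v<?n. 2 + (tm p (setv x v (?\<tau> v)) + 4 + 1) + 1 + 4) + 4) + 1) + 1) (I ?n)"
    unfolding cs.simps
    apply (rule runs_Seq)
    apply (rule runs_mono[OF cmp_correct order.refl])
    using For.prems apply simp
    using For.prems apply simp
    apply (rule runs_Seq)
    apply (rule runs_mono[OF runs_Assign_eq])
     apply simp
    apply (rule runs_mono[OF loop order.refl])
    using For.prems apply (auto simp: I_def intro!: named_eqI)
    done
  then show ?case
    by (rule runs_mono) (auto simp: I_def l add.commute)
qed

section \<open>Verification rules for structured programs\<close>

text \<open>From here on programs are verified on \<open>run\<close> and \<open>tm\<close>;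
  \<open>cs_correct\<close> transfers the outcome to the machine once, at the end.\<close>

definition meets :: "st \<Rightarrow> conf \<Rightarrow> nat \<Rightarrow> (conf \<Rightarrow> bool) \<Rightarrow> bool" where
  "meets p \<sigma> t Q \<longleftrightarrow> Q (run p \<sigma>) \<and> tm p \<sigma> \<le> t"

lemma meets_Sq: "meets p \<sigma> t (\<lambda>\<sigma>'. meets q \<sigma>' t' Q) \<Longrightarrow> meets (Sq p q) \<sigma> (t + t' + 1) Q"
  by (simp add: meets_def)

lemma meets_mono: "meets p \<sigma> t Q \<Longrightarrow> t \<le> t' \<Longrightarrow> (\<And>\<sigma>'. Q \<sigma>' \<Longrightarrow> Q' \<sigma>') \<Longrightarrow> meets p \<sigma> t' Q'"
  by (auto simp: meets_def)

lemma meets_For: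
  assumes "I 0 \<sigma>"
    and "\<And>v \<sigma>'. v < eval e (fst \<sigma>) (snd \<sigma>) \<Longrightarrow> I v \<sigma>' \<Longrightarrow> meets p (setv x v \<sigma>') (b v) (I (Suc v))"
  shows "meets (For x e p) \<sigma>
    (tc e (fst \<sigma> lreg) + 8 + (\<Sum>v<eval e (fst \<sigma>) (snd \<sigma>). b v + 12)) (I (eval e (fst \<sigma>) (snd \<sigma>)))"
proof -
  let ?\<tau> = "\<lambda>v. fold (\<lambda>v \<sigma>. run p (setv x v \<sigma>)) [0..<v] \<sigma>"
  let ?n = "eval e (fst \<sigma>) (snd \<sigma>)"
  have I: "I v (?\<tau> v)" if "v \<le> ?n" for v
    using that by (induction v) (use assms in \<open>auto simp: meets_def\<close>)
  then have "tm p (setv x v (?\<tau> v)) \<le> b v" if "v < ?n" for v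
    using that assms(2) by (auto simp: meets_def)
  then have "(\<Sum>v<?n. tm p (setv x v (?\<tau> v)) + 12) \<le> (\<Sum>v<?n. b v + 12)"
    by (intro sum_mono) auto
  with I[of ?n] show ?thesis by (simp add: meets_def)
qed

section \<open>Rooted trees\<close>

lemma cycle_list_contains_cycle:
  assumes "distinct p" "3 \<le> length p" "set p \<subseteq> verts G"
    and "successively (\<lambda>u v. {u, v} \<in> edges G) p" "{last p, hd p} \<in> edges G"
  shows "contains_subgraph G (cycle_graph (length p))"
  unfolding contains_subgraph_def
proof (intro exI conjI ballI)
  show "inj_on (nth p) (verts (cycle_graph (length p)))"
    using assms(1) by (auto simp: cycle_graph_def inj_on_def nth_eq_iff_index_eq)
  show "nth p ` verts (cycle_graph (length p)) \<subseteq> verts G"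
    using assms(3) by (auto simp: cycle_graph_def)
  fix e assume "e \<in> edges (cycle_graph (length p))"
  then obtain i where i: "i < length p" "e = {i, Suc i mod length p}"
    by (auto simp: cycle_graph_def)
  have "p \<noteq> []" using assms(2) by auto
  show "nth p ` e \<in> edges G"
  proof (cases "Suc i < length p")
    case True
    then show ?thesis using i successively_nth[OF assms(4), of i] by auto
  next
    case False
    then have "i = length p - 1" using i by auto
    then show ?thesis using i assms(5) \<open>p \<noteq> []\<close> by (simp add: last_conv_nth hd_conv_nth)
  qed
qed

text \<open>Cutting out the part between two visits of the same vertex shortens the walk and keeps
  both ends.\<close>

lemma walk_distinct:
  "walk G p \<Longrightarrow> \<exists>q. walk G q \<and> distinct q \<and> hd q = hd p \<and> last q = last p"
proof (induction "length p" arbitrary: p rule: less_induct)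
  case less
  show ?case
  proof (cases "distinct p")
    case False
    then obtain xs y ys zs where p: "p = xs @ [y] @ ys @ [y] @ zs"
      using not_distinct_decomp by blast
    have "walk G (xs @ [y] @ zs)"
      using less.prems unfolding p walk_def
      by (cases zs) (auto simp: successively_append_iff successively_Cons)
    from less.hyps[OF _ this] show ?thesis
      by (cases xs; cases zs) (auto simp: p)
  qed (use less in auto)
qed

text \<open>Serves to find the edge on which a walk leaves a subtree.\<close>

lemma successively_crossing:
  "successively P p \<Longrightarrow> p \<noteq> [] \<Longrightarrow> hd p \<in> S \<Longrightarrow> last p \<notin> S \<Longrightarrow>
   \<exists>a b. a \<in> S \<and> b \<notin> S \<and> P a b \<and> a \<in> set p \<and> b \<in> set p"
proof (induction p rule: induct_list012)
  case (3 x y zs)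
  then show ?case by (cases "y \<in> S") auto
qed auto

locale rooted_tree =
  fixes T :: "'i ugraph" and r :: 'i
  assumes tree: "tree T" and root: "r \<in> verts T"
begin

abbreviation ch :: "'i \<Rightarrow> 'i set" where "ch \<equiv> children T r"

definition parent_rel :: "('i \<times> 'i) set" where "parent_rel = {(i, j). j \<in> ch i}"

definition below :: "'i \<Rightarrow> 'i set" where "below i = {d. (i, d) \<in> parent_rel\<^sup>*}"

lemma simple: "simple_graph T" and conn: "connected_graph T"
  and acyc: "3 \<le> k \<Longrightarrow> \<not> contains_subgraph T (cycle_graph k)"
  using tree by (auto simp: tree_def)

lemma children_verts: "j \<in> ch i \<Longrightarrow> i \<in> verts T \<and> j \<in> verts T"
  by (auto simp: children_def walk_def)

lemma no_cycle_list:
  assumes "distinct p" "3 \<le> length p" "set p \<subseteq> verts T"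
    and "successively (\<lambda>u v. {u, v} \<in> edges T) p" "{last p, hd p} \<in> edges T"
  shows False
  using cycle_list_contains_cycle[OF assms] acyc assms(2) by blast

text \<open>Two paths from the root to \<open>j\<close> through different neighbours of \<open>j\<close> close a cycle at the last
  node of the second path that lies on the first.\<close>

lemma parent_unique:
  assumes "j \<in> ch i" "j \<in> ch i'"
  shows "i = i'"
proof (rule ccontr)
  assume ne: "i \<noteq> i'"
  from assms obtain p p' where
    p: "walk T (p @ [i, j])" "distinct (p @ [i, j])" "hd (p @ [i, j]) = r" and
    p': "walk T (p' @ [i', j])" "distinct (p' @ [i', j])" "hd (p' @ [i', j]) = r"
    by (auto simp: children_def)
  have "r \<in> set (p @ [i])" "r \<in> set (p' @ [i'])"
    using p(3) p'(3) by (cases p; cases p'; auto)+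
  then have "\<exists>z\<in>set (p' @ [i']). z \<in> set (p @ [i])" by blast
  then obtain xs z ys where z: "p' @ [i'] = xs @ z # ys" "z \<in> set (p @ [i])"
    "\<forall>y\<in>set ys. y \<notin> set (p @ [i])"
    using split_list_last_prop[of "p' @ [i']" "\<lambda>z. z \<in> set (p @ [i])"] by blast
  obtain us vs where uv: "p @ [i] = us @ z # vs" using z(2) by (meson split_list)
  have P: "p @ [i, j] = us @ z # vs @ [j]" using uv by simp
  have P': "p' @ [i', j] = xs @ z # ys @ [j]" using z(1) by simp
  let ?c = "z # ys @ [j] @ rev vs"
  have d: "distinct ?c"
    using p(2) p'(2) z(3) unfolding P P' uv by auto
  have len: "3 \<le> length ?c"
  proof (cases "ys = [] \<and> vs = []")
    case True
    then have "i = z" "i' = z" using uv z(1) by auto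
    with ne show ?thesis by simp
  qed (cases ys; cases vs; simp)
  have v: "set ?c \<subseteq> verts T"
    using p(1) p'(1) unfolding P P' by (auto simp: walk_def)
  have s: "successively (\<lambda>u v. {u, v} \<in> edges T) (z # vs @ [j])"
    "successively (\<lambda>u v. {u, v} \<in> edges T) (z # ys @ [j])"
    using p(1) p'(1) unfolding P P' walk_def by (simp_all add: successively_append_iff)
  have "successively (\<lambda>u v. {v, u} \<in> edges T) (rev (z # vs @ [j]))"
    using s(1) unfolding successively_rev by (simp add: insert_commute)
  then have s3: "successively (\<lambda>u v. {u, v} \<in> edges T) (j # rev vs @ [z])"
    by (simp add: insert_commute)
  then have s4: "successively (\<lambda>u v. {u, v} \<in> edges T) (j # rev vs)" "{last (j # rev vs), z} \<in> edges T"
    using successively_append_iff[of _ "j # rev vs" "[z]"] by auto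
  have "successively (\<lambda>u v. {u, v} \<in> edges T) ?c"
    using s(2) s4(1)
    using successively_append_iff[of "\<lambda>u v. {u, v} \<in> edges T" "z # ys" "j # rev vs"]
      successively_append_iff[of "\<lambda>u v. {u, v} \<in> edges T" "z # ys" "[j]"]
    by auto
  moreover have "{last ?c, hd ?c} \<in> edges T" using s4(2) by simp
  ultimately show False using no_cycle_list[OF d len v] by blast
qed

lemma root_no_parent: "r \<notin> ch i"
proof
  assume "r \<in> ch i"
  then obtain p where "distinct (p @ [i, r])" "hd (p @ [i, r]) = r"
    by (auto simp: children_def)
  then show False by (cases p) auto
qed

lemma root_path:
  assumes "v \<in> verts T"
  obtains p where "walk T p" "distinct p" "hd p = r" "last p = v"
  using conn root assms walk_distinct unfolding connected_graph_def by metis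

text \<open>If the path from the root to \<open>a\<close> avoids \<open>b\<close>, it extends to
  \<open>b\<close>. If it contains \<open>b\<close>, then \<open>b\<close> comes immediately before
  \<open>a\<close>, as otherwise the edge would close a cycle.\<close>

lemma tree_edge:
  assumes "{a, b} \<in> edges T"
  shows "b \<in> ch a \<or> a \<in> ch b"
proof -
  have ab: "a \<in> verts T" "b \<in> verts T" "a \<noteq> b"
    using assms simple by (auto simp: simple_graph_def doubleton_eq_iff dest!: bspec)
  obtain p where p: "walk T p" "distinct p" "hd p = r" "last p = a"
    using root_path[OF ab(1)] by blast
  then obtain q where q: "p = q @ [a]"
    by (metis append_butlast_last_id walk_def)
  show ?thesis
  proof (cases "b \<in> set p")
    case False
    have "walk T (q @ [a, b])"
      using p(1) assms ab unfolding q walk_def by (auto simp: successively_append_iff)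
    moreover have "distinct (q @ [a, b])" "hd (q @ [a, b]) = r"
      using p False ab unfolding q by (auto simp: hd_append split: if_splits)
    ultimately show ?thesis by (auto simp: children_def)
  next
    case True
    then obtain p1 p2 where qq: "q = p1 @ b # p2"
      using q ab(3) by (auto dest: split_list)
    show ?thesis
    proof (cases "p2 = []")
      case True
      with p show ?thesis unfolding q qq by (auto simp: children_def)
    next
      case False
      have s: "successively (\<lambda>u v. {u, v} \<in> edges T) (b # p2 @ [a])" "set (b # p2 @ [a]) \<subseteq> verts T"
        using p(1) unfolding walk_def q qq by (auto simp: successively_append_iff)
      have "3 \<le> length (b # p2 @ [a])" using False by (cases p2) auto
      with s assms p(2) have False
        by (intro no_cycle_list[of "b # p2 @ [a]"]) (auto simp: q qq)
      then show ?thesis ..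
    qed
  qed
qed

lemma parent_rel_iff: "(i, j) \<in> parent_rel \<longleftrightarrow> j \<in> ch i"
  by (simp add: parent_rel_def)

lemma root_reaches:
  assumes "v \<in> verts T"
  shows "(r, v) \<in> parent_rel\<^sup>*"
proof -
  have "(r, last p) \<in> parent_rel\<^sup>*" if "walk T p" "distinct p" "hd p = r" for p
    using that
  proof (induction p rule: rev_induct)
    case (snoc j p)
    show ?case
    proof (cases p rule: rev_cases)
      case (snoc q i)
      then have "walk T p" "distinct p" "hd p = r"
        using snoc.prems by (auto simp: walk_def successively_append_iff hd_append split: if_splits)
      then have "(r, i) \<in> parent_rel\<^sup>*" using snoc.IH snoc by simp
      moreover have "j \<in> ch i"
        using snoc.prems snoc by (auto simp: children_def)
      ultimately show ?thesis by (simp add: parent_rel_iff rtrancl.rtrancl_into_rtrancl)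
    qed (use snoc.prems in auto)
  qed (simp add: walk_def)
  with root_path[OF assms] show ?thesis by metis
qed

lemma below_verts: "i \<in> verts T \<Longrightarrow> d \<in> below i \<Longrightarrow> d \<in> verts T"
  unfolding below_def mem_Collect_eq
  by (erule rtranclE) (auto simp: parent_rel_iff dest: children_verts)

lemma below_root: "below r = verts T"
  using root_reaches below_verts[OF root] by (auto simp: below_def)

text \<open>Since parents are unique, a cycle through a node also passes through its parent, and so
  on up to the root, which has no parent.\<close>

lemma parent_rel_irrefl: "(v, v) \<notin> parent_rel\<^sup>+"
proof (cases "v \<in> verts T")
  case True
  from root_reaches[OF this] show ?thesis
  proof (induction rule: rtrancl_induct)
    case base
    show ?case using tranclD2[of r r parent_rel] root_no_parent by (auto simp: parent_rel_iff)
  next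
    case (step y z)
    show ?case
    proof
      assume "(z, z) \<in> parent_rel\<^sup>+"
      then obtain w where w: "(z, w) \<in> parent_rel\<^sup>*" "(w, z) \<in> parent_rel" by (auto dest: tranclD2)
      then have "w = y" using step(2) parent_unique by (auto simp: parent_rel_iff)
      with w step show False by (meson rtrancl_into_trancl2)
    qed
  qed
next
  case False
  then show ?thesis using tranclD[of v v parent_rel] children_verts by (auto simp: parent_rel_iff)
qed

text \<open>Stated for the converse, so that induction and recursion at a node may refer to its
  children.\<close>

lemma wf_parent_rel: "wf (parent_rel\<inverse>)"
proof (rule finite_acyclic_wf_converse)
  have "finite (verts T)" using simple by (simp add: simple_graph_def)
  moreover have "parent_rel \<subseteq> verts T \<times> verts T" using children_verts by (auto simp: parent_rel_iff)
  ultimately show "finite parent_rel" by (meson finite_SigmaI finite_subset)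
  show "acyclic parent_rel" using parent_rel_irrefl by (simp add: acyclic_def)
qed

lemma below_unfold: "below i = insert i (\<Union>j\<in>ch i. below j)"
  unfolding below_def
  by (auto simp: parent_rel_iff elim: converse_rtranclE intro: converse_rtrancl_into_rtrancl)

lemma parent_not_below: "j \<in> ch i \<Longrightarrow> i \<notin> below j"
  using parent_rel_irrefl[of i] rtrancl_into_trancl2[of i j parent_rel i] unfolding below_def
  by (auto simp: parent_rel_iff)

text \<open>The ancestors of a common node form a chain, so one of the two siblings would lie below
  the other. Then their parent would lie below its own child.\<close>

lemma below_disjoint:
  assumes "j \<in> ch i" "j' \<in> ch i" "j \<noteq> j'"
  shows "below j \<inter> below j' = {}"
proof -
  have *: False if "j \<in> ch i" "j' \<in> ch i" "j \<noteq> j'" "(j, j') \<in> parent_rel\<^sup>*" for j j'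
  proof -
    from that(4,3) obtain w where "(j, w) \<in> parent_rel\<^sup>*" "(w, j') \<in> parent_rel"
      by (cases rule: rtrancl.cases) auto
    then have "(j, i) \<in> parent_rel\<^sup>*" using that parent_unique by (auto simp: parent_rel_iff)
    then show False using parent_not_below[OF that(1)] by (simp add: below_def)
  qed
  have sv: "single_valued (parent_rel\<inverse>)"
    using parent_unique by (auto simp: single_valued_def parent_rel_iff)
  have "(j, j') \<in> parent_rel\<^sup>* \<or> (j', j) \<in> parent_rel\<^sup>*" if "d \<in> below j" "d \<in> below j'" for d
    using single_valued_confluent[OF sv, of d j j'] that
    by (auto simp: below_def rtrancl_converse)
  then show ?thesis using *[OF assms] *[of j' j] assms by auto
qed

text \<open>The nodes containing \<open>v\<close> are connected, and the only tree edge leaving the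
  subtree of \<open>j\<close> joins \<open>j\<close> to its parent \<open>i\<close>. Hence both ends
  of this edge contain \<open>v\<close>.\<close>

lemma bag_separation:
  assumes conn: "connected_graph (induced T {i \<in> verts T. v \<in> X i})"
    and j: "j \<in> ch i"
    and d: "d \<in> verts T" "v \<in> X d" "d \<in> below j"
    and e: "e \<in> verts T" "v \<in> X e" "e \<notin> below j"
  shows "v \<in> X i \<and> v \<in> X j"
proof -
  let ?I = "induced T {i \<in> verts T. v \<in> X i}"
  have "d \<in> verts ?I" "e \<in> verts ?I" using d e by (auto simp: induced_def)
  with conn obtain p where p: "walk ?I p" "hd p = d" "last p = e"
    unfolding connected_graph_def by blast
  then obtain a b where ab: "a \<in> below j" "b \<notin> below j" "{a, b} \<in> edges ?I" "a \<in> set p" "b \<in> set p"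
    using successively_crossing[of "\<lambda>u v. {u, v} \<in> edges ?I" p "below j"] d(3) e(3)
    unfolding walk_def by auto
  then have X: "v \<in> X a" "v \<in> X b" and E: "{a, b} \<in> edges T"
    using p(1) by (auto simp: walk_def induced_def)
  have "b \<notin> ch a"
    using ab(1,2) by (auto simp: below_def parent_rel_iff[symmetric] dest: rtrancl_into_rtrancl)
  with tree_edge[OF E] have "a \<in> ch b" by blast
  have "a = j"
  proof (rule ccontr)
    assume "a \<noteq> j"
    from ab(1) this obtain w where "(j, w) \<in> parent_rel\<^sup>*" "(w, a) \<in> parent_rel"
      unfolding below_def mem_Collect_eq by (cases rule: rtrancl.cases) auto
    moreover from this \<open>a \<in> ch b\<close> have "w = b"
      by (intro parent_unique[of a]) (simp_all add: parent_rel_iff)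
    ultimately show False using ab(2) by (simp add: below_def)
  qed
  with \<open>a \<in> ch b\<close> j parent_unique have "b = i" by blast
  with X \<open>a = j\<close> show ?thesis by simp
qed

end

section \<open>Dynamic programming over a tree decomposition\<close>

text \<open>Here \<open>u\<close>, \<open>w\<close> are opposite corners of the cycle and
  \<open>x\<close>, \<open>y\<close> the other two. Adjacent corners are distinct automatically in a
  simple graph.\<close>

definition C4_free_colouring :: "'a ugraph \<Rightarrow> ('a \<Rightarrow> bool) \<Rightarrow> 'a set \<Rightarrow> bool" where
  "C4_free_colouring G f W \<longleftrightarrow>
     (\<forall>u\<in>W. \<forall>w\<in>W. \<forall>x\<in>W. \<forall>y\<in>W. u \<noteq> w \<longrightarrow> f w = f u \<longrightarrow> f x = f u \<longrightarrow> f y = f u \<longrightarrow>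
        {x, u} \<in> edges G \<longrightarrow> {x, w} \<in> edges G \<longrightarrow> {y, u} \<in> edges G \<longrightarrow> {y, w} \<in> edges G \<longrightarrow> x = y)"

lemma C4_free_colouringD:
  "C4_free_colouring G f W \<Longrightarrow> u \<in> W \<Longrightarrow> w \<in> W \<Longrightarrow> x \<in> W \<Longrightarrow> y \<in> W \<Longrightarrow> u \<noteq> w \<Longrightarrow> f w = f u \<Longrightarrow>
   f x = f u \<Longrightarrow> f y = f u \<Longrightarrow> {x, u} \<in> edges G \<Longrightarrow> {x, w} \<in> edges G \<Longrightarrow> {y, u} \<in> edges G \<Longrightarrow>
   {y, w} \<in> edges G \<Longrightarrow> x = y"
  unfolding C4_free_colouring_def by blast

lemma C4_free_colouring_cong:
  "(\<And>v. v \<in> W \<Longrightarrow> f v = g v) \<Longrightarrow> C4_free_colouring G f W \<longleftrightarrow> C4_free_colouring G g W"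
  unfolding C4_free_colouring_def by simp

lemma simple_graph_edgeD:
  assumes "simple_graph G" "{a, b} \<in> edges G"
  shows "a \<noteq> b \<and> a \<in> verts G \<and> b \<in> verts G"
proof -
  obtain u v where "u \<in> verts G" "v \<in> verts G" "u \<noteq> v" "{a, b} = {u, v}"
    using assms unfolding simple_graph_def by blast
  then show ?thesis by (auto simp: doubleton_eq_iff)
qed

lemma contains_C4_iff:
  assumes "simple_graph G"
  shows "contains_subgraph (induced G A) (cycle_graph 4) \<longleftrightarrow>
    (\<exists>u\<in>A. \<exists>w\<in>A. \<exists>x\<in>A. \<exists>y\<in>A. u \<noteq> w \<and> x \<noteq> y \<and> {x, u} \<in> edges G \<and> {x, w} \<in> edges G \<and>
       {y, u} \<in> edges G \<and> {y, w} \<in> edges G)" (is "?l \<longleftrightarrow> ?r")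
proof
  have E: "edges (cycle_graph 4) = {{0, 1}, {1, 2}, {2, 3}, {3, 0}}"
  proof -
    have "{i :: nat. i < 4} = {0, 1, 2, 3}" by auto
    moreover have "edges (cycle_graph 4) = (\<lambda>i. {i, Suc i mod 4}) ` {i. i < 4}"
      by (auto simp: cycle_graph_def)
    moreover have "Suc 0 mod 4 = 1" "Suc 1 mod 4 = 2" "Suc 2 mod 4 = 3" "Suc 3 mod 4 = 0"
      by simp_all
    ultimately show ?thesis by (simp only: image_insert image_empty)
  qed
  {
    assume ?l
    then obtain f where f: "inj_on f {..<4}" "f ` {..<4} \<subseteq> verts (induced G A)"
      "\<forall>e\<in>edges (cycle_graph 4). f ` e \<in> edges (induced G A)"
      by (auto simp: contains_subgraph_def cycle_graph_def)
    have "f 0 \<noteq> f 2" "f 1 \<noteq> f 3" using f(1) by (auto dest: inj_onD)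
    moreover have "f 0 \<in> A" "f 1 \<in> A" "f 2 \<in> A" "f 3 \<in> A"
      using f(2) by (auto simp: induced_def)
    moreover have "{f 0, f 1} \<in> edges G" "{f 1, f 2} \<in> edges G" "{f 2, f 3} \<in> edges G" "{f 3, f 0} \<in> edges G"
      using f(3) by (auto simp: E induced_def)
    ultimately show ?r
      by (intro bexI[of _ "f 0"] bexI[of _ "f 2"] bexI[of _ "f 1"] bexI[of _ "f 3"])
        (auto simp: insert_commute)
  }
  assume ?r
  then obtain u w x y where *: "u \<in> A" "w \<in> A" "x \<in> A" "y \<in> A" "u \<noteq> w" "x \<noteq> y" and
    e: "{x, u} \<in> edges G" "{x, w} \<in> edges G" "{y, u} \<in> edges G" "{y, w} \<in> edges G"
    by blast
  from e[THEN simple_graph_edgeD[OF assms]]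
  have ne: "x \<noteq> u" "x \<noteq> w" "y \<noteq> u" "y \<noteq> w"
    and v: "u \<in> verts G" "w \<in> verts G" "x \<in> verts G" "y \<in> verts G"
    by auto
  have lt4: "{..<4 :: nat} = {0, 1, 2, 3}" by auto
  \<comment> \<open>The corners in cyclic order are \<open>u\<close>, \<open>x\<close>,
    \<open>w\<close>, \<open>y\<close>; the last is the default value and thereby the image of
    3.\<close>
  let ?f = "(\<lambda>_. y)(0 := u, 1 := x, 2 := w) :: nat \<Rightarrow> _"
  show ?l
    unfolding contains_subgraph_def E
    using * ne v e
    by (intro exI[of _ ?f])
      (auto simp: cycle_graph_def induced_def lt4 insert_commute)
qed

lemma C4_free_bipartition_iff:
  assumes G: "simple_graph G"
  shows "C4_free_bipartition G \<longleftrightarrow> 1 < card (verts G) \<and> (\<exists>f. C4_free_colouring G f (verts G))"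
proof
  have fin: "finite (verts G)" using G by (simp add: simple_graph_def)
  {
    assume "C4_free_bipartition G"
    then obtain A B where AB: "A \<union> B = verts G" "A \<inter> B = {}" "A \<noteq> {}" "B \<noteq> {}"
      and C: "\<not> contains_subgraph (induced G A) (cycle_graph 4)"
        "\<not> contains_subgraph (induced G B) (cycle_graph 4)"
      by (auto simp: C4_free_bipartition_def)
    have "card (verts G) = card A + card B"
      using AB fin by (metis card_Un_disjoint finite_Un)
    moreover have "0 < card A" "0 < card B" using AB fin by (auto simp: card_gt_0_iff intro: finite_subset)
    ultimately have "1 < card (verts G)" by linarith
    moreover have "C4_free_colouring G (\<lambda>v. v \<in> A) (verts G)"
      unfolding C4_free_colouring_def
    proof (intro ballI impI)
      fix u w x y
      assume "u \<in> verts G" "w \<in> verts G" "x \<in> verts G" "y \<in> verts G"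
        and c: "(w \<in> A) = (u \<in> A)" "(x \<in> A) = (u \<in> A)" "(y \<in> A) = (u \<in> A)"
        and e: "u \<noteq> w" "{x, u} \<in> edges G" "{x, w} \<in> edges G" "{y, u} \<in> edges G" "{y, w} \<in> edges G"
      then have "{u, w, x, y} \<subseteq> A \<or> {u, w, x, y} \<subseteq> B" using AB(1) by auto
      then show "x = y"
        using C e unfolding contains_C4_iff[OF G] by (elim disjE) (simp; metis)+
    qed
    ultimately show "1 < card (verts G) \<and> (\<exists>f. C4_free_colouring G f (verts G))" by blast
  }
  assume "1 < card (verts G) \<and> (\<exists>f. C4_free_colouring G f (verts G))"
  then obtain f where n: "1 < card (verts G)" and f: "C4_free_colouring G f (verts G)" by blast
  have free: "\<not> contains_subgraph (induced G A) (cycle_graph 4)"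
    if "A \<subseteq> verts G" "\<And>u v. u \<in> A \<Longrightarrow> v \<in> A \<Longrightarrow> f u = f v" for A
    unfolding contains_C4_iff[OF G]
  proof (clarify)
    fix u w x y
    assume *: "u \<in> A" "w \<in> A" "x \<in> A" "y \<in> A" and e: "u \<noteq> w" "x \<noteq> y"
      "{x, u} \<in> edges G" "{x, w} \<in> edges G" "{y, u} \<in> edges G" "{y, w} \<in> edges G"
    have "u \<in> verts G" "w \<in> verts G" "x \<in> verts G" "y \<in> verts G" using * that(1) by blast+
    moreover have "f w = f u" "f x = f u" "f y = f u" using * that(2) by blast+
    ultimately show False using C4_free_colouringD[OF f] e by blast
  qed
  show "C4_free_bipartition G"
  proof (cases "\<forall>u\<in>verts G. \<forall>v\<in>verts G. f u = f v")
    case False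
    let ?A = "{v \<in> verts G. f v}" and ?B = "{v \<in> verts G. \<not> f v}"
    have "\<not> contains_subgraph (induced G ?A) (cycle_graph 4)"
      "\<not> contains_subgraph (induced G ?B) (cycle_graph 4)"
      by (rule free; simp)+
    moreover have "?A \<union> ?B = verts G" "?A \<inter> ?B = {}" "?A \<noteq> {}" "?B \<noteq> {}" using False by auto
    ultimately show ?thesis unfolding C4_free_bipartition_def by blast
  next
    \<comment> \<open>All vertices have one colour, so \<open>free\<close> applies to every subset,
      in particular to a single vertex and to the rest.\<close>
    case True
    from n obtain a where a: "a \<in> verts G" by fastforce
    have "verts G - {a} \<noteq> {}"
    proof
      assume "verts G - {a} = {}"
      then have "verts G = {a}" using a by auto
      with n show False by simp
    qed
    moreover have "\<not> contains_subgraph (induced G {a}) (cycle_graph 4)"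
      "\<not> contains_subgraph (induced G (verts G - {a})) (cycle_graph 4)"
      by (rule free; use a True in blast)+
    moreover have "{a} \<union> (verts G - {a}) = verts G" "{a} \<inter> (verts G - {a}) = {}" using a by auto
    ultimately show ?thesis unfolding C4_free_bipartition_def by blast
  qed
qed

section \<open>Vertices occurring below a node\<close>

locale rooted_decomposition = rooted_tree T r for T :: "'i ugraph" and r +
  fixes G :: "'a ugraph" and X :: "'i \<Rightarrow> 'a set"
  assumes G: "simple_graph G" and decomposition: "tree_decomposition G T X"
begin

abbreviation adj :: "'a \<Rightarrow> 'a \<Rightarrow> bool" where "adj u v \<equiv> {u, v} \<in> edges G"

definition V_below :: "'i \<Rightarrow> 'a set" where "V_below i = (\<Union>d\<in>below i. X d)"

lemma adj_sym: "adj u v \<Longrightarrow> adj v u"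
  by (simp add: insert_commute)

lemma bag_verts: "i \<in> verts T \<Longrightarrow> X i \<subseteq> verts G"
  using decomposition by (auto simp: tree_decomposition_def)

lemma V_below_root: "V_below r = verts G"
  using decomposition unfolding V_below_def below_root tree_decomposition_def by blast

lemma V_below_unfold: "V_below i = X i \<union> (\<Union>j\<in>ch i. V_below j)"
  unfolding V_below_def by (subst below_unfold) auto

lemma separation:
  assumes "j \<in> ch i" "d \<in> below j" "v \<in> X d" "e \<in> verts T" "e \<notin> below j" "v \<in> X e"
  shows "v \<in> X i" "v \<in> X j"
proof -
  have d: "d \<in> verts T" using assms children_verts below_verts by blast
  with bag_verts assms(3) have "v \<in> verts G" by blast
  then have "connected_graph (induced T {i \<in> verts T. v \<in> X i})"
    using decomposition by (auto simp: tree_decomposition_def)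
  from bag_separation[OF this assms(1) d assms(3,2,4,6,5)] show "v \<in> X i" "v \<in> X j" by auto
qed

lemma V_below_inter_bag: "j \<in> ch i \<Longrightarrow> v \<in> V_below j \<Longrightarrow> v \<in> X i \<Longrightarrow> v \<in> X j"
  using separation(2)[of j i _ v i] children_verts[of j i] parent_not_below[of j i]
  by (auto simp: V_below_def)

text \<open>Some bag contains the edge and hence \<open>x\<close>. As \<open>x\<close> is missing
  from the bag of \<open>i\<close>, separation forces that bag to belong to the subtree of
  \<open>j\<close>.\<close>

lemma private_adj:
  assumes "j \<in> ch i" "x \<in> V_below j" "x \<notin> X i" "adj x u"
  shows "u \<in> V_below j"
proof -
  obtain e where e: "e \<in> verts T" "x \<in> X e" "u \<in> X e"
    using decomposition assms(4) by (auto simp: tree_decomposition_def dest!: bspec)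
  with assms separation(1)[of j i _ x e] have "e \<in> below j" by (auto simp: V_below_def)
  with e show ?thesis by (auto simp: V_below_def)
qed

text \<open>A bag below \<open>j'\<close> lies outside the subtree of \<open>j\<close>, so
  separation puts the shared vertex into the parent bag.\<close>

lemma V_below_disjoint:
  assumes "j \<in> ch i" "j' \<in> ch i" "j \<noteq> j'" "x \<in> V_below j" "x \<in> V_below j'"
  shows "x \<in> X i"
proof -
  obtain d e where "d \<in> below j" "x \<in> X d" "e \<in> below j'" "x \<in> X e"
    using assms by (auto simp: V_below_def)
  moreover have "e \<notin> below j" using below_disjoint[OF assms(1-3)] \<open>e \<in> below j'\<close> by auto
  moreover have "e \<in> verts T" using \<open>e \<in> below j'\<close> below_verts children_verts assms by blast
  ultimately show ?thesis using separation(1)[OF assms(1)] by blast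
qed

end

text \<open>A state at node \<open>i\<close> consists of a colouring \<open>cl i s\<close> of the bag and a set \<open>mk i s\<close> of pairs of bag
  vertices, which includes the equally coloured pairs with a common neighbour of their colour
  strictly below the bag. A monochromatic \<open>C\<^sub>4\<close> that does not lie below one child has two opposite
  vertices \<open>u\<close>, \<open>w\<close> in the bag, so it shows up as two common neighbours of \<open>u\<close> and \<open>w\<close> that
  are in the bag or announced by different children.\<close>

locale dp_states = rooted_decomposition T r G X
  for T :: "'i ugraph" and r and G :: "'a ugraph" and X +
  fixes St :: "'s set" and cl :: "'i \<Rightarrow> 's \<Rightarrow> 'a \<Rightarrow> bool" and mk :: "'i \<Rightarrow> 's \<Rightarrow> 'a \<Rightarrow> 'a \<Rightarrow> bool"
  assumes rich: "i \<in> verts T \<Longrightarrow>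
    \<exists>s\<in>St. (\<forall>v\<in>X i. cl i s v = c v) \<and> (\<forall>u\<in>X i. \<forall>w\<in>X i. u \<noteq> w \<longrightarrow> mk i s u w = M u w)"
begin

text \<open>The case \<open>x = y\<close> is included on purpose: it forbids a mark on any pair that
  already has a common neighbour of its colour in the bag.\<close>

definition chk :: "'i \<Rightarrow> 's \<Rightarrow> bool" where
  "chk i s \<longleftrightarrow> (\<forall>u\<in>X i. \<forall>w\<in>X i. \<forall>x\<in>X i. \<forall>y\<in>X i.
     u \<noteq> w \<and> cl i s w = cl i s u \<and> cl i s x = cl i s u \<and> cl i s y = cl i s u \<and>
     adj x u \<and> adj x w \<and> adj y u \<and> adj y w \<longrightarrow> x = y \<and> \<not> mk i s u w)"

text \<open>What child \<open>j\<close> announces to \<open>i\<close>. Marks of \<open>j\<close>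
  concern vertices strictly below its bag, so the vertices \<open>x\<close> that leave the bag
  between \<open>j\<close> and \<open>i\<close> have to be added.\<close>

definition lift :: "'i \<Rightarrow> 'i \<Rightarrow> 's \<Rightarrow> 'a \<Rightarrow> 'a \<Rightarrow> bool" where
  "lift i j s u w \<longleftrightarrow> u \<in> X i \<and> w \<in> X i \<and> u \<in> X j \<and> w \<in> X j \<and> u \<noteq> w \<and>
     (mk j s u w \<or> (\<exists>x\<in>X j. x \<notin> X i \<and> adj x u \<and> adj x w \<and> cl j s x = cl j s u \<and> cl j s w = cl j s u))"

text \<open>Colours must agree on shared vertices, whereas announcements only have to be included
  among the marks.\<close>

definition compat :: "'i \<Rightarrow> 'i \<Rightarrow> 's \<Rightarrow> 's \<Rightarrow> bool" where
  "compat i j s s' \<longleftrightarrow> (\<forall>u\<in>X i. u \<in> X j \<longrightarrow> cl i s u = cl j s' u) \<and> (\<forall>u w. lift i j s' u w \<longrightarrow> mk i s u w)"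

definition realizes :: "'i \<Rightarrow> 's \<Rightarrow> ('a \<Rightarrow> bool) \<Rightarrow> bool" where
  "realizes i s f \<longleftrightarrow> C4_free_colouring G f (V_below i) \<and> (\<forall>v\<in>X i. f v = cl i s v) \<and>
     (\<forall>u\<in>X i. \<forall>w\<in>X i. \<forall>x\<in>V_below i. x \<notin> X i \<and> u \<noteq> w \<and> f w = f u \<and> f x = f u \<and> adj x u \<and> adj x w \<longrightarrow> mk i s u w)"

text \<open>The two-sided counterpart of \<open>realizes\<close>: marks must have witnesses.
  Completeness needs this, since an unfounded mark could violate \<open>chk\<close> or the
  disjointness of announcements.\<close>

definition exact :: "'i \<Rightarrow> 's \<Rightarrow> ('a \<Rightarrow> bool) \<Rightarrow> bool" where
  "exact i s f \<longleftrightarrow> (\<forall>v\<in>X i. cl i s v = f v) \<and>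
     (\<forall>u\<in>X i. \<forall>w\<in>X i. u \<noteq> w \<longrightarrow> mk i s u w =
        (\<exists>x\<in>V_below i. x \<notin> X i \<and> f w = f u \<and> f x = f u \<and> adj x u \<and> adj x w))"

text \<open>Suppose a monochromatic cycle has a corner \<open>x\<close> private to child
  \<open>j\<close>. Its neighbours \<open>u\<close>, \<open>w\<close> lie below \<open>j\<close>. If
  the opposite corner does too, the realizer of \<open>j\<close> excludes the cycle. Otherwise
  \<open>u\<close> and \<open>w\<close> are in the bag and announced by \<open>j\<close>; an
  opposite corner in the bag contradicts \<open>chk\<close>, and one below another child contradicts
  disjointness. A cycle within the bag contradicts \<open>chk\<close>.\<close>

lemma combine_realizers:
  assumes i: "i \<in> verts T" and chk: "chk i s"
    and compat: "\<And>j. j \<in> ch i \<Longrightarrow> compat i j s (\<sigma> j)"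
    and disj: "\<And>j j' u w. j \<in> ch i \<Longrightarrow> j' \<in> ch i \<Longrightarrow> j \<noteq> j' \<Longrightarrow> \<not> (lift i j (\<sigma> j) u w \<and> lift i j' (\<sigma> j') u w)"
    and real: "\<And>j. j \<in> ch i \<Longrightarrow> realizes j (\<sigma> j) (f j)"
  shows "\<exists>g. realizes i s g"
proof -
  \<comment> \<open>Outside the bag the child is unique by \<open>V_below_disjoint\<close>, so the
    choice is determined; on the bag, \<open>compat\<close> makes the children agree with the
    state.\<close>
  define g where "g v = (if v \<in> X i then cl i s v else f (SOME j. j \<in> ch i \<and> v \<in> V_below j) v)" for v
  have g_bag: "g v = cl i s v" if "v \<in> X i" for v using that by (simp add: g_def)
  have g_child: "g v = f j v" if "j \<in> ch i" "v \<in> V_below j" for j v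
  proof (cases "v \<in> X i")
    case True
    then show ?thesis
      using V_below_inter_bag[OF that True] compat[OF that(1)] real[OF that(1)]
      by (auto simp: g_def compat_def realizes_def)
  next
    case False
    have "(SOME j. j \<in> ch i \<and> v \<in> V_below j) = j"
      by (rule some_equality) (use that V_below_disjoint False in auto)
    with False show ?thesis by (simp add: g_def)
  qed
  have free: "C4_free_colouring G g (V_below j)" if "j \<in> ch i" for j
    using C4_free_colouring_cong[of "V_below j" g "f j" G] g_child[OF that] real[OF that]
    by (simp add: realizes_def)
  have priv: "\<exists>j\<in>ch i. x \<in> V_below j" if "x \<in> V_below i" "x \<notin> X i" for x
    using that by (subst (asm) V_below_unfold) auto
  have lifts: "lift i j (\<sigma> j) u w"
    if "j \<in> ch i" "x \<in> V_below j" "x \<notin> X i" "u \<in> X i" "w \<in> X i" "u \<noteq> w" "g w = g u" "g x = g u"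
      "adj x u" "adj x w" for j x u w
  proof -
    have V: "u \<in> V_below j" "w \<in> V_below j" using private_adj that by blast+
    then have X: "u \<in> X j" "w \<in> X j" using V_below_inter_bag that by blast+
    have f: "f j w = f j u" "f j x = f j u" using g_child that V by metis+
    have cl: "f j v = cl j (\<sigma> j) v" if "v \<in> X j" for v
      using that real[OF \<open>j \<in> ch i\<close>] by (auto simp: realizes_def)
    show ?thesis
    proof (cases "x \<in> X j")
      case True
      then show ?thesis using that X f cl by (auto simp: lift_def)
    next
      case False
      then have "mk j (\<sigma> j) u w"
        using real[OF \<open>j \<in> ch i\<close>] X f that V unfolding realizes_def by blast
      then show ?thesis using that X by (auto simp: lift_def)
    qed
  qed
  have mk: "mk i s u w"
    if "j \<in> ch i" "x \<in> V_below j" "x \<notin> X i" "u \<in> X i" "w \<in> X i" "u \<noteq> w" "g w = g u" "g x = g u"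
      "adj x u" "adj x w" for j x u w
    using lifts[OF that] compat[OF that(1)] by (auto simp: compat_def)
  have key: "x = y"
    if x: "x \<in> V_below i" "x \<notin> X i" and y: "y \<in> V_below i" and u: "u \<in> V_below i" and w: "w \<in> V_below i"
      and c: "u \<noteq> w" "g w = g u" "g x = g u" "g y = g u" "adj x u" "adj x w" "adj y u" "adj y w"
    for u w x y
  proof (rule ccontr)
    assume "x \<noteq> y"
    obtain j where j: "j \<in> ch i" "x \<in> V_below j" using priv x by blast
    have uw: "u \<in> V_below j" "w \<in> V_below j" using private_adj j x(2) c by blast+
    have "y \<notin> V_below j"
      using C4_free_colouringD[OF free[OF j(1)] uw j(2)] c \<open>x \<noteq> y\<close> by blast
    \<comment> \<open>Were \<open>u\<close> or \<open>w\<close> outside the bag, its neighbour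
      \<open>y\<close> would lie below \<open>j\<close> by \<open>private_adj\<close>.\<close>
    then have uwX: "u \<in> X i" "w \<in> X i"
      using private_adj[OF j(1)] uw c adj_sym by blast+
    show False
    proof (cases "y \<in> X i")
      case True
      have "mk i s u w" using mk[OF j x(2) uwX c(1,2,3,5,6)] .
      then show False
        using chk True uwX c g_bag unfolding chk_def by metis
    next
      case False
      then obtain j' where j': "j' \<in> ch i" "y \<in> V_below j'" using priv y by blast
      then have "j \<noteq> j'" using \<open>y \<notin> V_below j\<close> by auto
      then show False
        using disj[OF j(1) j'(1)] lifts[OF j x(2) uwX c(1,2,3,5,6)] lifts[OF j' False uwX c(1,2,4,7,8)]
        by blast
    qed
  qed
  have "C4_free_colouring G g (V_below i)"
    unfolding C4_free_colouring_def
  proof (intro ballI impI)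
    fix u w x y
    assume V: "u \<in> V_below i" "w \<in> V_below i" "x \<in> V_below i" "y \<in> V_below i"
      and c: "u \<noteq> w" "g w = g u" "g x = g u" "g y = g u" "adj x u" "adj x w" "adj y u" "adj y w"
    show "x = y"
    proof (rule ccontr)
      assume ne: "x \<noteq> y"
      \<comment> \<open>The cycle is symmetric in its corners, so \<open>key\<close> can be applied
        to each of them in turn and leaves only cycles inside the bag.\<close>
      have "x \<in> X i" using key[of x y u w] V c ne by blast
      moreover have "y \<in> X i" using key[of y x u w] V c ne by metis
      moreover have "u \<in> X i" using key[of u w x y] V c ne adj_sym by metis
      moreover have "w \<in> X i" using key[of w u x y] V c ne adj_sym by metis
      ultimately show False
        using chk c ne g_bag unfolding chk_def by metis
    qed
  qed
  then show ?thesis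
    using g_bag mk priv unfolding realizes_def by (intro exI[of _ g]) metis
qed

text \<open>Marks now have real witnesses. A violated condition would therefore exhibit two
  different common neighbours of one pair in one colour, which \<open>f\<close> rules out.\<close>

lemma split_exact:
  assumes i: "i \<in> verts T" and f: "C4_free_colouring G f (verts G)" and ex: "exact i s f"
    and ch: "\<And>j. j \<in> ch i \<Longrightarrow> exact j (\<sigma> j) f"
  shows "chk i s" "j \<in> ch i \<Longrightarrow> compat i j s (\<sigma> j)"
    "j \<in> ch i \<Longrightarrow> j' \<in> ch i \<Longrightarrow> j \<noteq> j' \<Longrightarrow> \<not> (lift i j (\<sigma> j) u w \<and> lift i j' (\<sigma> j') u w)"
proof -
  have Vsub: "V_below i \<subseteq> verts G" if "i \<in> verts T" for i
    using that bag_verts below_verts by (fastforce simp: V_below_def)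
  have XV: "X i \<subseteq> V_below i" for i by (subst V_below_unfold) auto
  show "chk i s"
    unfolding chk_def
  proof (intro ballI impI, elim conjE)
    fix u w x y
    assume X: "u \<in> X i" "w \<in> X i" "x \<in> X i" "y \<in> X i" and c: "u \<noteq> w"
      "cl i s w = cl i s u" "cl i s x = cl i s u" "cl i s y = cl i s u" "adj x u" "adj x w" "adj y u" "adj y w"
    have fc: "f w = f u" "f x = f u" "f y = f u" using ex X c by (auto simp: exact_def)
    have V: "v \<in> verts G" if "v \<in> X i" for v using that bag_verts i by blast
    have "x = y" using C4_free_colouringD[OF f] V X c fc by metis
    moreover have False if m: "mk i s u w"
    proof -
      from m obtain z where z: "z \<in> V_below i" "z \<notin> X i" "f z = f u" "adj z u" "adj z w"
        using ex X c(1) unfolding exact_def by blast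
      then have "x = z" using C4_free_colouringD[OF f, of u w x z] V X c fc Vsub[OF i] by blast
      with z X show False by blast
    qed
    ultimately show "x = y \<and> \<not> mk i s u w" by blast
  qed
  \<comment> \<open>Each announcement comes from a vertex outside the bag of \<open>i\<close>: a
    witness of the child's mark stays outside by \<open>V_below_inter_bag\<close>, the other kind is
    outside by definition.\<close>
  have L: "\<exists>x\<in>V_below j. x \<notin> X i \<and> f w = f u \<and> f x = f u \<and> adj x u \<and> adj x w"
    if j: "j \<in> ch i" and l: "lift i j (\<sigma> j) u w" for j u w
  proof -
    have X: "u \<in> X i" "w \<in> X i" "u \<in> X j" "w \<in> X j" "u \<noteq> w" using l by (auto simp: lift_def)
    consider "mk j (\<sigma> j) u w" | x where "x \<in> X j" "x \<notin> X i" "adj x u" "adj x w"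
        "cl j (\<sigma> j) x = cl j (\<sigma> j) u" "cl j (\<sigma> j) w = cl j (\<sigma> j) u"
      using l by (auto simp: lift_def)
    then show ?thesis
    proof cases
      case 1
      then obtain x where "x \<in> V_below j" "x \<notin> X j" "f w = f u" "f x = f u" "adj x u" "adj x w"
        using ch[OF j] X unfolding exact_def by blast
      with V_below_inter_bag[OF j] show ?thesis by blast
    next
      case 2
      have "\<And>v. v \<in> X j \<Longrightarrow> cl j (\<sigma> j) v = f v" using ch[OF j] by (simp add: exact_def)
      then have "f x = f u" "f w = f u" using 2(1,5,6) X(3,4) by auto
      moreover have "x \<in> V_below j" using 2(1) XV by blast
      ultimately show ?thesis using 2(2-4) by blast
    qed
  qed
  show "compat i j s (\<sigma> j)" if j: "j \<in> ch i" for j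
    unfolding compat_def
  proof (intro conjI ballI allI impI)
    fix u assume "u \<in> X i" "u \<in> X j"
    then show "cl i s u = cl j (\<sigma> j) u" using ex ch[OF j] by (auto simp: exact_def)
  next
    fix u w assume l: "lift i j (\<sigma> j) u w"
    have "V_below j \<subseteq> V_below i" using j V_below_unfold[of i] by blast
    with L[OF j l] l ex show "mk i s u w" unfolding exact_def lift_def by blast
  qed
  show "\<not> (lift i j (\<sigma> j) u w \<and> lift i j' (\<sigma> j') u w)" if j: "j \<in> ch i" "j' \<in> ch i" "j \<noteq> j'" for j j' u w
  proof
    assume l: "lift i j (\<sigma> j) u w \<and> lift i j' (\<sigma> j') u w"
    obtain x where x: "x \<in> V_below j" "x \<notin> X i" "f w = f u" "f x = f u" "adj x u" "adj x w"
      using L[OF j(1)] l by blast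
    obtain y where y: "y \<in> V_below j'" "y \<notin> X i" "f y = f u" "adj y u" "adj y w"
      using L[OF j(2)] l by blast
    have uw: "u \<in> X i" "w \<in> X i" "u \<noteq> w" using l by (auto simp: lift_def)
    have "j \<in> verts T" "j' \<in> verts T" using children_verts j by auto
    then have "x = y"
      using C4_free_colouringD[OF f, of u w x y] x y uw Vsub bag_verts[OF i] by blast
    with V_below_disjoint[OF j] x y show False by blast
  qed
qed

text \<open>\<open>F\<close> is squeezed between two notions: exact states of a global colouring
  satisfy \<open>F\<close>, and states satisfying \<open>F\<close> are realized. Both follow by
  induction from the children, and at the root \<open>V_below\<close> is the whole vertex
  set.\<close>

theorem dp_correct:
  assumes rec: "\<And>i s. i \<in> verts T \<Longrightarrow> s \<in> St \<Longrightarrow> F i s \<longleftrightarrow> chk i s \<and> (\<exists>\<sigma>.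
    (\<forall>j\<in>ch i. \<sigma> j \<in> St \<and> F j (\<sigma> j) \<and> compat i j s (\<sigma> j)) \<and>
    (\<forall>j\<in>ch i. \<forall>j'\<in>ch i. j \<noteq> j' \<longrightarrow> (\<forall>u w. \<not> (lift i j (\<sigma> j) u w \<and> lift i j' (\<sigma> j') u w))))"
  shows "(\<exists>s\<in>St. F r s) \<longleftrightarrow> (\<exists>f. C4_free_colouring G f (verts G))"
proof
  have sound: "i \<in> verts T \<Longrightarrow> s \<in> St \<Longrightarrow> F i s \<Longrightarrow> \<exists>f. realizes i s f" for i s
  proof (induction i arbitrary: s rule: wf_induct_rule[OF wf_parent_rel])
    case (1 i)
    obtain \<sigma> where chk: "chk i s"
      and \<sigma>: "\<forall>j\<in>ch i. \<sigma> j \<in> St \<and> F j (\<sigma> j) \<and> compat i j s (\<sigma> j)"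
      and d: "\<forall>j\<in>ch i. \<forall>j'\<in>ch i. j \<noteq> j' \<longrightarrow> (\<forall>u w. \<not> (lift i j (\<sigma> j) u w \<and> lift i j' (\<sigma> j') u w))"
      using rec[OF 1(2,3)] 1(4) by blast
    have "\<forall>j\<in>ch i. \<exists>f. realizes j (\<sigma> j) f"
      using 1(1) \<sigma> children_verts by (auto simp: parent_rel_iff)
    then obtain f where "\<And>j. j \<in> ch i \<Longrightarrow> realizes j (\<sigma> j) (f j)" by metis
    with combine_realizers[OF 1(2) chk, of \<sigma> f] \<sigma> d show ?case by blast
  qed
  {
    assume "\<exists>s\<in>St. F r s"
    with sound root obtain s f where "realizes r s f" by blast
    then have "C4_free_colouring G f (V_below r)" by (simp add: realizes_def)
    then show "\<exists>f. C4_free_colouring G f (verts G)" unfolding V_below_root by blast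
  }
  assume "\<exists>f. C4_free_colouring G f (verts G)"
  then obtain f where f: "C4_free_colouring G f (verts G)" ..
  have ex: "\<exists>s\<in>St. exact i s f" if "i \<in> verts T" for i
    unfolding exact_def
    using rich[OF that, of f "\<lambda>u w. \<exists>x\<in>V_below i. x \<notin> X i \<and> f w = f u \<and> f x = f u \<and> adj x u \<and> adj x w"] .
  have complete: "i \<in> verts T \<Longrightarrow> s \<in> St \<Longrightarrow> exact i s f \<Longrightarrow> F i s" for i s
  proof (induction i arbitrary: s rule: wf_induct_rule[OF wf_parent_rel])
    case (1 i)
    have "\<forall>j\<in>ch i. \<exists>s\<in>St. exact j s f" using ex children_verts by blast
    then obtain \<sigma> where \<sigma>: "\<And>j. j \<in> ch i \<Longrightarrow> \<sigma> j \<in> St \<and> exact j (\<sigma> j) f" by metis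
    have "\<forall>j\<in>ch i. F j (\<sigma> j)"
      using 1(1) \<sigma> children_verts by (auto simp: parent_rel_iff)
    then show ?case
      unfolding rec[OF 1(2,3)] using split_exact[OF 1(2) f 1(4), of \<sigma>] \<sigma> by blast
  qed
  with ex[OF root] root show "\<exists>s\<in>St. F r s" by blast
qed

end

section \<open>Formulas as expressions\<close>

text \<open>
  Registers: 2 number \<open>S\<close> of states; 3, 4 numbers of vertices and nodes; 5 entries of the adjacency
  lists; 6, 7 offsets and entries of the child lists; 8, 9 offsets and entries of the bags; 10 end
  of the input; 11 maximal bag size \<open>k\<close>; 12 number \<open>k + k\<^sup>2\<close> of bits of a state; 30, 31 current node
  and state; 50, 51 its children; 52, 53 states of the children; 54 number of children.
  Memory regions: 1 powers of two; 2, 3 row starts and entries of the adjacency matrix; 4 nodes in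
  breadth-first order; 5, 6 table starts and entries of the dynamic program. The adjacency
  matrix has quadratically many cells, but only those of the edges are ever written: the others
  are 0 initially.
\<close>

definition holds :: "fx \<Rightarrow> (nat \<Rightarrow> nat) \<Rightarrow> (nat \<Rightarrow> nat) \<Rightarrow> bool" where
  "holds e \<rho> \<mu> \<longleftrightarrow> eval e \<rho> \<mu> \<noteq> 0"

text \<open>Truth means nonzero. Hence addition is disjunction, a sum counts witnesses and so is an
  existential quantifier, and truncated subtraction yields comparison and negation.\<close>

definition "Lt a b = Sub b a"
definition "Neg a = Sub (C 1) a"
definition "Conj a b = Ite a b (C 0)"
definition "Disj a b = Add a b"
definition "Imp a b = Ite a b (C 1)"
definition "Iff a b = Conj (Imp a b) (Imp b a)"
definition "Eq a b = Neg (Add (Sub a b) (Sub b a))"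
definition "Exi x a = Sum x a"
definition "Alli x a = Neg (Exi x (Neg a))"
definition "Mul a b = Sum 47 (Ite (Lt (V 47) a) b (C 0))"

lemma holds_simps [simp]:
  "holds (Lt a b) \<rho> \<mu> \<longleftrightarrow> eval a \<rho> \<mu> < eval b \<rho> \<mu>"
  "holds (Neg a) \<rho> \<mu> \<longleftrightarrow> \<not> holds a \<rho> \<mu>"
  "holds (Conj a b) \<rho> \<mu> \<longleftrightarrow> holds a \<rho> \<mu> \<and> holds b \<rho> \<mu>"
  "holds (Disj a b) \<rho> \<mu> \<longleftrightarrow> holds a \<rho> \<mu> \<or> holds b \<rho> \<mu>"
  "holds (Imp a b) \<rho> \<mu> \<longleftrightarrow> (holds a \<rho> \<mu> \<longrightarrow> holds b \<rho> \<mu>)"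
  "holds (Eq a b) \<rho> \<mu> \<longleftrightarrow> eval a \<rho> \<mu> = eval b \<rho> \<mu>"
  "holds (Exi x a) \<rho> \<mu> \<longleftrightarrow> (\<exists>v<\<rho> lreg. holds a (\<rho>(x := v)) \<mu>)"
  by (auto simp: holds_def Lt_def Neg_def Conj_def Disj_def Imp_def Eq_def Exi_def)

lemma holds_Iff [simp]: "holds (Iff a b) \<rho> \<mu> \<longleftrightarrow> (holds a \<rho> \<mu> \<longleftrightarrow> holds b \<rho> \<mu>)"
  by (auto simp: Iff_def)

lemma holds_Alli [simp]:
  "holds (Alli x a) \<rho> \<mu> \<longleftrightarrow> (\<forall>v<\<rho> lreg. holds a (\<rho>(x := v)) \<mu>)"
  by (simp add: Alli_def)

lemma wfx_simps [simp]:
  "wfx (Lt a b) \<longleftrightarrow> wfx a \<and> wfx b"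
  "wfx (Neg a) \<longleftrightarrow> wfx a"
  "wfx (Conj a b) \<longleftrightarrow> wfx a \<and> wfx b"
  "wfx (Disj a b) \<longleftrightarrow> wfx a \<and> wfx b"
  "wfx (Imp a b) \<longleftrightarrow> wfx a \<and> wfx b"
  "wfx (Eq a b) \<longleftrightarrow> wfx a \<and> wfx b"
  "wfx (Iff a b) \<longleftrightarrow> wfx a \<and> wfx b"
  "wfx (Exi x a) \<longleftrightarrow> x < nvar \<and> x \<noteq> lreg \<and> wfx a"
  "wfx (Alli x a) \<longleftrightarrow> x < nvar \<and> x \<noteq> lreg \<and> wfx a"
  "wfx (Mul a b) \<longleftrightarrow> wfx a \<and> wfx b"
  by (auto simp: Lt_def Neg_def Conj_def Disj_def Imp_def Iff_def Eq_def Exi_def Alli_def Mul_def)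

text \<open>The factor \<open>x\<close> is counted off by the summation index, so it must not exceed
  the common bound. Register 47 is the index, hence the operands must not depend on it.\<close>

lemma eval_Mul:
  assumes "\<And>v. eval a (\<rho>(47 := v)) \<mu> = x" "\<And>v. eval b (\<rho>(47 := v)) \<mu> = y" "x \<le> \<rho> lreg"
  shows "eval (Mul a b) \<rho> \<mu> = x * y"
proof -
  have "eval (Mul a b) \<rho> \<mu> = (\<Sum>v<\<rho> lreg. if v < x then y else 0)"
    unfolding Mul_def eval.simps by (intro sum.cong refl) (auto simp: assms Lt_def)
  also have "\<dots> = (\<Sum>v<x. y)"
    by (rule sum.mono_neutral_cong_right) (use assms(3) in auto)
  finally show ?thesis by simp
qed

text \<open>The memory beyond the input is divided into regions, which are interleaved so that none
  of them has to be given a size in advance.\<close>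

definition region :: "nat \<Rightarrow> (nat \<Rightarrow> nat) \<Rightarrow> nat \<Rightarrow> nat \<Rightarrow> nat" where
  "region L \<mu> q x = \<mu> (L + 8 * x + q)"

text \<open>The stride 8 is produced by repeated doubling of \<open>a\<close>, as there is no
  multiplication.\<close>

definition Addr :: "nat \<Rightarrow> fx \<Rightarrow> fx" where
  "Addr q a = Add (V 10) (Add (Add (Add (Add a a) (Add a a)) (Add (Add a a) (Add a a))) (C q))"

lemma eval_Addr: "eval (Addr q a) \<rho> \<mu> = \<rho> 10 + 8 * eval a \<rho> \<mu> + q"
  unfolding Addr_def eval.simps by presburger

definition "Rd q a = Ld (Addr q a)"
definition "Wr q a e = Sto (Addr q a) e"

lemma eval_Rd [simp]: "eval (Rd q a) \<rho> \<mu> = region (\<rho> 10) \<mu> q (eval a \<rho> \<mu>)"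
  by (simp add: Rd_def eval_Addr region_def)

lemma wfx_Rd [simp]: "wfx (Rd q a) \<longleftrightarrow> wfx a"
  by (simp add: Rd_def Addr_def)

lemma wfs_Wr [simp]: "wfs (Wr q a e) \<longleftrightarrow> wfx a \<and> wfx e"
  by (auto simp: Wr_def Addr_def)

definition upd_region :: "nat \<Rightarrow> nat \<Rightarrow> nat \<Rightarrow> nat \<Rightarrow> (nat \<Rightarrow> nat) \<Rightarrow> nat \<Rightarrow> nat" where
  "upd_region L q x v \<mu> = \<mu>(L + 8 * x + q := v)"

lemma run_Wr:
  "run (Wr q a e) \<sigma> =
    (fst \<sigma>, upd_region (fst \<sigma> 10) q (eval a (fst \<sigma>) (snd \<sigma>)) (eval e (fst \<sigma>) (snd \<sigma>)) (snd \<sigma>))"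
  by (simp add: Wr_def eval_Addr upd_region_def)

lemma region_upd [simp]:
  "q < 8 \<Longrightarrow> q' < 8 \<Longrightarrow>
   region L (upd_region L q x v \<mu>) q' x' = (if q' = q \<and> x' = x then v else region L \<mu> q' x')"
  unfolding region_def upd_region_def by auto presburger+

lemma upd_region_below [simp]: "a < L \<Longrightarrow> upd_region L q x v \<mu> a = \<mu> a"
  by (simp add: upd_region_def)

text \<open>\<open>b\<close> is the address of the offsets and \<open>d\<close> that of the entries
  in the layout of \<open>rows\<close>; a row length is the difference of consecutive
  offsets.\<close>

definition "RLen b i = Sub (Ld (Add b (Add i (C 1)))) (Ld (Add b i))"
definition "RAt b d i p = Ld (Add d (Add (Ld (Add b i)) p))"

lemma wfx_RLen [simp]: "wfx (RLen b i) \<longleftrightarrow> wfx b \<and> wfx i"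
  by (auto simp: RLen_def)

lemma wfx_RAt [simp]: "wfx (RAt b d i p) \<longleftrightarrow> wfx b \<and> wfx d \<and> wfx i \<and> wfx p"
  by (auto simp: RAt_def)

section \<open>Bits of a state\<close>

definition sbit :: "nat \<Rightarrow> nat \<Rightarrow> bool" where
  "sbit s b \<longleftrightarrow> odd (s div 2 ^ b)"

text \<open>The machine can neither divide nor shift. This form lets a formula guess quotient and
  remainder, with the power of two read from memory.\<close>

lemma sbit_iff: "sbit s b \<longleftrightarrow> (\<exists>q r. r < 2 ^ b \<and> s = q * (2 ^ b + 2 ^ b) + 2 ^ b + r)"
proof
  assume "sbit s b"
  then obtain q where "s div 2 ^ b = 2 * q + 1" by (auto simp: sbit_def elim: oddE)
  then have "s = (2 * q + 1) * 2 ^ b + s mod 2 ^ b" by (metis div_mult_mod_eq)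
  then have "s = q * (2 ^ b + 2 ^ b) + 2 ^ b + s mod 2 ^ b" by (simp add: algebra_simps)
  moreover have "s mod 2 ^ b < 2 ^ b" by simp
  ultimately show "\<exists>q r. r < 2 ^ b \<and> s = q * (2 ^ b + 2 ^ b) + 2 ^ b + r" by blast
next
  assume "\<exists>q r. r < 2 ^ b \<and> s = q * (2 ^ b + 2 ^ b) + 2 ^ b + r"
  then obtain q r where r: "r < 2 ^ b" and s: "s = q * (2 ^ b + 2 ^ b) + 2 ^ b + r" by blast
  have "s = r + (2 * q + 1) * 2 ^ b" using s by (simp add: algebra_simps)
  then have "s div 2 ^ b = 2 * q + 1" using r by (simp only: div_mult_self1) simp
  then show "sbit s b" by (simp add: sbit_def)
qed

lemma exists_bits: "\<exists>s<2 ^ m. \<forall>b<m. sbit s b = f b"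
proof (induction m arbitrary: f)
  case (Suc m)
  obtain s where s: "s < 2 ^ m" "\<And>b. b < m \<Longrightarrow> sbit s b = f (Suc b)" using Suc[of "\<lambda>b. f (Suc b)"] by blast
  let ?s = "2 * s + of_bool (f 0)"
  have "sbit ?s b = f b" if "b < Suc m" for b
  proof (cases b)
    case (Suc c)
    then have "?s div 2 ^ b = s div 2 ^ c" by (simp add: div_mult2_eq)
    then show ?thesis using s(2)[of c] Suc that by (simp add: sbit_def)
  qed (simp add: sbit_def)
  moreover have "?s < 2 ^ Suc m" using s(1) by simp
  ultimately show ?case by blast
qed auto

definition Bit :: "nat \<Rightarrow> fx \<Rightarrow> fx" where
  "Bit s b = Ite (Exi 45 (Exi 46 (Conj (Lt (V 46) (Rd 1 b))
     (Eq (V s) (Add (Add (Mul (V 45) (Add (Rd 1 b) (Rd 1 b))) (Rd 1 b)) (V 46)))))) (C 1) (C 0)"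

lemma wfx_Bit [simp]: "wfx (Bit s b) \<longleftrightarrow> s < nvar \<and> wfx b"
  by (auto simp: Bit_def)

lemma eval_Bit:
  assumes "\<And>x y z. eval b (\<rho>(45 := x, 46 := y)) \<mu> = b' \<and> eval b (\<rho>(45 := x, 46 := y, 47 := z)) \<mu> = b'"
    and "region (\<rho> 10) \<mu> 1 b' = 2 ^ b'" "\<rho> s < \<rho> lreg" "s \<notin> {45, 46, 47}"
  shows "eval (Bit s b) \<rho> \<mu> = of_bool (sbit (\<rho> s) b')"
proof -
  have M: "eval (Mul (V 45) (Add (Rd 1 b) (Rd 1 b))) (\<rho>(45 := x, 46 := y)) \<mu> = x * (2 ^ b' + 2 ^ b')"
    if "x < \<rho> lreg" for x y
    by (rule eval_Mul) (use assms that in auto)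
  have "holds (Exi 45 (Exi 46 (Conj (Lt (V 46) (Rd 1 b))
     (Eq (V s) (Add (Add (Mul (V 45) (Add (Rd 1 b) (Rd 1 b))) (Rd 1 b)) (V 46)))))) \<rho> \<mu>
    \<longleftrightarrow> (\<exists>x<\<rho> lreg. \<exists>y<\<rho> lreg. y < 2 ^ b' \<and> \<rho> s = x * (2 ^ b' + 2 ^ b') + 2 ^ b' + y)"
    using assms M by auto
  also have "\<dots> \<longleftrightarrow> sbit (\<rho> s) b'"
  proof
    assume "sbit (\<rho> s) b'"
    then obtain q r where qr: "r < 2 ^ b'" "\<rho> s = q * (2 ^ b' + 2 ^ b') + 2 ^ b' + r"
      unfolding sbit_iff by blast
    \<comment> \<open>The divisor is positive, so quotient and remainder are at most the state
      itself and fall into the range of the sums.\<close>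
    have "q * 1 \<le> q * (2 ^ b' + 2 ^ b')" by (intro mult_le_mono2) (simp add: trans_le_add1)
    with qr assms(3) have "q < \<rho> lreg" "r < \<rho> lreg" by linarith+
    with qr show "\<exists>x<\<rho> lreg. \<exists>y<\<rho> lreg. y < 2 ^ b' \<and> \<rho> s = x * (2 ^ b' + 2 ^ b') + 2 ^ b' + y"
      by blast
  qed (auto simp: sbit_iff)
  finally show ?thesis unfolding Bit_def by (simp add: holds_def)
qed

section \<open>Reading the input\<close>

definition off :: "nat list list \<Rightarrow> nat \<Rightarrow> nat" where
  "off ls i = length (concat (take i ls))"

lemma off_0 [simp]: "off ls 0 = 0"
  by (simp add: off_def)

lemma off_Suc: "i < length ls \<Longrightarrow> off ls (Suc i) = off ls i + length (ls ! i)"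
  by (simp add: off_def take_Suc_conv_app_nth)

lemma off_mono: "i \<le> j \<Longrightarrow> j \<le> length ls \<Longrightarrow> off ls i \<le> off ls j"
  by (induction rule: dec_induct) (auto simp: off_Suc)

lemma length_rows: "length (rows ls) = Suc (length ls + off ls (length ls))"
  by (simp add: rows_def off_def)

lemma rows_offset: "i \<le> length ls \<Longrightarrow> rows ls ! i = off ls i"
  by (simp add: rows_def off_def nth_append del: upt_Suc)

lemma concat_nth_off:
  "i < length ls \<Longrightarrow> p < length (ls ! i) \<Longrightarrow> concat ls ! (off ls i + p) = ls ! i ! p"
proof (induction ls arbitrary: i)
  case (Cons l ls)
  then show ?case by (cases i) (auto simp: nth_append off_def)
qed auto

lemma rows_entry:
  assumes "i < length ls" "p < length (ls ! i)"
  shows "rows ls ! (Suc (length ls) + (off ls i + p)) = ls ! i ! p"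
  using concat_nth_off[OF assms] by (simp add: rows_def nth_append del: upt_Suc)

lemma off_less:
  assumes "i < length ls" "p < length (ls ! i)"
  shows "off ls i + p < off ls (length ls)"
  using off_mono[of "Suc i" "length ls" ls] assms by (simp add: off_Suc)

definition stored :: "(nat \<Rightarrow> nat) \<Rightarrow> nat \<Rightarrow> nat \<Rightarrow> nat list list \<Rightarrow> bool" where
  "stored \<mu> b d ls \<longleftrightarrow> (\<forall>i\<le>length ls. \<mu> (b + i) = off ls i) \<and>
     (\<forall>i<length ls. \<forall>p<length (ls ! i). \<mu> (d + off ls i + p) = ls ! i ! p)"

lemma stored_rows:
  assumes "\<And>a. a < length (pre @ rows ls @ post) \<Longrightarrow> \<mu> a = (pre @ rows ls @ post) ! a"
  shows "stored \<mu> (length pre) (length pre + Suc (length ls)) ls"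
  unfolding stored_def
proof (intro conjI allI impI)
  fix i assume "i \<le> length ls"
  then show "\<mu> (length pre + i) = off ls i"
    using assms[of "length pre + i"] rows_offset[of i ls] by (simp add: length_rows nth_append)
next
  fix i p assume "i < length ls" "p < length (ls ! i)"
  from off_less[OF this] rows_entry[OF this]
  show "\<mu> (length pre + Suc (length ls) + off ls i + p) = ls ! i ! p"
    using assms[of "length pre + (Suc (length ls) + (off ls i + p))"]
    by (simp add: length_rows nth_append add.assoc)
qed

lemma eval_RLen:
  assumes "stored \<mu> (eval b \<rho> \<mu>) d ls" "eval i \<rho> \<mu> < length ls"
  shows "eval (RLen b i) \<rho> \<mu> = length (ls ! eval i \<rho> \<mu>)"
proof -
  let ?b = "eval b \<rho> \<mu>" and ?i = "eval i \<rho> \<mu>"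
  have "\<mu> (?b + ?i) = off ls ?i" "\<mu> (?b + Suc ?i) = off ls (Suc ?i)"
    using assms less_imp_le[OF assms(2)] Suc_leI[OF assms(2)] unfolding stored_def by blast+
  then show ?thesis using assms(2) by (simp add: RLen_def off_Suc)
qed

lemma eval_RAt:
  assumes "stored \<mu> (eval b \<rho> \<mu>) (eval d \<rho> \<mu>) ls" "eval i \<rho> \<mu> < length ls"
    and "eval p \<rho> \<mu> < length (ls ! eval i \<rho> \<mu>)"
  shows "eval (RAt b d i p) \<rho> \<mu> = ls ! eval i \<rho> \<mu> ! eval p \<rho> \<mu>"
proof -
  have "\<mu> (eval b \<rho> \<mu> + eval i \<rho> \<mu>) = off ls (eval i \<rho> \<mu>)"
    using assms(1) less_imp_le[OF assms(2)] unfolding stored_def by blast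
  then show ?thesis using assms by (simp add: RAt_def stored_def add.assoc)
qed

section \<open>One step of the dynamic program as an expression\<close>

text \<open>Bag vertices are quantified through their positions in the bag list: positions stay
  below the common bound \<open>S\<close>, vertex numbers need not.\<close>

definition "Node i p = RAt (V 8) (V 9) (V i) (V p)"
definition "AllB x i a = Alli x (Imp (Lt (V x) (RLen (V 8) (V i))) a)"
definition "ExB x i a = Exi x (Conj (Lt (V x) (RLen (V 8) (V i))) a)"
definition "Col s p = Bit s (V p)"
text \<open>The first \<open>k\<close> bits of a state are the colours by position; a
  \<open>k\<close> by \<open>k\<close> matrix of marks follows row by row. Register 11 holds
  \<open>k\<close>.\<close>

definition "Mk s p q = Bit s (Add (V 11) (Add (Mul (V p) (V 11)) (V q)))"
text \<open>The row start is looked up and not computed, because \<open>Mul\<close> is correct only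
  if its first factor is at most \<open>S\<close>.\<close>

definition "Adj a b = Rd 3 (Add (Rd 2 a) b)"

definition "ChkF = AllB 34 30 (AllB 35 30 (AllB 36 30 (AllB 37 30
  (Imp (Conj (Neg (Eq (Node 30 34) (Node 30 35)))
       (Conj (Iff (Col 31 35) (Col 31 34)) (Conj (Iff (Col 31 36) (Col 31 34)) (Conj (Iff (Col 31 37) (Col 31 34))
       (Conj (Adj (Node 30 36) (Node 30 34)) (Conj (Adj (Node 30 36) (Node 30 35))
       (Conj (Adj (Node 30 37) (Node 30 34)) (Adj (Node 30 37) (Node 30 35)))))))))
     (Conj (Eq (Node 30 36) (Node 30 37)) (Neg (Mk 31 34 35)))))))"

text \<open>A vertex may have different positions in the two bags. Positions 36 and 37 in the
  child's bag are searched for and matched with 34 and 35 by the two final equations.\<close>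

definition "LiftF j s = Conj (Neg (Eq (Node 30 34) (Node 30 35)))
  (ExB 36 j (ExB 37 j (Conj
    (Disj (Mk s 36 37)
      (ExB 38 j (Conj (AllB 39 30 (Neg (Eq (Node 30 39) (Node j 38))))
        (Conj (Adj (Node j 38) (Node 30 34)) (Conj (Adj (Node j 38) (Node 30 35))
          (Conj (Iff (Col s 38) (Col s 36)) (Iff (Col s 37) (Col s 36))))))))
    (Conj (Eq (Node j 36) (Node 30 34)) (Eq (Node j 37) (Node 30 35))))))"

definition "CompF j s = Conj
  (AllB 34 30 (AllB 36 j (Disj (Iff (Col 31 34) (Col s 36)) (Neg (Eq (Node 30 34) (Node j 36))))))
  (AllB 34 30 (AllB 35 30 (Imp (LiftF j s) (Mk 31 34 35))))"

definition "DisjF = Neg (ExB 34 30 (ExB 35 30 (Conj (LiftF 50 52) (LiftF 51 53))))"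

definition "TabF j s = Rd 6 (Add (Rd 5 (V j)) (V s))"

text \<open>Two child states are always guessed; the guards on register 54 make the clauses of
  absent children vacuous, so one formula serves all kinds of nodes.\<close>

definition "StepF = Conj ChkF (Exi 52 (Exi 53 (Conj
   (Imp (Lt (C 0) (V 54)) (Conj (TabF 50 52) (CompF 50 52)))
   (Imp (Lt (C 1) (V 54)) (Conj (TabF 51 53) (Conj (CompF 51 53) DisjF))))))"

lemma wfx_StepF: "wfx StepF"
  by (simp add: StepF_def TabF_def DisjF_def CompF_def LiftF_def ChkF_def Adj_def Mk_def Col_def
      ExB_def AllB_def Node_def)

section \<open>Meaning of the formulas on an encoded input\<close>

locale c4_input = rooted_decomposition T r G X
  for T :: "nat ugraph" and r and G :: "nat ugraph" and X +
  fixes adjl chs bags :: "nat list list"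
  assumes verts_G: "verts G = {..<length adjl}"
    and adjl: "v < length adjl \<Longrightarrow> distinct (adjl ! v) \<and> set (adjl ! v) = {u. {u, v} \<in> edges G}"
    and verts_T: "verts T = {..<length chs}" and length_bags: "length bags = length chs"
    and chs: "i < length chs \<Longrightarrow> distinct (chs ! i) \<and> set (chs ! i) = ch i"
    and bags: "i < length chs \<Longrightarrow> distinct (bags ! i) \<and> set (bags ! i) = X i"
    and binary: "i < length chs \<Longrightarrow> length (chs ! i) \<le> 2"
begin

abbreviation n :: nat where "n \<equiv> length adjl"
abbreviation N :: nat where "N \<equiv> length chs"

text \<open>The width bound \<open>t\<close> is not part of the input, so the states are based on
  the largest bag that occurs. The 0 matches the initial value of register 11 in
  \<open>MaxBag\<close>.\<close>

definition k :: nat where "k = Max (insert 0 (length ` set bags))"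
definition m :: nat where "m = k + k * k"
definition S :: nat where "S = 2 ^ m"

definition xs :: "nat list" where "xs = [n, N, r] @ rows adjl @ rows chs @ rows bags"

text \<open>Start of the child rows: 3 header cells, \<open>n + 1\<close> offsets, then the
  adjacency lists. Likewise \<open>b0\<close> is the start of the bag rows and \<open>L\<close> the
  end of the input.\<close>

definition c0 :: nat where "c0 = 4 + n + off adjl n"
definition b0 :: nat where "b0 = c0 + Suc N + off chs N"
definition L :: nat where "L = b0 + Suc N + off bags N"

definition cl :: "nat \<Rightarrow> nat \<Rightarrow> nat \<Rightarrow> bool" where
  "cl i s v \<longleftrightarrow> (\<exists>p<length (bags ! i). bags ! i ! p = v \<and> sbit s p)"

definition mk :: "nat \<Rightarrow> nat \<Rightarrow> nat \<Rightarrow> nat \<Rightarrow> bool" where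
  "mk i s u w \<longleftrightarrow> (\<exists>p<length (bags ! i). \<exists>q<length (bags ! i).
     bags ! i ! p = u \<and> bags ! i ! q = w \<and> sbit s (k + (p * k + q)))"

lemma length_xs: "length xs = L"
  by (simp add: xs_def L_def b0_def c0_def length_rows length_bags)

lemma length_bag: "i < N \<Longrightarrow> length (bags ! i) \<le> k"
  unfolding k_def by (rule Max_ge) (auto simp: length_bags)

lemma nth_bag_eq: "i < N \<Longrightarrow> p < length (bags ! i) \<Longrightarrow> q < length (bags ! i) \<Longrightarrow>
    bags ! i ! p = bags ! i ! q \<longleftrightarrow> p = q"
  using bags by (simp add: nth_eq_iff_index_eq)

lemma cl_nth: "i < N \<Longrightarrow> p < length (bags ! i) \<Longrightarrow> cl i s (bags ! i ! p) \<longleftrightarrow> sbit s p"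
  by (auto simp: cl_def nth_bag_eq)

lemma mk_nth: "i < N \<Longrightarrow> p < length (bags ! i) \<Longrightarrow> q < length (bags ! i) \<Longrightarrow>
    mk i s (bags ! i ! p) (bags ! i ! q) \<longleftrightarrow> sbit s (k + (p * k + q))"
  by (auto simp: mk_def nth_bag_eq)

lemma ball_bag: "i < N \<Longrightarrow> (\<forall>v\<in>X i. P v) \<longleftrightarrow> (\<forall>p<length (bags ! i). P (bags ! i ! p))"
  using bags[of i] by (metis all_set_conv_all_nth)

lemma bex_bag: "i < N \<Longrightarrow> (\<exists>v\<in>X i. P v) \<longleftrightarrow> (\<exists>p<length (bags ! i). P (bags ! i ! p))"
  using ball_bag[of i "\<lambda>v. \<not> P v"] by blast

lemma mk_index: "p < k \<Longrightarrow> q < k \<Longrightarrow> k + (p * k + q) < m"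
proof -
  assume "p < k" "q < k"
  then have "p * k + q < Suc p * k" by simp
  also have "\<dots> \<le> k * k" using \<open>p < k\<close> by (intro mult_le_mono1) simp
  finally show ?thesis by (simp add: m_def)
qed

sublocale dp_states T r G X "{..<S}" cl mk
proof
  fix i and c :: "nat \<Rightarrow> bool" and M :: "nat \<Rightarrow> nat \<Rightarrow> bool"
  assume i: "i \<in> verts T"
  then have iN: "i < N" by (simp add: verts_T)
  \<comment> \<open>Inverts the layout of a state: colours first, then the marks, whose row and
    column are recovered by division with remainder.\<close>
  define f where "f b = (if b < k then c (bags ! i ! b)
    else M (bags ! i ! ((b - k) div k)) (bags ! i ! ((b - k) mod k)))" for b
  obtain s where s: "s < 2 ^ m" "\<And>b. b < m \<Longrightarrow> sbit s b = f b" using exists_bits by blast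
  have "cl i s (bags ! i ! p) = c (bags ! i ! p)" if "p < length (bags ! i)" for p
    using that cl_nth[OF iN that] s(2)[of p] length_bag[OF iN] by (simp add: f_def m_def)
  moreover have "mk i s (bags ! i ! p) (bags ! i ! q) = M (bags ! i ! p) (bags ! i ! q)"
    if "p < length (bags ! i)" "q < length (bags ! i)" for p q
    using that mk_nth[OF iN that] s(2)[OF mk_index, of p q] length_bag[OF iN] by (simp add: f_def)
  ultimately show "\<exists>s\<in>{..<S}. (\<forall>v\<in>X i. cl i s v = c v) \<and>
      (\<forall>u\<in>X i. \<forall>w\<in>X i. u \<noteq> w \<longrightarrow> mk i s u w = M u w)"
    using s(1) unfolding ball_bag[OF iN] S_def by blast
qed

definition inp :: "(nat \<Rightarrow> nat) \<Rightarrow> (nat \<Rightarrow> nat) \<Rightarrow> bool" where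
  "inp \<rho> \<mu> \<longleftrightarrow> \<rho> 3 = n \<and> \<rho> 4 = N \<and> \<rho> 5 = 4 + n \<and> \<rho> 6 = c0 \<and> \<rho> 7 = c0 + Suc N \<and>
     \<rho> 8 = b0 \<and> \<rho> 9 = b0 + Suc N \<and> \<rho> 10 = L \<and> (\<forall>a<L. \<mu> a = xs ! a)"

definition ctx :: "(nat \<Rightarrow> nat) \<Rightarrow> (nat \<Rightarrow> nat) \<Rightarrow> bool" where
  "ctx \<rho> \<mu> \<longleftrightarrow> inp \<rho> \<mu> \<and> \<rho> 11 = k \<and> \<rho> lreg = S \<and> (\<forall>b<m. region L \<mu> 1 b = 2 ^ b) \<and>
     (\<forall>u<n. \<forall>v<n. region L \<mu> 3 (region L \<mu> 2 u + v) \<noteq> 0 \<longleftrightarrow> {u, v} \<in> edges G)"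

lemma inp_upd [simp]: "10 < x \<Longrightarrow> inp (\<rho>(x := v)) \<mu> = inp \<rho> \<mu>"
  by (auto simp: inp_def)

lemma inp_upd_region [simp]: "inp \<rho> (upd_region L q x v \<mu>) = inp \<rho> \<mu>"
  by (auto simp: inp_def)

lemma ctx_upd [simp]: "11 < x \<Longrightarrow> ctx (\<rho>(x := v)) \<mu> = ctx \<rho> \<mu>"
  by (auto simp: ctx_def)

lemma stored_memory:
  assumes "\<forall>a<L. \<mu> a = xs ! a"
  shows stored_adjl: "stored \<mu> 3 (4 + n) adjl"
    and stored_chs: "stored \<mu> c0 (c0 + Suc N) chs"
    and stored_bags: "stored \<mu> b0 (b0 + Suc N) bags"
proof -
  have *: "stored \<mu> a (a + Suc (length ls)) ls" if "xs = pre @ rows ls @ post" "length pre = a" for pre ls post a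
    using stored_rows[of pre ls post \<mu>] assms that by (simp add: length_xs[symmetric])
  have "stored \<mu> 3 (3 + Suc n) adjl"
    by (rule *[of "[n, N, r]" _ "rows chs @ rows bags"]) (simp_all add: xs_def)
  then show "stored \<mu> 3 (4 + n) adjl" by simp
  show "stored \<mu> c0 (c0 + Suc N) chs"
    by (rule *[of "[n, N, r] @ rows adjl" _ "rows bags"]) (simp_all add: xs_def c0_def length_rows)
  have "stored \<mu> b0 (b0 + Suc (length bags)) bags"
    by (rule *[of "[n, N, r] @ rows adjl @ rows chs" _ "[]"])
      (simp_all add: xs_def b0_def c0_def length_rows)
  then show "stored \<mu> b0 (b0 + Suc N) bags" by (simp add: length_bags)
qed

lemma stored_inp:
  assumes "inp \<rho> \<mu>"
  shows "stored \<mu> 3 (\<rho> 5) adjl" "stored \<mu> (\<rho> 6) (\<rho> 7) chs" "stored \<mu> (\<rho> 8) (\<rho> 9) bags"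
  using assms stored_memory[of \<mu>] by (auto simp: inp_def)

lemma ctx_inp: "ctx \<rho> \<mu> \<Longrightarrow> inp \<rho> \<mu>"
  by (simp add: ctx_def)

text \<open>Ensures that the sums, which run up to \<open>S\<close>, cover all bag
  positions.\<close>

lemma k_le_S: "k \<le> S"
proof -
  have "k \<le> m" by (simp add: m_def)
  also have "m < S" by (simp add: S_def less_exp)
  finally show ?thesis by simp
qed

lemma eval_len: "inp \<rho> \<mu> \<Longrightarrow> \<rho> i < N \<Longrightarrow> eval (RLen (V 8) (V i)) \<rho> \<mu> = length (bags ! \<rho> i)"
  using eval_RLen[of \<mu> "V 8" \<rho> "\<rho> 9" bags "V i"] stored_inp(3)[of \<rho> \<mu>] by (simp add: length_bags)

lemma eval_Node: "ctx \<rho> \<mu> \<Longrightarrow> \<rho> i < N \<Longrightarrow> \<rho> p < length (bags ! \<rho> i) \<Longrightarrow>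
    eval (Node i p) \<rho> \<mu> = bags ! \<rho> i ! \<rho> p"
  using eval_RAt[of \<mu> "V 8" \<rho> "V 9" bags "V i" "V p"] stored_inp(3)[OF ctx_inp, of \<rho> \<mu>]
  by (simp add: length_bags Node_def)

lemma holds_AllB:
  assumes "ctx \<rho> \<mu>" "\<rho> i < N" "x \<noteq> i" "11 < x"
  shows "holds (AllB x i a) \<rho> \<mu> \<longleftrightarrow> (\<forall>p<length (bags ! \<rho> i). holds a (\<rho>(x := p)) \<mu>)"
proof -
  have "inp (\<rho>(x := v)) \<mu>" for v using assms by (simp add: ctx_inp)
  then have "eval (RLen (V 8) (V i)) (\<rho>(x := v)) \<mu> = length (bags ! \<rho> i)" for v
    using eval_len[of "\<rho>(x := v)" \<mu> i] assms by simp
  then show ?thesis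
    using assms length_bag[of "\<rho> i"] k_le_S by (auto simp: AllB_def ctx_def)
qed

lemma holds_ExB:
  assumes "ctx \<rho> \<mu>" "\<rho> i < N" "x \<noteq> i" "11 < x"
  shows "holds (ExB x i a) \<rho> \<mu> \<longleftrightarrow> (\<exists>p<length (bags ! \<rho> i). holds a (\<rho>(x := p)) \<mu>)"
  using holds_AllB[OF assms, of "Neg a"] by (auto simp: AllB_def ExB_def)

lemma holds_Col:
  assumes "ctx \<rho> \<mu>" "\<rho> s < S" "\<rho> p < k" "s \<notin> {45, 46, 47}" "p \<notin> {45, 46, 47}"
  shows "holds (Col s p) \<rho> \<mu> \<longleftrightarrow> sbit (\<rho> s) (\<rho> p)"
proof -
  have "eval (Col s p) \<rho> \<mu> = of_bool (sbit (\<rho> s) (\<rho> p))"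
    unfolding Col_def
    by (rule eval_Bit) (use assms in \<open>auto simp: ctx_def inp_def m_def\<close>)
  then show ?thesis by (simp add: holds_def)
qed

lemma holds_Mk:
  assumes "ctx \<rho> \<mu>" "\<rho> s < S" "\<rho> p < k" "\<rho> q < k" "s \<notin> {45, 46, 47}" "p \<notin> {45, 46, 47}" "q \<notin> {45, 46, 47}"
  shows "holds (Mk s p q) \<rho> \<mu> \<longleftrightarrow> sbit (\<rho> s) (k + (\<rho> p * k + \<rho> q))"
proof -
  have M: "eval (Mul (V p) (V 11)) \<rho>' \<mu> = \<rho> p * k"
    if "\<rho>' = \<rho>(45 := x, 46 := y) \<or> \<rho>' = \<rho>(45 := x, 46 := y, 47 := z)" for x y z \<rho>'
    by (rule eval_Mul) (use that assms k_le_S in \<open>auto simp: ctx_def\<close>)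
  have "eval (Mk s p q) \<rho> \<mu> = of_bool (sbit (\<rho> s) (k + (\<rho> p * k + \<rho> q)))"
    unfolding Mk_def
    by (rule eval_Bit) (use assms M mk_index in \<open>auto simp: ctx_def inp_def\<close>)
  then show ?thesis by (simp add: holds_def)
qed

lemma holds_Adj:
  assumes "ctx \<rho> \<mu>" "eval a \<rho> \<mu> < n" "eval b \<rho> \<mu> < n"
  shows "holds (Adj a b) \<rho> \<mu> \<longleftrightarrow> {eval a \<rho> \<mu>, eval b \<rho> \<mu>} \<in> edges G"
  using assms by (auto simp: holds_def Adj_def ctx_def inp_def)

lemma bag_less_n: "i < N \<Longrightarrow> p < length (bags ! i) \<Longrightarrow> bags ! i ! p < n"
  using bags[of i] bag_verts[of i] nth_mem[of p "bags ! i"] by (auto simp: verts_T verts_G)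

lemmas holds_rules = holds_AllB holds_ExB eval_Node holds_Col holds_Mk holds_Adj bag_less_n

lemma holds_ChkF:
  assumes "ctx \<rho> \<mu>" "\<rho> 30 < N" "\<rho> 31 < S"
  shows "holds ChkF \<rho> \<mu> \<longleftrightarrow> chk (\<rho> 30) (\<rho> 31)"
proof -
  have lk: "p < k" if "p < length (bags ! \<rho> 30)" for p
    using length_bag[OF assms(2)] that by simp
  show ?thesis
    unfolding ChkF_def chk_def ball_bag[OF assms(2)]
    using assms by (simp add: holds_rules lk cl_nth mk_nth cong: conj_cong)
qed

lemma holds_LiftF:
  assumes "ctx \<rho> \<mu>" "\<rho> 30 < N" "\<rho> j < N" "\<rho> s < S" "47 < j" "47 < s"
    "\<rho> 34 < length (bags ! \<rho> 30)" "\<rho> 35 < length (bags ! \<rho> 30)"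
  shows "holds (LiftF j s) \<rho> \<mu> \<longleftrightarrow>
    lift (\<rho> 30) (\<rho> j) (\<rho> s) (bags ! \<rho> 30 ! \<rho> 34) (bags ! \<rho> 30 ! \<rho> 35)"
proof -
  have lk: "p < k" if "p < length (bags ! \<rho> j)" for p
    using length_bag[OF assms(3)] that by simp
  let ?u = "bags ! \<rho> 30 ! \<rho> 34" and ?w = "bags ! \<rho> 30 ! \<rho> 35"
  have "?u \<in> X (\<rho> 30)" "?w \<in> X (\<rho> 30)" using bags[OF assms(2)] assms(7,8) nth_mem by metis+
  then have "lift (\<rho> 30) (\<rho> j) (\<rho> s) ?u ?w \<longleftrightarrow> ?u \<noteq> ?w \<and> (\<exists>u\<in>X (\<rho> j). \<exists>w\<in>X (\<rho> j).
     (mk (\<rho> j) (\<rho> s) u w \<or> (\<exists>x\<in>X (\<rho> j). (\<forall>v\<in>X (\<rho> 30). v \<noteq> x) \<and> adj x ?u \<and> adj x ?w \<and>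
       cl (\<rho> j) (\<rho> s) x = cl (\<rho> j) (\<rho> s) u \<and> cl (\<rho> j) (\<rho> s) w = cl (\<rho> j) (\<rho> s) u)) \<and>
     u = ?u \<and> w = ?w)"
    unfolding lift_def by blast
  also have "\<dots> \<longleftrightarrow> holds (LiftF j s) \<rho> \<mu>"
    unfolding LiftF_def ball_bag[OF assms(2)] bex_bag[OF assms(3)]
    using assms
    by (simp add: holds_rules lk cl_nth mk_nth cong: conj_cong)
  finally show ?thesis ..
qed

lemma holds_CompF:
  assumes "ctx \<rho> \<mu>" "\<rho> 30 < N" "\<rho> 31 < S" "\<rho> j < N" "\<rho> s < S" "47 < j" "47 < s"
  shows "holds (CompF j s) \<rho> \<mu> \<longleftrightarrow> compat (\<rho> 30) (\<rho> j) (\<rho> 31) (\<rho> s)"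
proof -
  have lk: "p < k" if "p < length (bags ! \<rho> j)" for p
    using length_bag[OF assms(4)] that by simp
  have lk': "p < k" if "p < length (bags ! \<rho> 30)" for p
    using length_bag[OF assms(2)] that by simp
  have "compat (\<rho> 30) (\<rho> j) (\<rho> 31) (\<rho> s) \<longleftrightarrow>
    (\<forall>u\<in>X (\<rho> 30). \<forall>v\<in>X (\<rho> j). (cl (\<rho> 30) (\<rho> 31) u = cl (\<rho> j) (\<rho> s) v) \<or> u \<noteq> v) \<and>
    (\<forall>u\<in>X (\<rho> 30). \<forall>w\<in>X (\<rho> 30). lift (\<rho> 30) (\<rho> j) (\<rho> s) u w \<longrightarrow> mk (\<rho> 30) (\<rho> 31) u w)"
    unfolding compat_def lift_def by blast
  also have "\<dots> \<longleftrightarrow> holds (CompF j s) \<rho> \<mu>"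
    unfolding CompF_def ball_bag[OF assms(2)] ball_bag[OF assms(4)]
    using assms
    by (simp add: holds_rules holds_LiftF lk lk' cl_nth mk_nth cong: conj_cong)
  finally show ?thesis ..
qed

lemma holds_DisjF:
  assumes "ctx \<rho> \<mu>" "\<rho> 30 < N" "\<rho> 50 < N" "\<rho> 51 < N" "\<rho> 52 < S" "\<rho> 53 < S"
  shows "holds DisjF \<rho> \<mu> \<longleftrightarrow>
    (\<forall>u w. \<not> (lift (\<rho> 30) (\<rho> 50) (\<rho> 52) u w \<and> lift (\<rho> 30) (\<rho> 51) (\<rho> 53) u w))"
proof -
  have "(\<forall>u w. \<not> (lift (\<rho> 30) (\<rho> 50) (\<rho> 52) u w \<and> lift (\<rho> 30) (\<rho> 51) (\<rho> 53) u w)) \<longleftrightarrow>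
    \<not> (\<exists>u\<in>X (\<rho> 30). \<exists>w\<in>X (\<rho> 30). lift (\<rho> 30) (\<rho> 50) (\<rho> 52) u w \<and> lift (\<rho> 30) (\<rho> 51) (\<rho> 53) u w)"
    unfolding lift_def by blast
  also have "\<dots> \<longleftrightarrow> holds DisjF \<rho> \<mu>"
    unfolding DisjF_def bex_bag[OF assms(2)]
    using assms by (simp add: holds_rules holds_LiftF cong: conj_cong)
  finally show ?thesis ..
qed

definition step :: "(nat \<Rightarrow> nat \<Rightarrow> bool) \<Rightarrow> nat \<Rightarrow> nat \<Rightarrow> bool" where
  "step F i s \<longleftrightarrow> chk i s \<and> (\<exists>s1<S. \<exists>s2<S.
     (0 < length (chs ! i) \<longrightarrow> F (chs ! i ! 0) s1 \<and> compat i (chs ! i ! 0) s s1) \<and>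
     (1 < length (chs ! i) \<longrightarrow> F (chs ! i ! 1) s2 \<and> compat i (chs ! i ! 1) s s2 \<and>
        (\<forall>u w. \<not> (lift i (chs ! i ! 0) s1 u w \<and> lift i (chs ! i ! 1) s2 u w))))"

lemma child_less: "i < N \<Longrightarrow> e < length (chs ! i) \<Longrightarrow> chs ! i ! e < N"
  using chs[of i] children_verts[of "chs ! i ! e" i] nth_mem[of e "chs ! i"] by (auto simp: verts_T)

text \<open>Table contents are assumed correct at the children only, which is what a bottom-up order
  provides.\<close>

lemma holds_StepF:
  assumes c: "ctx \<rho> \<mu>" "\<rho> 30 < N" "\<rho> 31 < S" "\<rho> 54 = length (chs ! \<rho> 30)"
    and e: "0 < length (chs ! \<rho> 30) \<Longrightarrow> \<rho> 50 = chs ! \<rho> 30 ! 0"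
      "1 < length (chs ! \<rho> 30) \<Longrightarrow> \<rho> 51 = chs ! \<rho> 30 ! 1"
    and F: "\<And>j s. j \<in> ch (\<rho> 30) \<Longrightarrow> s < S \<Longrightarrow> region L \<mu> 6 (region L \<mu> 5 j + s) \<noteq> 0 \<longleftrightarrow> F j s"
  shows "holds StepF \<rho> \<mu> \<longleftrightarrow> step F (\<rho> 30) (\<rho> 31)"
proof -
  let ?i = "\<rho> 30"
  have S: "\<rho> lreg = S" using c by (simp add: ctx_def)
  have ch: "chs ! ?i ! e \<in> ch ?i" if "e < length (chs ! ?i)" for e
    using chs[OF c(2)] nth_mem[OF that] by simp
  have L: "\<rho> 10 = L" using c by (simp add: ctx_def inp_def)
  have 0: "holds (Conj (TabF 50 52) (CompF 50 52)) (\<rho>(52 := s1, 53 := s2)) \<mu> \<longleftrightarrow>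
      F (chs ! ?i ! 0) s1 \<and> compat ?i (chs ! ?i ! 0) (\<rho> 31) s1"
    if "0 < length (chs ! ?i)" "s1 < S" for s1 s2
    using that c e(1) F[OF ch[OF that(1)] that(2)] child_less[OF c(2) that(1)] L
    by (simp add: holds_CompF TabF_def holds_def[of "Rd 6 _"])
  have c0: "\<rho> 50 = chs ! ?i ! 0" "chs ! ?i ! 0 < N" if "1 < length (chs ! ?i)"
    by (rule e(1) child_less[OF c(2)]; use that in linarith)+
  have 1: "holds (Conj (TabF 51 53) (Conj (CompF 51 53) DisjF)) (\<rho>(52 := s1, 53 := s2)) \<mu> \<longleftrightarrow>
      F (chs ! ?i ! 1) s2 \<and> compat ?i (chs ! ?i ! 1) (\<rho> 31) s2 \<and>
        (\<forall>u w. \<not> (lift ?i (chs ! ?i ! 0) s1 u w \<and> lift ?i (chs ! ?i ! 1) s2 u w))"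
    if "1 < length (chs ! ?i)" "s1 < S" "s2 < S" for s1 s2
    using that c e(2) c0[OF that(1)] F[OF ch[OF that(1)] that(3)] child_less[OF c(2) that(1)] L
    by (simp add: holds_CompF holds_DisjF TabF_def holds_def[of "Rd 6 _"])
  have "holds StepF \<rho> \<mu> \<longleftrightarrow> holds ChkF \<rho> \<mu> \<and> (\<exists>s1<S. \<exists>s2<S.
      (0 < length (chs ! ?i) \<longrightarrow> holds (Conj (TabF 50 52) (CompF 50 52)) (\<rho>(52 := s1, 53 := s2)) \<mu>) \<and>
      (1 < length (chs ! ?i) \<longrightarrow>
        holds (Conj (TabF 51 53) (Conj (CompF 51 53) DisjF)) (\<rho>(52 := s1, 53 := s2)) \<mu>))"
    using c S by (simp add: StepF_def)
  also have "\<dots> \<longleftrightarrow> step F ?i (\<rho> 31)"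
    unfolding step_def by (simp only: 0 1 holds_ChkF[OF c(1-3)] cong: conj_cong imp_cong)
  finally show ?thesis .
qed

section \<open>The intended tables and their correctness\<close>

definition table :: "nat \<Rightarrow> nat set" where
  "table = wfrec (parent_rel\<inverse>) (\<lambda>f i. {s. step (\<lambda>j s. s \<in> f j) i s})"

text \<open>\<open>step\<close> consults the table only at children, where the cut-off function of
  the well-founded recursion agrees with \<open>table\<close>.\<close>

lemma table_unfold:
  assumes "i < N"
  shows "s \<in> table i \<longleftrightarrow> step (\<lambda>j s. s \<in> table j) i s"
proof -
  have ch: "(chs ! i ! e, i) \<in> parent_rel\<inverse>" if "e < length (chs ! i)" for e
    using chs[OF assms] nth_mem[OF that] by (simp add: parent_rel_iff)
  have "table i = {s. step (\<lambda>j s. s \<in> cut table (parent_rel\<inverse>) i j) i s}"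
    by (rule def_wfrec[OF table_def[THEN eq_reflection] wf_parent_rel])
  then show ?thesis using ch by (auto simp: step_def cut_apply)
qed

text \<open>The choice function of \<open>dp_correct\<close> amounts to at most two states here. For
  an absent child any state below \<open>S\<close> will do, and one exists because \<open>S\<close>
  is positive.\<close>

lemma table_correct: "(\<exists>s<S. s \<in> table r) \<longleftrightarrow> (\<exists>f. C4_free_colouring G f (verts G))"
proof -
  have rec: "s \<in> table i \<longleftrightarrow> chk i s \<and> (\<exists>\<sigma>.
    (\<forall>j\<in>ch i. \<sigma> j \<in> {..<S} \<and> \<sigma> j \<in> table j \<and> compat i j s (\<sigma> j)) \<and>
    (\<forall>j\<in>ch i. \<forall>j'\<in>ch i. j \<noteq> j' \<longrightarrow> (\<forall>u w. \<not> (lift i j (\<sigma> j) u w \<and> lift i j' (\<sigma> j') u w))))"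
    (is "_ \<longleftrightarrow> chk i s \<and> (\<exists>\<sigma>. ?P \<sigma>)") if "i \<in> verts T" for i s
  proof -
    have i: "i < N" using that by (simp add: verts_T)
    have S0: "0 < S" by (simp add: S_def)
    consider "chs ! i = []" | a where "chs ! i = [a]" | a b where "chs ! i = [a, b]"
      using binary[OF i] by (cases "chs ! i" rule: remdups_adj.cases) auto
    then have "step (\<lambda>j s. s \<in> table j) i s \<longleftrightarrow> chk i s \<and> (\<exists>\<sigma>. ?P \<sigma>)"
    proof cases
      case 1
      then have "ch i = {}" using chs[OF i] by simp
      moreover have "\<exists>s1<S. \<exists>s2<S. True" using S0 by blast
      ultimately show ?thesis using 1 by (simp add: step_def)
    next
      case 2
      then have ch: "ch i = {a}" using chs[OF i] by simp
      have "(\<exists>\<sigma>. ?P \<sigma>) \<longleftrightarrow> (\<exists>s1<S. s1 \<in> table a \<and> compat i a s s1)"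
        (is "_ \<longleftrightarrow> ?R")
      proof
        assume ?R
        then obtain s1 where "s1 < S" "s1 \<in> table a" "compat i a s s1" by blast
        then have "?P (\<lambda>_. s1)" unfolding ch by simp
        then show "\<exists>\<sigma>. ?P \<sigma>" by (rule exI[of ?P "\<lambda>_. s1"])
      next
        assume "\<exists>\<sigma>. ?P \<sigma>"
        then obtain \<sigma> where "?P \<sigma>" by (rule exE)
        then show ?R by (intro exI[of _ "\<sigma> a"]) (simp add: ch)
      qed
      moreover have "(\<exists>s1<S. \<exists>s2<S. Q s1) \<longleftrightarrow> (\<exists>s1<S. Q s1)" for Q using S0 by blast
      ultimately show ?thesis using 2 by (simp add: step_def)
    next
      case 3
      then have ch: "ch i = {a, b}" and ab: "a \<noteq> b" using chs[OF i] by auto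
      have "(\<exists>\<sigma>. ?P \<sigma>) \<longleftrightarrow> (\<exists>s1<S. \<exists>s2<S. (s1 \<in> table a \<and> compat i a s s1) \<and>
         s2 \<in> table b \<and> compat i b s s2 \<and> (\<forall>u w. \<not> (lift i a s1 u w \<and> lift i b s2 u w)))"
        (is "_ \<longleftrightarrow> ?R")
      proof
        assume ?R
        then obtain s1 s2 where s: "s1 < S" "s2 < S" "s1 \<in> table a" "compat i a s s1" "s2 \<in> table b"
          "compat i b s s2" "\<forall>u w. \<not> (lift i a s1 u w \<and> lift i b s2 u w)" by blast
        have "?P (\<lambda>j. if j = a then s1 else s2)" unfolding ch using s ab by auto
        then show "\<exists>\<sigma>. ?P \<sigma>" by (rule exI[of ?P "\<lambda>j. if j = a then s1 else s2"])
      next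
        assume "\<exists>\<sigma>. ?P \<sigma>"
        then obtain \<sigma> where "?P \<sigma>" by (rule exE)
        with ab show ?R by (intro exI[of _ "\<sigma> a"] exI[of _ "\<sigma> b"] conjI) (auto simp: ch)
      qed
      with 3 show ?thesis by (simp add: step_def)
    qed
    then show ?thesis by (simp add: table_unfold[OF i])
  qed
  show ?thesis using dp_correct[of "\<lambda>i s. s \<in> table i", OF rec] by (simp add: Bex_def)
qed

end

section \<open>The program\<close>

definition Setup :: st where
  "Setup = Sq (Asg 3 (Ld (C 0))) (Sq (Asg 4 (Ld (C 1))) (Sq (Asg 5 (Add (C 4) (V 3)))
     (Sq (Asg 6 (Add (V 5) (Ld (Add (C 3) (V 3))))) (Sq (Asg 7 (Add (V 6) (Add (V 4) (C 1))))
     (Sq (Asg 8 (Add (V 7) (Ld (Add (V 6) (V 4))))) (Sq (Asg 9 (Add (V 8) (Add (V 4) (C 1))))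
       (Asg 10 (Add (V 9) (Ld (Add (V 8) (V 4)))))))))))"

text \<open>With truncated subtraction, \<open>a + (b - a)\<close> is the maximum of
  \<open>a\<close> and \<open>b\<close>; register 11 starts at 0.\<close>

definition MaxBag :: st where
  "MaxBag = For 20 (V 4) (Asg 11 (Add (V 11) (Sub (RLen (V 8) (V 20)) (V 11))))"

definition BitCount :: st where
  "BitCount = Sq (Asg 12 (V 11)) (For 20 (V 11) (Asg 12 (Add (V 12) (V 11))))"

text \<open>After \<open>m\<close> doublings register 13 holds \<open>S\<close>, which becomes the
  bound of all sums. No phase up to this point evaluates a sum.\<close>

definition Powers :: st where
  "Powers = Sq (Asg 13 (C 1)) (Sq (For 20 (V 12) (Sq (Wr 1 (V 20) (V 13)) (Asg 13 (Add (V 13) (V 13)))))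
     (Asg 2 (V 13)))"

definition AdjMatrix :: st where
  "AdjMatrix = Sq (Asg 13 (C 0)) (For 20 (V 3) (Sq (Wr 2 (V 20) (V 13))
     (Sq (For 21 (RLen (C 3) (V 20)) (Wr 3 (Add (V 13) (RAt (C 3) (V 5) (V 20) (V 21))) (C 1)))
       (Asg 13 (Add (V 13) (V 3))))))"

text \<open>Register 20 is the front of the queue and 14 its end. Exactly \<open>N\<close> rounds
  are made without a test for emptiness, which \<open>bfs_growing\<close> justifies.\<close>

definition Bfs :: st where
  "Bfs = Sq (Wr 4 (C 0) (Ld (C 2))) (Sq (Asg 14 (C 1)) (For 20 (V 4) (Sq (Asg 30 (Rd 4 (V 20)))
     (For 21 (RLen (V 6) (V 30)) (Sq (Wr 4 (V 14) (RAt (V 6) (V 7) (V 30) (V 21)))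
        (Asg 14 (Add (V 14) (C 1))))))))"

text \<open>Reading the breadth-first order backwards puts children before parents. Registers 50 and
  51 are loaded without a test; for an absent child their contents are arbitrary, and
  \<open>StepF\<close> guards against them.\<close>

definition Tables :: st where
  "Tables = Sq (Asg 13 (C 0)) (For 20 (V 4)
     (Sq (Sq (Asg 30 (Rd 4 (Sub (V 4) (Add (V 20) (C 1))))) (Sq (Wr 5 (V 30) (V 13))
      (Sq (Asg 50 (RAt (V 6) (V 7) (V 30) (C 0))) (Sq (Asg 51 (RAt (V 6) (V 7) (V 30) (C 1)))
        (Asg 54 (RLen (V 6) (V 30)))))))
      (Sq (For 31 (V 2) (Wr 6 (Add (V 13) (V 31)) StepF))
       (Asg 13 (Add (V 13) (V 2))))))"

definition AnswerF :: fx where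
  "AnswerF = Conj (Lt (C 1) (V 3)) (Exi 31 (Rd 6 (Add (Rd 5 (Ld (C 2))) (V 31))))"

definition Answer :: st where
  "Answer = Asg 0 (Ite AnswerF (C 1) (C 0))"

definition Main_prog :: st where
  "Main_prog = Sq Setup (Sq MaxBag (Sq BitCount (Sq Powers (Sq AdjMatrix (Sq Bfs (Sq Tables Answer))))))"

lemma wfs_Main_prog: "wfs Main_prog"
  by (simp add: Main_prog_def Setup_def MaxBag_def BitCount_def Powers_def AdjMatrix_def Bfs_def
      Tables_def Answer_def AnswerF_def wfx_StepF)

lemma tc_Rd [simp]: "tc (Rd q a) B = 8 * tc a B + 62"
  by (simp add: Rd_def Addr_def)

lemma tc_RLen [simp]: "tc (RLen b i) B = 2 * tc b B + 2 * tc i B + 34"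
  by (simp add: RLen_def)

lemma tc_RAt [simp]: "tc (RAt b d i p) B = tc b B + tc d B + tc i B + tc p B + 26"
  by (simp add: RAt_def)

lemma tm_Wr: "tm (Wr q a e) \<sigma> = 8 * tc a (fst \<sigma> lreg) + tc e (fst \<sigma> lreg) + 63"
  by (simp add: Wr_def Addr_def)

lemma setv_simps [simp]: "fst (setv x v \<sigma>) = (fst \<sigma>)(x := v)" "snd (setv x v \<sigma>) = snd \<sigma>"
  by (simp_all add: setv_def)

lemmas exec_simps = meets_def run_Wr tm_Wr

lemma meets_Sq':
  "meets p \<sigma> t P \<Longrightarrow> (\<And>\<sigma>'. P \<sigma>' \<Longrightarrow> meets q \<sigma>' t' Q) \<Longrightarrow> meets (Sq p q) \<sigma> (t + t' + 1) Q"
  by (rule meets_Sq) (erule meets_mono; simp)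

lemma meets_For':
  assumes "I 0 \<sigma>" "eval e (fst \<sigma>) (snd \<sigma>) = c"
    and "\<And>v \<sigma>'. v < c \<Longrightarrow> I v \<sigma>' \<Longrightarrow> meets p (setv x v \<sigma>') T (I (Suc v))"
    and "\<And>\<sigma>'. I c \<sigma>' \<Longrightarrow> Q \<sigma>'"
  shows "meets (For x e p) \<sigma> (tc e (fst \<sigma> lreg) + 8 + c * (T + 12)) Q"
proof (rule meets_mono)
  show "meets (For x e p) \<sigma> (tc e (fst \<sigma> lreg) + 8 + (\<Sum>v<c. T + 12)) (I c)"
    using meets_For[where I=I and \<sigma>=\<sigma> and e=e and p=p and b="\<lambda>_. T" and x=x, OF assms(1)] assms(3) unfolding assms(2) by blast
qed (simp_all add: assms(4))

section \<open>Correctness and cost of the phases\<close>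

context c4_input
begin

definition mem0 :: "nat \<Rightarrow> nat" where "mem0 a = (if a < L then xs ! a else 0)"

lemma meets_Setup:
  "meets Setup (\<lambda>_. 0, mem0) 300 (\<lambda>\<sigma>. inp (fst \<sigma>) (snd \<sigma>) \<and> snd \<sigma> = mem0 \<and> fst \<sigma> 11 = 0)"
proof -
  have mem: "\<forall>a<L. mem0 a = xs ! a" by (simp add: mem0_def)
  have "3 < L" by (simp add: L_def b0_def c0_def)
  then have hd: "mem0 0 = n" "mem0 (Suc 0) = N" by (auto simp: mem0_def xs_def)
  have o: "mem0 (3 + n) = off adjl n" "mem0 (c0 + N) = off chs N" "mem0 (b0 + N) = off bags N"
    using stored_memory[OF mem] by (auto simp: stored_def length_bags)
  have e: "4 + n + off adjl n = c0" "Suc (c0 + N + off chs N) = b0" "Suc (b0 + N + off bags N) = L"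
    by (simp_all add: c0_def b0_def L_def)
  show ?thesis
    unfolding Setup_def meets_def by (simp add: inp_def hd o e mem)
qed

lemma meets_MaxBag:
  assumes "inp (fst \<sigma>) (snd \<sigma>)" "fst \<sigma> 11 = 0"
  shows "meets MaxBag \<sigma> (10 + N * 100) (\<lambda>\<sigma>'. inp (fst \<sigma>') (snd \<sigma>') \<and> snd \<sigma>' = snd \<sigma> \<and> fst \<sigma>' 11 = k)"
proof -
  define I where "I v \<sigma>' \<longleftrightarrow> inp (fst \<sigma>') (snd \<sigma>') \<and> snd \<sigma>' = snd \<sigma> \<and>
    (\<forall>i<v. length (bags ! i) \<le> fst \<sigma>' 11) \<and> (fst \<sigma>' 11 = 0 \<or> (\<exists>i<v. fst \<sigma>' 11 = length (bags ! i)))"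
    for v and \<sigma>' :: conf
  have mx: "a + (b - a) = max a b" for a b :: nat by simp
  have "meets MaxBag \<sigma> (tc (V 4) (fst \<sigma> lreg) + 8 + N * (61 + 12))
    (\<lambda>\<sigma>'. inp (fst \<sigma>') (snd \<sigma>') \<and> snd \<sigma>' = snd \<sigma> \<and> fst \<sigma>' 11 = k)"
    unfolding MaxBag_def
  proof (rule meets_For'[where I=I])
    show "I 0 \<sigma>" using assms by (simp add: I_def)
    show "eval (V 4) (fst \<sigma>) (snd \<sigma>) = N" using assms by (simp add: inp_def)
  next
    fix v \<sigma>' assume v: "v < N" and I: "I v \<sigma>'"
    have "inp ((fst \<sigma>')(20 := v)) (snd \<sigma>')" using I by (auto simp: I_def)
    from eval_len[OF this, of 20] v
    have "eval (RLen (V 8) (V 20)) ((fst \<sigma>')(20 := v)) (snd \<sigma>') = length (bags ! v)" by simp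
    then show "meets (Asg 11 (Add (V 11) (Sub (RLen (V 8) (V 20)) (V 11)))) (setv 20 v \<sigma>') 61 (I (Suc v))"
      using I mx unfolding meets_def I_def by (auto simp: less_Suc_eq max_def)
  next
    fix \<sigma>' assume I: "I N \<sigma>'"
    have "length (bags ! i) \<in> length ` set bags" if "i < N" for i
      using that by (simp add: length_bags)
    then have "fst \<sigma>' 11 = k" unfolding k_def
      by (intro Max_eqI[symmetric]) (use I in \<open>auto simp: I_def length_bags in_set_conv_nth\<close>)
    then show "inp (fst \<sigma>') (snd \<sigma>') \<and> snd \<sigma>' = snd \<sigma> \<and> fst \<sigma>' 11 = k" using I by (auto simp: I_def)
  qed
  then show ?thesis by (rule meets_mono) auto
qed

lemma meets_BitCount:
  assumes "inp (fst \<sigma>) (snd \<sigma>)" "fst \<sigma> 11 = k"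
  shows "meets BitCount \<sigma> (20 + k * 40)
    (\<lambda>\<sigma>'. inp (fst \<sigma>') (snd \<sigma>') \<and> snd \<sigma>' = snd \<sigma> \<and> fst \<sigma>' 11 = k \<and> fst \<sigma>' 12 = m)"
proof -
  define I where "I v \<sigma>' \<longleftrightarrow> inp (fst \<sigma>') (snd \<sigma>') \<and> snd \<sigma>' = snd \<sigma> \<and> fst \<sigma>' 11 = k \<and>
    fst \<sigma>' 12 = k + v * k" for v and \<sigma>' :: conf
  have "meets (For 20 (V 11) (Asg 12 (Add (V 12) (V 11)))) \<sigma>'
     (tc (V 11) (fst \<sigma>' lreg) + 8 + k * (13 + 12)) (I k)" if "I 0 \<sigma>'" for \<sigma>'
    by (rule meets_For'[where I=I]) (use that in \<open>auto simp: I_def meets_def\<close>)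
  then have "meets BitCount \<sigma> (5 + (10 + k * 25) + 1) (I k)"
    unfolding BitCount_def using assms
    by (intro meets_Sq'[where P="I 0"]) (auto simp: meets_def[of "Asg _ _"] I_def)
  then show ?thesis by (rule meets_mono) (auto simp: I_def m_def)
qed

lemma meets_Powers:
  assumes "inp (fst \<sigma>) (snd \<sigma>)" "fst \<sigma> 11 = k" "fst \<sigma> 12 = m" "\<And>x. region L (snd \<sigma>) 3 x = 0"
  shows "meets Powers \<sigma> (40 + m * 200)
    (\<lambda>\<sigma>'. inp (fst \<sigma>') (snd \<sigma>') \<and> fst \<sigma>' 11 = k \<and> fst \<sigma>' lreg = S \<and>
       (\<forall>b<m. region L (snd \<sigma>') 1 b = 2 ^ b) \<and> (\<forall>x. region L (snd \<sigma>') 3 x = 0))"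
proof -
  define I where "I v \<sigma>' \<longleftrightarrow> inp (fst \<sigma>') (snd \<sigma>') \<and> fst \<sigma>' 11 = k \<and> fst \<sigma>' 12 = m \<and>
    fst \<sigma>' 13 = 2 ^ v \<and> (\<forall>b<v. region L (snd \<sigma>') 1 b = 2 ^ b) \<and> (\<forall>x. region L (snd \<sigma>') 3 x = 0)"
    for v and \<sigma>' :: conf
  have L: "fst \<sigma>' 10 = L" if "I v \<sigma>'" for v \<sigma>' using that by (simp add: I_def inp_def)
  have "meets (For 20 (V 12) (Sq (Wr 1 (V 20) (V 13)) (Asg 13 (Add (V 13) (V 13))))) \<sigma>'
     (tc (V 12) (fst \<sigma>' lreg) + 8 + m * (95 + 12)) (I m)" if "I 0 \<sigma>'" for \<sigma>'
  proof (rule meets_For'[where I=I])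
    fix v \<sigma>' assume v: "v < m" and I: "I v \<sigma>'"
    show "meets (Sq (Wr 1 (V 20) (V 13)) (Asg 13 (Add (V 13) (V 13)))) (setv 20 v \<sigma>') 95 (I (Suc v))"
      using I L[OF I] by (auto simp: I_def exec_simps less_Suc_eq)
  qed (use that in \<open>auto simp: I_def\<close>)
  then have "meets Powers \<sigma> (5 + ((10 + m * 107) + 5 + 1) + 1)
    (\<lambda>\<sigma>'. inp (fst \<sigma>') (snd \<sigma>') \<and> fst \<sigma>' 11 = k \<and> fst \<sigma>' lreg = S \<and>
       (\<forall>b<m. region L (snd \<sigma>') 1 b = 2 ^ b) \<and> (\<forall>x. region L (snd \<sigma>') 3 x = 0))"
    unfolding Powers_def using assms
    by (intro meets_Sq'[where P="I 0"] meets_Sq'[where P="I m"])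
      (auto simp: meets_def[of "Asg _ _"] I_def S_def inp_def)
  then show ?thesis by (rule meets_mono) auto
qed

lemma eval_degree:
  "inp \<rho> \<mu> \<Longrightarrow> \<rho> 20 < n \<Longrightarrow> eval (RLen (C 3) (V 20)) \<rho> \<mu> = length (adjl ! \<rho> 20)"
  using eval_RLen[of \<mu> "C 3" \<rho> "\<rho> 5" adjl "V 20"] stored_inp(1)[of \<rho> \<mu>] by simp

lemma eval_neighbour:
  "inp \<rho> \<mu> \<Longrightarrow> \<rho> 20 < n \<Longrightarrow> \<rho> 21 < length (adjl ! \<rho> 20) \<Longrightarrow>
   eval (RAt (C 3) (V 5) (V 20) (V 21)) \<rho> \<mu> = adjl ! \<rho> 20 ! \<rho> 21"
  using eval_RAt[of \<mu> "C 3" \<rho> "V 5" adjl "V 20" "V 21"] stored_inp(1)[of \<rho> \<mu>] by simp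

lemma neighbour_iff: "u < n \<Longrightarrow> (\<exists>e<length (adjl ! u). adjl ! u ! e = w) \<longleftrightarrow> {u, w} \<in> edges G"
  using adjl[of u] by (auto simp: in_set_conv_nth[symmetric] insert_commute Bex_def)

text \<open>Different pairs use different matrix cells: \<open>w\<close> is a remainder modulo
  \<open>n\<close>, so division recovers \<open>u\<close>.\<close>

lemma index_inj:
  assumes "u * n + w = u' * n + w'" "w < n" "w' < (n :: nat)"
  shows "u = u' \<and> w = w'"
proof -
  have "(u * n + w) div n = u" if "w < n" for u w
    using that by (cases "adjl = []") simp_all
  with assms have "u = u'" by metis
  with assms(1) show ?thesis by simp
qed

text \<open>The inner loop costs the degree of its vertex, and the degrees add up to
  \<open>off adjl n\<close>. The invariants \<open>I\<close> and \<open>J\<close> describe the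
  nonzero cells exactly, since the untouched zeros encode the non-edges.\<close>

lemma meets_AdjMatrix:
  assumes "inp (fst \<sigma>) (snd \<sigma>)" "fst \<sigma> 11 = k" "fst \<sigma> lreg = S"
    "\<forall>b<m. region L (snd \<sigma>) 1 b = 2 ^ b" "\<And>x. region L (snd \<sigma>) 3 x = 0"
  shows "meets AdjMatrix \<sigma> (50 + n * 300 + off adjl n * 500) (\<lambda>\<sigma>'. ctx (fst \<sigma>') (snd \<sigma>'))"
proof -
  define E where "E v x \<longleftrightarrow> (\<exists>u<v. \<exists>w. {u, w} \<in> edges G \<and> x = u * n + w)" for v x
  define K where "K v \<sigma>' \<longleftrightarrow> inp (fst \<sigma>') (snd \<sigma>') \<and> fst \<sigma>' 11 = k \<and> fst \<sigma>' lreg = S \<and>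
    (\<forall>b<m. region L (snd \<sigma>') 1 b = 2 ^ b) \<and> (\<forall>u<v. region L (snd \<sigma>') 2 u = u * n)"
    for v and \<sigma>' :: conf
  define I where "I v \<sigma>' \<longleftrightarrow> K v \<sigma>' \<and> fst \<sigma>' 13 = v * n \<and> (\<forall>x. region L (snd \<sigma>') 3 x \<noteq> 0 \<longleftrightarrow> E v x)"
    for v and \<sigma>' :: conf
  define J where "J v e \<sigma>' \<longleftrightarrow> K (Suc v) \<sigma>' \<and> fst \<sigma>' 13 = v * n \<and> fst \<sigma>' 20 = v \<and>
     (\<forall>x. region L (snd \<sigma>') 3 x \<noteq> 0 \<longleftrightarrow> E v x \<or> (\<exists>e'<e. x = v * n + adjl ! v ! e'))"
    for v e and \<sigma>' :: conf
  have L: "fst \<sigma>' 10 = L" if "K v \<sigma>'" for v \<sigma>' using that by (simp add: K_def inp_def)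
  have inner: "meets (For 21 (RLen (C 3) (V 20)) (Wr 3 (Add (V 13) (RAt (C 3) (V 5) (V 20) (V 21))) (C 1))) \<sigma>'
     (42 + 8 + length (adjl ! v) * (433 + 12)) (J v (length (adjl ! v)))"
    if "J v 0 \<sigma>'" "v < n" for v \<sigma>'
  proof -
    have "tc (RLen (C 3) (V 20)) (fst \<sigma>' lreg) = 42" by simp
    moreover have "meets (For 21 (RLen (C 3) (V 20)) (Wr 3 (Add (V 13) (RAt (C 3) (V 5) (V 20) (V 21))) (C 1))) \<sigma>'
      (tc (RLen (C 3) (V 20)) (fst \<sigma>' lreg) + 8 + length (adjl ! v) * (433 + 12)) (J v (length (adjl ! v)))"
    proof (rule meets_For'[where I="J v"])
      show "eval (RLen (C 3) (V 20)) (fst \<sigma>') (snd \<sigma>') = length (adjl ! v)"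
        using eval_degree[of "fst \<sigma>'" "snd \<sigma>'"] that by (simp add: J_def K_def)
    next
      fix e \<sigma>' assume e: "e < length (adjl ! v)" and J: "J v e \<sigma>'"
      have "eval (RAt (C 3) (V 5) (V 20) (V 21)) ((fst \<sigma>')(21 := e)) (snd \<sigma>') = adjl ! v ! e"
        using eval_neighbour[of "(fst \<sigma>')(21 := e)" "snd \<sigma>'"] J e that(2) by (simp add: J_def K_def)
      then show "meets (Wr 3 (Add (V 13) (RAt (C 3) (V 5) (V 20) (V 21))) (C 1)) (setv 21 e \<sigma>') 433 (J v (Suc e))"
        using J L[of "Suc v" \<sigma>'] by (auto simp: J_def K_def exec_simps less_Suc_eq)
    qed (use that in auto)
    ultimately show ?thesis by simp
  qed
  have body: "meets (Sq (Wr 2 (V 20) (V 13))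
     (Sq (For 21 (RLen (C 3) (V 20)) (Wr 3 (Add (V 13) (RAt (C 3) (V 5) (V 20) (V 21))) (C 1)))
       (Asg 13 (Add (V 13) (V 3))))) (setv 20 v \<sigma>') (81 + ((42 + 8 + length (adjl ! v) * (433 + 12)) + 13 + 1) + 1) (I (Suc v))"
    if "v < n" "I v \<sigma>'" for v \<sigma>'
  proof (rule meets_Sq'[where P="J v 0"])
    show "meets (Wr 2 (V 20) (V 13)) (setv 20 v \<sigma>') 81 (J v 0)"
      using that L[of v \<sigma>'] by (auto simp: I_def J_def K_def exec_simps less_Suc_eq)
  next
    fix \<sigma>' assume "J v 0 \<sigma>'"
    then show "meets (Sq (For 21 (RLen (C 3) (V 20)) (Wr 3 (Add (V 13) (RAt (C 3) (V 5) (V 20) (V 21))) (C 1)))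
       (Asg 13 (Add (V 13) (V 3)))) \<sigma>' ((42 + 8 + length (adjl ! v) * (433 + 12)) + 13 + 1) (I (Suc v))"
    proof (intro meets_Sq'[OF inner[OF _ that(1)]])
      fix \<sigma>' assume J: "J v (length (adjl ! v)) \<sigma>'"
      have "E (Suc v) x \<longleftrightarrow> E v x \<or> (\<exists>e<length (adjl ! v). x = v * n + adjl ! v ! e)" for x
      proof -
        have "E (Suc v) x \<longleftrightarrow> E v x \<or> (\<exists>w. {v, w} \<in> edges G \<and> x = v * n + w)"
          by (auto simp: E_def less_Suc_eq)
        then show ?thesis unfolding neighbour_iff[OF that(1), symmetric] by blast
      qed
      then show "meets (Asg 13 (Add (V 13) (V 3))) \<sigma>' 13 (I (Suc v))"
        using J by (auto simp: I_def J_def K_def meets_def inp_def)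
    qed auto
  qed
  have all: "meets (For 20 (V 3) (Sq (Wr 2 (V 20) (V 13))
     (Sq (For 21 (RLen (C 3) (V 20)) (Wr 3 (Add (V 13) (RAt (C 3) (V 5) (V 20) (V 21))) (C 1)))
       (Asg 13 (Add (V 13) (V 3)))))) \<sigma>' (40 + n * 200 + off adjl n * 500) (I n)" if "I 0 \<sigma>'" for \<sigma>'
  proof -
    have c: "fst \<sigma>' 3 = n" using that by (simp add: I_def K_def inp_def)
    have "off adjl v = (\<Sum>u<v. length (adjl ! u))" if "v \<le> n" for v
      using that by (induction v) (auto simp: off_Suc)
    then have o: "off adjl n = (\<Sum>u<n. length (adjl ! u))" by simp
    show ?thesis
      by (rule meets_mono[OF meets_For[where I=I, OF that body]])
        (auto simp: c o sum.distrib sum_distrib_left sum_distrib_right[symmetric])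
  qed
  have final: "ctx (fst \<sigma>') (snd \<sigma>')" if I: "I n \<sigma>'" for \<sigma>'
  proof -
    have "E n (u * n + v) \<longleftrightarrow> {u, v} \<in> edges G" if "u < n" "v < n" for u v
    proof
      assume "E n (u * n + v)"
      then obtain u' w where uw: "{u', w} \<in> edges G" "u * n + v = u' * n + w" unfolding E_def by blast
      then have "w < n" using simple_graph_edgeD[OF G uw(1)] by (simp add: verts_G)
      with index_inj[OF uw(2) that(2)] uw show "{u, v} \<in> edges G" by simp
    qed (use that in \<open>auto simp: E_def\<close>)
    with I show ?thesis unfolding ctx_def I_def K_def by auto
  qed
  have loop: "meets (For 20 (V 3) (Sq (Wr 2 (V 20) (V 13))
     (Sq (For 21 (RLen (C 3) (V 20)) (Wr 3 (Add (V 13) (RAt (C 3) (V 5) (V 20) (V 21))) (C 1)))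
       (Asg 13 (Add (V 13) (V 3)))))) \<sigma>' (40 + n * 200 + off adjl n * 500) (\<lambda>\<sigma>'. ctx (fst \<sigma>') (snd \<sigma>'))"
    if "I 0 \<sigma>'" for \<sigma>'
    by (rule meets_mono[OF all[OF that] order.refl final])
  have "meets (Asg 13 (C 0)) \<sigma> 5 (I 0)"
    using assms unfolding meets_def I_def K_def E_def by simp
  from meets_Sq'[OF this loop] show ?thesis
    unfolding AdjMatrix_def by (rule meets_mono) auto
qed

section \<open>Breadth-first order of the nodes\<close>

text \<open>The queue after \<open>v\<close> rounds. Processed nodes stay in it, so that the final
  queue is the order itself.\<close>

primrec bfs :: "nat \<Rightarrow> nat list" where
  "bfs 0 = [r]"
| "bfs (Suc v) = bfs v @ chs ! (bfs v ! v)"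

lemma root_less: "r < N"
  using root by (simp add: verts_T)

lemma set_chs: "i < N \<Longrightarrow> set (chs ! i) = ch i"
  using chs by blast

lemma bfs_closed_all:
  assumes "r \<in> A" "\<And>i. i \<in> A \<Longrightarrow> ch i \<subseteq> A"
  shows "{..<N} \<subseteq> A"
proof
  fix x assume "x \<in> {..<N}"
  then have "(r, x) \<in> parent_rel\<^sup>*" using root_reaches by (simp add: verts_T)
  then show "x \<in> A"
    by (induction rule: rtrancl_induct) (use assms in \<open>auto simp: parent_rel_iff\<close>)
qed

text \<open>If every entry had been processed, the queue would be closed under children and contain
  all \<open>N\<close> nodes, although only \<open>v < N\<close> rounds were made.\<close>

lemma bfs_growing:
  assumes "v < N" "v \<le> length Q" "distinct Q" "set Q \<subseteq> {..<N}"
    "Q = r # concat (map ((!) chs) (take v Q))"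
  shows "v < length Q"
proof (rule ccontr)
  assume "\<not> v < length Q"
  then have v: "length Q = v" using assms(2) by simp
  then have Q: "Q = r # concat (map ((!) chs) Q)" using assms(5) by simp
  then have "set Q = insert r (\<Union>i\<in>set Q. set (chs ! i))"
    by (metis list.set(2) set_concat set_map image_image)
  then have "ch i \<subseteq> set Q" if "i \<in> set Q" for i
    using that set_chs[of i] assms(4) by blast
  moreover have "r \<in> set Q" by (subst Q) simp
  ultimately have "set Q = {..<N}" using bfs_closed_all assms(4) by blast
  then have "length Q = N" using distinct_card[OF assms(3)] by simp
  with v assms(1) show False by simp
qed

lemma bfs_invariant:
  "v \<le> N \<Longrightarrow> v \<le> length (bfs v) \<and> distinct (bfs v) \<and> set (bfs v) \<subseteq> {..<N} \<and>
     bfs v = r # concat (map ((!) chs) (take v (bfs v)))"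
proof (induction v)
  case 0
  then show ?case using root_less by simp
next
  case (Suc v)
  let ?Q = "bfs v"
  have IH: "v \<le> length ?Q" "distinct ?Q" "set ?Q \<subseteq> {..<N}"
    "?Q = r # concat (map ((!) chs) (take v ?Q))" using Suc by simp_all
  have less: "v < length ?Q" using bfs_growing[OF _ IH] Suc.prems by simp
  let ?i = "?Q ! v"
  have i: "?i < N" using IH(3) nth_mem[OF less] by auto
  \<comment> \<open>A child already queued is not the root, so an earlier entry brought it in. By
    uniqueness of parents that entry equals the current one, against distinctness.\<close>
  have disj: "set ?Q \<inter> set (chs ! ?i) = {}"
  proof (rule ccontr)
    assume "set ?Q \<inter> set (chs ! ?i) \<noteq> {}"
    then obtain j where j: "j \<in> set ?Q" "j \<in> ch ?i" using set_chs[OF i] by auto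
    from j(1) have "j = r \<or> (\<exists>i\<in>set (take v ?Q). j \<in> set (chs ! i))"
      by (subst (asm) IH(4)) auto
    moreover have "j \<noteq> r" using j(2) root_no_parent by auto
    ultimately obtain i' where i': "i' \<in> set (take v ?Q)" "j \<in> set (chs ! i')" by blast
    then obtain x where x: "x < v" "j \<in> set (chs ! (?Q ! x))"
      by (metis in_set_conv_nth length_take min_less_iff_conj nth_take)
    have "?Q ! x \<in> set ?Q" using x(1) less by simp
    then have "?Q ! x < N" using IH(3) by auto
    then have "?Q ! x = ?i" using x(2) j(2) set_chs parent_unique by blast
    then show False using IH(2) x(1) less by (simp add: nth_eq_iff_index_eq)
  qed
  have "set (bfs (Suc v)) \<subseteq> {..<N}" using IH(3) set_chs[OF i] children_verts verts_T by auto
  moreover have "bfs (Suc v) = r # concat (map ((!) chs) (take (Suc v) (bfs (Suc v))))"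
    using IH(4) less by (simp add: take_Suc_conv_app_nth)
  moreover have "distinct (bfs (Suc v))" using IH(2) disj chs[OF i] by auto
  moreover have "Suc v \<le> length (bfs (Suc v))" using less by simp
  ultimately show ?case by blast
qed

lemma bfs_length:
  assumes "v < N"
  shows "v < length (bfs v)"
  using bfs_growing[of v "bfs v"] bfs_invariant[of v] assms by simp

definition order :: "nat list" where "order = bfs N"

lemma order: "length order = N" "distinct order" "set order = {..<N}"
proof -
  have *: "N \<le> length order" "distinct order" "set order \<subseteq> {..<N}"
    using bfs_invariant[of N] by (simp_all add: order_def)
  moreover have "length order \<le> N"
    using distinct_card[OF *(2)] card_mono[OF _ *(3)] by simp
  ultimately show "length order = N" "distinct order" "set order = {..<N}"
    using card_subset_eq[OF _ *(3)] distinct_card[OF *(2)] by auto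
qed

lemma bfs_prefix: "v \<le> w \<Longrightarrow> \<exists>ys. bfs w = bfs v @ ys"
  by (induction rule: dec_induct) auto

lemma bfs_nth: "v \<le> N \<Longrightarrow> x < length (bfs v) \<Longrightarrow> bfs v ! x = order ! x"
  using bfs_prefix[of v N] by (auto simp: order_def nth_append)

text \<open>In round \<open>x\<close> the children are appended at the end of the queue, and
  position \<open>x\<close> lies before that end.\<close>

lemma child_later:
  assumes "x < N" "j \<in> ch (order ! x)"
  shows "\<exists>y. x < y \<and> y < N \<and> order ! y = j"
proof -
  have "order ! x = bfs x ! x" using bfs_nth[of x x] bfs_length assms by simp
  then have "bfs (Suc x) = bfs x @ chs ! (order ! x)" by simp
  moreover have "order ! x < N" using assms(1) order nth_mem[of x order] by auto
  then obtain e where e: "e < length (chs ! (order ! x))" "chs ! (order ! x) ! e = j"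
    using assms(2) set_chs by (metis in_set_conv_nth)
  ultimately have "length (bfs x) + e < length (bfs (Suc x))" "bfs (Suc x) ! (length (bfs x) + e) = j"
    by simp_all
  then have "order ! (length (bfs x) + e) = j"
    using bfs_nth[of "Suc x" "length (bfs x) + e"] assms(1) by (metis Suc_leI)
  moreover have "length (bfs x) + e < N"
  proof -
    obtain ys where "order = bfs (Suc x) @ ys" using bfs_prefix[of "Suc x" N] assms(1) by (auto simp: order_def)
    then show ?thesis using \<open>length (bfs x) + e < length (bfs (Suc x))\<close> order(1) by (metis length_append trans_less_add1)
  qed
  moreover have "x < length (bfs x) + e" using bfs_length[OF assms(1)] by simp
  ultimately show ?thesis by blast
qed

lemma ctx_upd_region [simp]:
  "3 < q \<Longrightarrow> q < 8 \<Longrightarrow> ctx \<rho> (upd_region L q x v \<mu>) = ctx \<rho> \<mu>"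
  by (auto simp: ctx_def)

lemma ctx_L: "ctx \<rho> \<mu> \<Longrightarrow> \<rho> 10 = L"
  by (simp add: ctx_def inp_def)

lemma ctx_root: "ctx \<rho> \<mu> \<Longrightarrow> \<mu> 2 = r"
  by (simp add: ctx_def inp_def xs_def L_def b0_def c0_def)

lemma eval_child_count:
  "ctx \<rho> \<mu> \<Longrightarrow> \<rho> 30 < N \<Longrightarrow> eval (RLen (V 6) (V 30)) \<rho> \<mu> = length (chs ! \<rho> 30)"
  using eval_RLen[of \<mu> "V 6" \<rho> "\<rho> 7" chs "V 30"] stored_inp(2)[of \<rho> \<mu>] by (simp add: ctx_inp)

lemma eval_child:
  "ctx \<rho> \<mu> \<Longrightarrow> \<rho> 30 < N \<Longrightarrow> eval e \<rho> \<mu> < length (chs ! \<rho> 30) \<Longrightarrow>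
   eval (RAt (V 6) (V 7) (V 30) e) \<rho> \<mu> = chs ! \<rho> 30 ! eval e \<rho> \<mu>"
  using eval_RAt[of \<mu> "V 6" \<rho> "V 7" chs "V 30" e] stored_inp(2)[of \<rho> \<mu>] by (simp add: ctx_inp)

lemma meets_Bfs:
  assumes "ctx (fst \<sigma>) (snd \<sigma>)"
  shows "meets Bfs \<sigma> (200 + N * 600)
    (\<lambda>\<sigma>'. ctx (fst \<sigma>') (snd \<sigma>') \<and> (\<forall>x<N. region L (snd \<sigma>') 4 x = order ! x))"
proof -
  define holdsQ where "holdsQ Q \<sigma>' \<longleftrightarrow> ctx (fst \<sigma>') (snd \<sigma>') \<and> fst \<sigma>' 14 = length Q \<and>
     (\<forall>x<length Q. region L (snd \<sigma>') 4 x = Q ! x)" for Q and \<sigma>' :: conf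
  have inner: "meets (For 21 (RLen (V 6) (V 30)) (Sq (Wr 4 (V 14) (RAt (V 6) (V 7) (V 30) (V 21)))
        (Asg 14 (Add (V 14) (C 1))))) \<sigma>' (42 + 8 + 2 * (150 + 12)) (holdsQ (bfs (Suc v)))"
    if v: "v < N" and Q: "holdsQ (bfs v) \<sigma>'" "fst \<sigma>' 30 = bfs v ! v" for v \<sigma>'
  proof -
    let ?i = "bfs v ! v"
    have i: "?i < N" using bfs_invariant[of v] v nth_mem[OF bfs_length[OF v]] by auto
    define J where "J e \<sigma>' \<longleftrightarrow> holdsQ (bfs v @ take e (chs ! ?i)) \<sigma>' \<and> fst \<sigma>' 30 = ?i" for e and \<sigma>' :: conf
    have "meets (For 21 (RLen (V 6) (V 30)) (Sq (Wr 4 (V 14) (RAt (V 6) (V 7) (V 30) (V 21)))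
        (Asg 14 (Add (V 14) (C 1))))) \<sigma>' (tc (RLen (V 6) (V 30)) (fst \<sigma>' lreg) + 8 + length (chs ! ?i) * (150 + 12))
        (holdsQ (bfs (Suc v)))"
    proof (rule meets_For'[where I=J])
      show "eval (RLen (V 6) (V 30)) (fst \<sigma>') (snd \<sigma>') = length (chs ! ?i)"
        using eval_child_count[of "fst \<sigma>'" "snd \<sigma>'"] Q i by (simp add: holdsQ_def)
      show "J 0 \<sigma>'" using Q by (simp add: J_def)
    next
      fix e \<sigma>' assume e: "e < length (chs ! ?i)" and J: "J e \<sigma>'"
      have "eval (RAt (V 6) (V 7) (V 30) (V 21)) ((fst \<sigma>')(21 := e)) (snd \<sigma>') = chs ! ?i ! e"
        using eval_child[of "(fst \<sigma>')(21 := e)" "snd \<sigma>'" "V 21"] J e i by (simp add: J_def holdsQ_def)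
      then show "meets (Sq (Wr 4 (V 14) (RAt (V 6) (V 7) (V 30) (V 21))) (Asg 14 (Add (V 14) (C 1))))
         (setv 21 e \<sigma>') 150 (J (Suc e))"
        using J e ctx_L[of "fst \<sigma>'" "snd \<sigma>'"]
        by (auto simp: J_def holdsQ_def exec_simps take_Suc_conv_app_nth nth_append less_Suc_eq)
    next
      fix \<sigma>' assume "J (length (chs ! ?i)) \<sigma>'"
      then show "holdsQ (bfs (Suc v)) \<sigma>'" by (simp add: J_def)
    qed
    then show ?thesis
      by (rule meets_mono) (use binary[OF i] in auto)
  qed
  have loop: "meets (For 20 (V 4) (Sq (Asg 30 (Rd 4 (V 20)))
     (For 21 (RLen (V 6) (V 30)) (Sq (Wr 4 (V 14) (RAt (V 6) (V 7) (V 30) (V 21)))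
        (Asg 14 (Add (V 14) (C 1))))))) \<sigma>' (tc (V 4) (fst \<sigma>' lreg) + 8 + N * ((81 + (42 + 8 + 2 * (150 + 12)) + 1) + 12))
      (\<lambda>\<sigma>'. ctx (fst \<sigma>') (snd \<sigma>') \<and> (\<forall>x<N. region L (snd \<sigma>') 4 x = order ! x))"
    if "holdsQ (bfs 0) \<sigma>'" for \<sigma>'
  proof (rule meets_For'[where I="\<lambda>v. holdsQ (bfs v)"])
    show "eval (V 4) (fst \<sigma>') (snd \<sigma>') = N" using that by (simp add: holdsQ_def ctx_def inp_def)
  next
    fix v \<sigma>' assume v: "v < N" and Q: "holdsQ (bfs v) \<sigma>'"
    have "meets (Asg 30 (Rd 4 (V 20))) (setv 20 v \<sigma>') 81 (\<lambda>\<sigma>'. holdsQ (bfs v) \<sigma>' \<and> fst \<sigma>' 30 = bfs v ! v)"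
      using Q bfs_length[OF v] ctx_L[of "fst \<sigma>'" "snd \<sigma>'"] by (auto simp: holdsQ_def meets_def)
    then show "meets (Sq (Asg 30 (Rd 4 (V 20)))
     (For 21 (RLen (V 6) (V 30)) (Sq (Wr 4 (V 14) (RAt (V 6) (V 7) (V 30) (V 21)))
        (Asg 14 (Add (V 14) (C 1)))))) (setv 20 v \<sigma>') (81 + (42 + 8 + 2 * (150 + 12)) + 1) (holdsQ (bfs (Suc v)))"
      by (rule meets_Sq') (use inner[OF v] in blast)
  qed (use that order(1) in \<open>auto simp: holdsQ_def order_def\<close>)
  have wr: "meets (Wr 4 (C 0) (Ld (C 2))) \<sigma> 85 (\<lambda>\<sigma>'. ctx (fst \<sigma>') (snd \<sigma>') \<and> region L (snd \<sigma>') 4 0 = r)"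
    using assms ctx_L[OF assms] ctx_root[OF assms] by (simp add: exec_simps)
  have tail: "meets (Asg 14 (C 1)) \<sigma>' 5 (holdsQ (bfs 0))"
    if "ctx (fst \<sigma>') (snd \<sigma>') \<and> region L (snd \<sigma>') 4 0 = r" for \<sigma>'
    using that by (simp add: meets_def holdsQ_def)
  from meets_Sq'[OF wr meets_Sq'[OF tail loop[unfolded tc.simps(2)]]] show ?thesis
    unfolding Bfs_def by (rule meets_mono) auto
qed

section \<open>Filling the tables bottom up\<close>

definition solved :: "nat \<Rightarrow> (nat \<Rightarrow> nat) \<Rightarrow> bool" where
  "solved v \<mu> \<longleftrightarrow> (\<forall>x<v. region L \<mu> 5 (rev order ! x) = x * S \<and>
     (\<forall>s<S. region L \<mu> 6 (x * S + s) \<noteq> 0 \<longleftrightarrow> s \<in> table (rev order ! x)))"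

lemma child_earlier:
  assumes "x < N" "j \<in> ch (rev order ! x)"
  shows "\<exists>y<x. rev order ! y = j"
proof -
  have "rev order ! x = order ! (N - Suc x)" using assms(1) order(1) by (simp add: rev_nth)
  moreover have "N - Suc x < N" using assms(1) by linarith
  ultimately obtain y where y: "N - Suc x < y" "y < N" "order ! y = j"
    using child_later[of "N - Suc x" j] assms(2) by auto
  then have "rev order ! (N - Suc y) = j" using order(1) by (simp add: rev_nth)
  moreover have "N - Suc y < x" using y(1,2) assms(1) by linarith
  ultimately show ?thesis by blast
qed

lemma block_less: "x < v \<Longrightarrow> s < S \<Longrightarrow> x * S + s < v * S"
proof -
  assume "x < v" "s < S"
  then have "x * S + s < Suc x * S" by simp
  also have "\<dots> \<le> v * S" using \<open>x < v\<close> by (intro mult_le_mono1) simp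
  finally show ?thesis .
qed

lemma meets_Tables:
  assumes "ctx (fst \<sigma>) (snd \<sigma>)" "\<forall>x<N. region L (snd \<sigma>) 4 x = order ! x"
  shows "meets Tables \<sigma> (50 + N * (1000 + S * (tc StepF S + 200)))
    (\<lambda>\<sigma>'. ctx (fst \<sigma>') (snd \<sigma>') \<and> solved N (snd \<sigma>'))"
proof -
  define I where "I v \<sigma>' \<longleftrightarrow> ctx (fst \<sigma>') (snd \<sigma>') \<and> (\<forall>x<N. region L (snd \<sigma>') 4 x = order ! x) \<and>
     fst \<sigma>' 13 = v * S \<and> solved v (snd \<sigma>')" for v and \<sigma>' :: conf
  define J where "J v s \<sigma>' \<longleftrightarrow> I v \<sigma>' \<and> fst \<sigma>' 30 = rev order ! v \<and>
     fst \<sigma>' 54 = length (chs ! (rev order ! v)) \<and>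
     (0 < length (chs ! (rev order ! v)) \<longrightarrow> fst \<sigma>' 50 = chs ! (rev order ! v) ! 0) \<and>
     (1 < length (chs ! (rev order ! v)) \<longrightarrow> fst \<sigma>' 51 = chs ! (rev order ! v) ! 1) \<and>
     region L (snd \<sigma>') 5 (rev order ! v) = v * S \<and>
     (\<forall>s'<s. region L (snd \<sigma>') 6 (v * S + s') \<noteq> 0 \<longleftrightarrow> s' \<in> table (rev order ! v))"
    for v s and \<sigma>' :: conf
  have nodes: "rev order ! v < N" if "v < N" for v
    using that order nth_mem[of v "rev order"] by auto
  have distinct: "rev order ! x \<noteq> rev order ! v" if "x < v" "v < N" for x v
    using that order by (simp add: nth_eq_iff_index_eq)
  let ?init = "Sq (Asg 30 (Rd 4 (Sub (V 4) (Add (V 20) (C 1))))) (Sq (Wr 5 (V 30) (V 13))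
      (Sq (Asg 50 (RAt (V 6) (V 7) (V 30) (C 0))) (Sq (Asg 51 (RAt (V 6) (V 7) (V 30) (C 1)))
        (Asg 54 (RLen (V 6) (V 30))))))"
  have init: "meets ?init (setv 20 v \<sigma>') 600 (J v 0)" if v: "v < N" and I: "I v \<sigma>'" for v \<sigma>'
  proof -
    let ?i = "rev order ! v"
    have i: "order ! (N - Suc v) = ?i" using v order(1) by (simp add: rev_nth)
    have rN: "fst \<sigma>' 4 = N" and c: "ctx (fst \<sigma>') (snd \<sigma>')" using I by (simp_all add: I_def ctx_def inp_def)
    have "meets (Asg 30 (Rd 4 (Sub (V 4) (Add (V 20) (C 1))))) (setv 20 v \<sigma>') 209
      (\<lambda>\<sigma>'. I v \<sigma>' \<and> fst \<sigma>' 30 = ?i)"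
      using I rN v i ctx_L[OF c] by (simp add: meets_def I_def)
    moreover have "meets (Wr 5 (V 30) (V 13)) \<sigma>' 81 (\<lambda>\<sigma>'. I v \<sigma>' \<and> fst \<sigma>' 30 = ?i \<and> region L (snd \<sigma>') 5 ?i = v * S)"
      if "I v \<sigma>' \<and> fst \<sigma>' 30 = ?i" for \<sigma>'
      using that distinct[OF _ v] ctx_L[of "fst \<sigma>'" "snd \<sigma>'"] by (simp add: exec_simps I_def solved_def)
    moreover have "meets (Asg 50 (RAt (V 6) (V 7) (V 30) (C 0))) \<sigma>' 50 (\<lambda>\<sigma>'. I v \<sigma>' \<and> fst \<sigma>' 30 = ?i \<and>
        region L (snd \<sigma>') 5 ?i = v * S \<and> (0 < length (chs ! ?i) \<longrightarrow> fst \<sigma>' 50 = chs ! ?i ! 0))"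
      if "I v \<sigma>' \<and> fst \<sigma>' 30 = ?i \<and> region L (snd \<sigma>') 5 ?i = v * S" for \<sigma>'
      using that eval_child[of "fst \<sigma>'" "snd \<sigma>'" "C 0"] nodes[OF v] by (simp add: meets_def I_def)
    moreover have "meets (Asg 51 (RAt (V 6) (V 7) (V 30) (C 1))) \<sigma>' 50 (\<lambda>\<sigma>'. I v \<sigma>' \<and> fst \<sigma>' 30 = ?i \<and>
        region L (snd \<sigma>') 5 ?i = v * S \<and> (0 < length (chs ! ?i) \<longrightarrow> fst \<sigma>' 50 = chs ! ?i ! 0) \<and>
        (1 < length (chs ! ?i) \<longrightarrow> fst \<sigma>' 51 = chs ! ?i ! 1))"
      if "I v \<sigma>' \<and> fst \<sigma>' 30 = ?i \<and> region L (snd \<sigma>') 5 ?i = v * S \<and>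
        (0 < length (chs ! ?i) \<longrightarrow> fst \<sigma>' 50 = chs ! ?i ! 0)" for \<sigma>'
      using that eval_child[of "fst \<sigma>'" "snd \<sigma>'" "C 1"] nodes[OF v] by (simp add: meets_def I_def)
    moreover have "meets (Asg 54 (RLen (V 6) (V 30))) \<sigma>' 60 (J v 0)"
      if "I v \<sigma>' \<and> fst \<sigma>' 30 = ?i \<and> region L (snd \<sigma>') 5 ?i = v * S \<and>
        (0 < length (chs ! ?i) \<longrightarrow> fst \<sigma>' 50 = chs ! ?i ! 0) \<and>
        (1 < length (chs ! ?i) \<longrightarrow> fst \<sigma>' 51 = chs ! ?i ! 1)" for \<sigma>'
      using that eval_child_count[of "fst \<sigma>'" "snd \<sigma>'"] nodes[OF v] by (simp add: meets_def I_def J_def)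
    ultimately have "meets ?init (setv 20 v \<sigma>') (209 + (81 + (50 + (50 + 60 + 1) + 1) + 1) + 1) (J v 0)"
      by (intro meets_Sq') blast+
    then show ?thesis by (rule meets_mono) auto
  qed
  have inner: "meets (For 31 (V 2) (Wr 6 (Add (V 13) (V 31)) StepF)) \<sigma>' (10 + S * (tc StepF S + 155)) (J v S)"
    if v: "v < N" and J: "J v 0 \<sigma>'" for v \<sigma>'
  proof -
    let ?i = "rev order ! v"
    have "meets (For 31 (V 2) (Wr 6 (Add (V 13) (V 31)) StepF)) \<sigma>'
       (tc (V 2) (fst \<sigma>' lreg) + 8 + S * ((tc StepF S + 143) + 12)) (J v S)"
    proof (rule meets_For'[where I="J v"])
      show "eval (V 2) (fst \<sigma>') (snd \<sigma>') = S" using J by (simp add: J_def I_def ctx_def)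
    next
      fix s \<sigma>' assume s: "s < S" and J: "J v s \<sigma>'"
      let ?\<rho> = "(fst \<sigma>')(31 := s)" and ?\<mu> = "snd \<sigma>'"
      have c: "ctx (fst \<sigma>') ?\<mu>" using J by (simp add: J_def I_def)
      \<comment> \<open>Children precede their parent in the reversed order, so their blocks are
        already complete.\<close>
      have F: "region L ?\<mu> 6 (region L ?\<mu> 5 j + s) \<noteq> 0 \<longleftrightarrow> s \<in> table j"
        if j: "j \<in> ch ?i" and "s < S" for j s
      proof -
        obtain y where "y < v" "rev order ! y = j" using child_earlier[OF v j] by blast
        then show ?thesis using J that by (auto simp: J_def I_def solved_def)
      qed
      have "holds StepF ?\<rho> ?\<mu> \<longleftrightarrow> step (\<lambda>j s. s \<in> table j) (?\<rho> 30) (?\<rho> 31)"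
        by (rule holds_StepF) (use J c F nodes[OF v] s in \<open>simp_all add: J_def\<close>)
      then have st: "eval StepF ?\<rho> ?\<mu> \<noteq> 0 \<longleftrightarrow> s \<in> table ?i"
        using table_unfold[OF nodes[OF v]] J by (simp add: holds_def J_def)
      \<comment> \<open>The cell being written lies beyond all earlier blocks and leaves them
        intact.\<close>
      have other: "x * S + s' \<noteq> v * S + s" if "x < v" "s' < S" for x s'
        using block_less[OF that] by simp
      have lr: "fst \<sigma>' lreg = S" using c by (simp add: ctx_def)
      show "meets (Wr 6 (Add (V 13) (V 31)) StepF) (setv 31 s \<sigma>') (tc StepF S + 143) (J v (Suc s))"
        using J st other lr ctx_L[OF c] unfolding J_def I_def solved_def
        by (simp add: exec_simps less_Suc_eq)
    qed (use J in auto)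
    then show ?thesis by (rule meets_mono) auto
  qed
  have body: "meets (Sq ?init (Sq (For 31 (V 2) (Wr 6 (Add (V 13) (V 31)) StepF)) (Asg 13 (Add (V 13) (V 2)))))
     (setv 20 v \<sigma>') (600 + ((10 + S * (tc StepF S + 155)) + 13 + 1) + 1) (I (Suc v))"
    if v: "v < N" and I: "I v \<sigma>'" for v \<sigma>'
  proof -
    have "meets (Asg 13 (Add (V 13) (V 2))) \<sigma>' 13 (I (Suc v))" if "J v S \<sigma>'" for \<sigma>'
      using that by (auto simp: meets_def J_def I_def solved_def less_Suc_eq ctx_def)
    from meets_Sq'[OF inner[OF v] this] meets_Sq'[OF init[OF v I]] show ?thesis by blast
  qed
  have loop: "meets (For 20 (V 4) (Sq ?init (Sq (For 31 (V 2) (Wr 6 (Add (V 13) (V 31)) StepF)) (Asg 13 (Add (V 13) (V 2))))))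
     \<sigma>' (tc (V 4) (fst \<sigma>' lreg) + 8 + N * ((600 + ((10 + S * (tc StepF S + 155)) + 13 + 1) + 1) + 12))
     (\<lambda>\<sigma>'. ctx (fst \<sigma>') (snd \<sigma>') \<and> solved N (snd \<sigma>'))" if "I 0 \<sigma>'" for \<sigma>'
  proof (rule meets_For'[where I=I, OF that _ body])
    show "eval (V 4) (fst \<sigma>') (snd \<sigma>') = N" using that by (simp add: I_def ctx_def inp_def)
  qed (auto simp: I_def)
  have "meets (Asg 13 (C 0)) \<sigma> 5 (I 0)"
    using assms by (simp add: meets_def I_def solved_def)
  from meets_Sq'[OF this loop[unfolded tc.simps(2)]] show ?thesis
    unfolding Tables_def by (rule meets_mono) (auto simp: algebra_simps)
qed

lemma table_root: "solved N \<mu> \<Longrightarrow> s < S \<Longrightarrow> region L \<mu> 6 (region L \<mu> 5 r + s) \<noteq> 0 \<longleftrightarrow> s \<in> table r"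
proof -
  assume *: "solved N \<mu>" "s < S"
  have "r \<in> set (rev order)" using order root_less by simp
  then obtain x where "x < N" "rev order ! x = r" by (metis in_set_conv_nth length_rev order(1))
  with * show ?thesis by (auto simp: solved_def)
qed

lemma meets_Answer:
  assumes "ctx (fst \<sigma>) (snd \<sigma>)" "solved N (snd \<sigma>)"
  shows "meets Answer \<sigma> (tc AnswerF S + 20)
    (\<lambda>\<sigma>'. fst \<sigma>' 0 = (if C4_free_bipartition G then 1 else 0))"
proof -
  have S: "fst \<sigma> lreg = S" and n: "fst \<sigma> 3 = n" using assms by (simp_all add: ctx_def inp_def)
  have "holds AnswerF (fst \<sigma>) (snd \<sigma>) \<longleftrightarrow> 1 < n \<and> (\<exists>s<S. s \<in> table r)"
    using table_root[OF assms(2)] ctx_L[OF assms(1)] ctx_root[OF assms(1)]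
    by (simp add: AnswerF_def S n holds_def[of "Rd 6 _"] cong: conj_cong)
  then have "holds AnswerF (fst \<sigma>) (snd \<sigma>) \<longleftrightarrow> C4_free_bipartition G"
    unfolding table_correct C4_free_bipartition_iff[OF G] by (simp add: verts_G)
  then show ?thesis by (simp add: Answer_def meets_def holds_def S)
qed

section \<open>Running time\<close>

lemma meets_Main_prog:
  "meets Main_prog (\<lambda>_. 0, mem0)
    (300 + ((10 + N * 100) + ((20 + k * 40) + ((40 + m * 200) + ((50 + n * 300 + off adjl n * 500) +
     ((200 + N * 600) + ((50 + N * (1000 + S * (tc StepF S + 200))) + (tc AnswerF S + 20) + 1) + 1) + 1) + 1) + 1) + 1) + 1)
    (\<lambda>\<sigma>. fst \<sigma> 0 = (if C4_free_bipartition G then 1 else 0))"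
  unfolding Main_prog_def
proof (rule meets_Sq'[OF meets_Setup], elim conjE)
  fix \<sigma> assume 1: "inp (fst \<sigma>) (snd \<sigma>)" "snd \<sigma> = mem0" "fst \<sigma> 11 = 0"
  have zero: "region L mem0 3 x = 0" for x by (simp add: region_def mem0_def)
  show "meets (Sq MaxBag (Sq BitCount (Sq Powers (Sq AdjMatrix (Sq Bfs (Sq Tables Answer)))))) \<sigma>
    ((10 + N * 100) + ((20 + k * 40) + ((40 + m * 200) + ((50 + n * 300 + off adjl n * 500) +
     ((200 + N * 600) + ((50 + N * (1000 + S * (tc StepF S + 200))) + (tc AnswerF S + 20) + 1) + 1) + 1) + 1) + 1) + 1)
    (\<lambda>\<sigma>. fst \<sigma> 0 = (if C4_free_bipartition G then 1 else 0))"
    apply (rule meets_Sq'[OF meets_MaxBag[OF 1(1,3)]], elim conjE)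
    apply (rule meets_Sq'[OF meets_BitCount], assumption, assumption, elim conjE)
    apply (rule meets_Sq'[OF meets_Powers], assumption, assumption, assumption)
     apply (simp add: 1(2) zero)
    apply (elim conjE)
    apply (rule meets_Sq'[OF meets_AdjMatrix], assumption, assumption, assumption, assumption, blast)
    apply (rule meets_Sq'[OF meets_Bfs], assumption, elim conjE)
    apply (rule meets_Sq'[OF meets_Tables], assumption, assumption, elim conjE)
    apply (rule meets_Answer, assumption, assumption)
    done
qed

lemma card_bag: "i < N \<Longrightarrow> card (X i) = length (bags ! i)"
  using bags[of i] distinct_card[of "bags ! i"] by simp

text \<open>Every ordered adjacent pair lies in the square of some bag, and a node contributes at
  most \<open>k * k\<close> such pairs. This makes reading the adjacency lists linear in the number
  of nodes.\<close>

lemma degree_sum: "off adjl n \<le> N * (k * k)"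
proof -
  have "off adjl v = (\<Sum>u<v. length (adjl ! u))" if "v \<le> n" for v
    using that by (induction v) (auto simp: off_Suc)
  then have "off adjl n = (\<Sum>u<n. card (set (adjl ! u)))"
    using adjl distinct_card by (metis (no_types, lifting) lessThan_iff order.refl sum.cong)
  also have "\<dots> = card (SIGMA u:{..<n}. set (adjl ! u))" by simp
  also have "\<dots> \<le> card (\<Union>i<N. X i \<times> X i)"
  proof (rule card_mono)
    have "finite (X i)" if "i < N" for i using bags[OF that] by (metis List.finite_set)
    then show "finite (\<Union>i<N. X i \<times> X i)" by auto
    show "(SIGMA u:{..<n}. set (adjl ! u)) \<subseteq> (\<Union>i<N. X i \<times> X i)"
    proof clarify
      fix u w assume "u < n" "w \<in> set (adjl ! u)"
      then have "{w, u} \<in> edges G" using adjl[of u] by auto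
      then obtain i where "i \<in> verts T" "{w, u} \<subseteq> X i"
        using decomposition unfolding tree_decomposition_def by blast
      then show "(u, w) \<in> (\<Union>i<N. X i \<times> X i)" by (auto simp: verts_T)
    qed
  qed
  also have "\<dots> \<le> (\<Sum>i<N. card (X i \<times> X i))" by (rule card_UN_le) simp
  also have "\<dots> \<le> (\<Sum>i<N. k * k)"
    using length_bag card_bag by (intro sum_mono) (auto simp: card_cartesian_product intro: mult_le_mono)
  finally show ?thesis by simp
qed

text \<open>One power \<open>W\<close> of \<open>18 * (S + 1)\<close> dominates \<open>S\<close>,
  the work for a whole table and the final formula; also \<open>k\<close>, \<open>k * k\<close> and
  \<open>m\<close> are at most \<open>S\<close>. What remains is linear in \<open>n\<close> and
  \<open>N\<close>.\<close>

lemma meets_Main_prog':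
  "meets Main_prog (\<lambda>_. 0, mem0)
    (4000 * (n + N) * (18 * (S + 1)) ^ (size StepF + size AnswerF + 3))
    (\<lambda>\<sigma>. fst \<sigma> 0 = (if C4_free_bipartition G then 1 else 0))"
proof (rule meets_mono[OF meets_Main_prog])
  define Y where "Y = 18 * (S + 1)"
  define W where "W = Y ^ (size StepF + size AnswerF + 3)"
  let ?a = "tc StepF S" and ?b = "tc AnswerF S"
  have Y1: "1 \<le> Y" "S \<le> Y" by (simp_all add: Y_def)
  have pow: "Y ^ j \<le> W" if "j \<le> size StepF + size AnswerF + 3" for j
    unfolding W_def by (rule power_increasing[OF that Y1(1)])
  have N: "1 \<le> N" using root_less by simp
  have W1: "1 \<le> W" using pow[of 0] by simp
  have SW: "S \<le> W" using pow[of 1] Y1(2) by simp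
  have b: "?b \<le> W" using tc_bound[of AnswerF S] pow[of "Suc (size AnswerF)"] by (simp add: Y_def)
  have Sa: "S * ?a \<le> W"
  proof -
    have "?a \<le> Y ^ Suc (size StepF)" using tc_bound[of StepF S] by (simp only: Y_def)
    with Y1(2) have "S * ?a \<le> Y * Y ^ Suc (size StepF)" by (rule mult_le_mono)
    also have "\<dots> = Y ^ (size StepF + 2)" by simp
    also have "\<dots> \<le> W" by (rule pow) simp
    finally show ?thesis .
  qed
  have m: "m \<le> S" using less_exp[of m] unfolding S_def by (rule less_imp_le)
  have kk: "k \<le> m" "k * k \<le> m" by (simp_all add: m_def)
  have off: "off adjl n \<le> N * W"
    using degree_sum mult_le_mono2[of "k * k" W N] kk(2) m SW by linarith
  have nW: "n \<le> n * W" "N \<le> N * W" "W \<le> N * W" using W1 N by simp_all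
  have SN: "N * S \<le> N * W" using SW by simp
  have aN: "N * (S * ?a) \<le> N * W" using Sa by simp
  have "N * (1000 + S * (?a + 200)) = 1000 * N + N * (S * ?a) + 200 * (N * S)"
    by (simp only: distrib_left)
  also have "\<dots> \<le> 1201 * (N * W)" using nW SN aN by linarith
  finally have tab: "N * (1000 + S * (?a + 200)) \<le> 1201 * (N * W)" .
  have kW: "k \<le> N * W" "m \<le> N * W" using kk m SW nW by linarith+
  have "1 \<le> N * W" using nW N by linarith
  \<comment> \<open>With all products replaced by variables this is linear arithmetic: the terms
    bounded by \<open>B\<close>, constants included, have coefficients of total 3339.\<close>
  moreover have "300 + ((10 + N * 100) + ((20 + k * 40) + ((40 + m * 200) + ((50 + n * 300 + D * 500) +
     ((200 + N * 600) + ((50 + Z) + (b + 20) + 1) + 1) + 1) + 1) + 1) + 1) + 1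
     \<le> 4000 * (A + B)"
    if "1 \<le> B" "n \<le> A" "N \<le> B" "k \<le> B" "m \<le> B" "D \<le> B" "Z \<le> 1201 * B" "b \<le> B" for A B D Z b
    using that by simp
  ultimately have "300 + ((10 + N * 100) + ((20 + k * 40) + ((40 + m * 200) + ((50 + n * 300 + off adjl n * 500) +
     ((200 + N * 600) + ((50 + N * (1000 + S * (?a + 200))) + (?b + 20) + 1) + 1) + 1) + 1) + 1) + 1) + 1
     \<le> 4000 * (n * W + N * W)"
    using nW(1,2) kW off tab order.trans[OF b nW(3)] by blast
  also have "\<dots> = 4000 * (n + N) * W" by (simp only: distrib_right mult.assoc)
  finally show "300 + ((10 + N * 100) + ((20 + k * 40) + ((40 + m * 200) + ((50 + n * 300 + off adjl n * 500) +
     ((200 + N * 600) + ((50 + N * (1000 + S * (?a + 200))) + (?b + 20) + 1) + 1) + 1) + 1) + 1) + 1) + 1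
     \<le> 4000 * (n + N) * (18 * (S + 1)) ^ (size StepF + size AnswerF + 3)"
    unfolding W_def Y_def .
qed

lemma Main_prog_answers:
  assumes "real (4000 * (n + N) * (18 * (S + 1)) ^ (size StepF + size AnswerF + 3)) \<le> b"
  shows "answers_within (cs Main_prog nvar) xs b (C4_free_bipartition G)"
proof -
  let ?s = "initial_state xs"
  have s: "named ?s = (\<lambda>_. 0)" "mem ?s = mem0"
    by (auto simp: named_def initial_state_def mem0_def length_xs)
  have t: "tm Main_prog (named ?s, mem ?s) \<le> 4000 * (n + N) * (18 * (S + 1)) ^ (size StepF + size AnswerF + 3)"
    and a: "fst (run Main_prog (named ?s, mem ?s)) 0 = (if C4_free_bipartition G then 1 else 0)"
    using meets_Main_prog' unfolding meets_def s by simp_all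
  obtain \<tau> s' where 1: "exec (cs Main_prog nvar) ?s \<tau> s'" "\<tau> \<le> tm Main_prog (named ?s, mem ?s)"
    "(named s', mem s') = run Main_prog (named ?s, mem ?s)"
    using cs_correct[OF wfs_Main_prog order.refl, of ?s] unfolding runs_def by blast
  have "regs s' 0 = named s' 0" by (simp add: named_def)
  also have "\<dots> = (if C4_free_bipartition G then 1 else 0)" using a 1(3) by (metis fst_conv)
  finally show ?thesis
    using 1(1) order_trans[OF of_nat_mono[OF order_trans[OF 1(2) t]] assms]
    unfolding answers_within_def by blast
qed

end

section \<open>From encoded inputs to the stated bound\<close>

text \<open>Niceness yields at most two children per node, and the child lists are distinct, so
  their lengths are at most 2.\<close>

lemma encodes_c4_input:
  assumes G: "simple_graph G" and nice: "nice_tree_decomposition G T r X" and "encodes ys G T r X"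
  obtains adjl chs bags where "c4_input T r G X adjl chs bags" "ys = c4_input.xs r adjl chs bags"
proof -
  obtain adjl chs bags where
    ys: "ys = [length adjl, length chs, r] @ rows adjl @ rows chs @ rows bags" and
    v: "verts G = {..<length adjl}" "verts T = {..<length chs}" "length bags = length chs" and
    a: "\<forall>v\<in>verts G. distinct (adjl ! v) \<and> set (adjl ! v) = {u. {u, v} \<in> edges G}" and
    c: "\<forall>i\<in>verts T. distinct (chs ! i) \<and> set (chs ! i) = children T r i \<and>
                     distinct (bags ! i) \<and> set (bags ! i) = X i"
    using assms(3) unfolding encodes_def by blast
  have td: "tree_decomposition G T X" "r \<in> verts T" "tree T"
    using nice by (auto simp: nice_tree_decomposition_def tree_decomposition_def)
  have "length (chs ! i) \<le> 2" if "i \<in> verts T" for i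
  proof -
    have "card (children T r i) \<le> 2"
      using nice that unfolding nice_tree_decomposition_def leaf_node_def introduce_node_def
        forget_node_def join_node_def by fastforce
    then show ?thesis using c that distinct_card by metis
  qed
  then have I: "c4_input T r G X adjl chs bags"
    by unfold_locales (use G td v a c in auto)
  moreover have "ys = c4_input.xs r adjl chs bags" unfolding c4_input.xs_def[OF I] by (rule ys)
  ultimately show ?thesis by (rule that)
qed

theorem theorem3:
  "\<exists>P :: com. \<forall>d :: nat. \<exists>g :: nat \<Rightarrow> real. g \<in> O(\<lambda>t. real t ^ 2) \<and>
     (\<forall>(G :: nat ugraph) (T :: nat ugraph) (r :: nat) (X :: nat \<Rightarrow> nat set) (t :: nat) (xs :: nat list).
        simple_graph G \<longrightarrow> treewidth G \<le> int t \<longrightarrow>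
        nice_tree_decomposition G T r X \<longrightarrow> width T X \<le> int t \<longrightarrow>
        card (verts T) \<le> d * card (verts G) \<longrightarrow>
        encodes xs G T r X \<longrightarrow>
        answers_within P xs (2 powr g t * real (card (verts G))) (C4_free_bipartition G))"
proof (intro exI[of _ "cs Main_prog nvar"] allI)
  fix d :: nat
  define K where "K = size StepF + size AnswerF + 3"
  \<comment> \<open>Moves the constant of the linear factor into the exponent: with at most
    \<open>d * n\<close> nodes, \<open>n + N\<close> is at most \<open>(d + 1) * n\<close>.\<close>
  define c where "c = log 2 (4000 * (real d + 1))"
  \<comment> \<open>The 6 comes from \<open>18 * (S + 1) \<le> 64 * S\<close>, and the rest bounds
    \<open>m\<close> by means of \<open>k \<le> t + 1\<close>.\<close>
  define g where "g t = c + real (K * (6 + ((t + 1) + (t + 1) * (t + 1))))" for t :: nat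
  have c0: "0 \<le> c" unfolding c_def by simp
  have "g \<in> O(\<lambda>t. real t ^ 2)"
  proof (rule bigoI[where c = "c + real K * 12"], rule eventually_mono[OF eventually_ge_at_top[of 1]])
    fix t :: nat assume t: "1 \<le> t"
    then have "t \<le> t * t" "1 \<le> t * t" by simp_all
    \<comment> \<open>The left side is \<open>t * t + 3 * t + 8\<close>, and each term is at most
      its coefficient times \<open>t * t\<close> because \<open>1 \<le> t\<close>.\<close>
    then have "6 + ((t + 1) + (t + 1) * (t + 1)) \<le> 12 * (t * t)"
      unfolding distrib_left distrib_right mult_1_left mult_1_right by linarith
    then have "real (K * (6 + ((t + 1) + (t + 1) * (t + 1)))) \<le> real (K * (12 * (t * t)))"
      by (intro of_nat_mono mult_le_mono2)
    moreover have "c \<le> c * real (t * t)" 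
      using mult_left_mono[OF of_nat_mono[OF \<open>1 \<le> t * t\<close>] c0] by simp
    ultimately have "g t \<le> (c + real K * 12) * real t ^ 2"
      by (simp add: g_def power2_eq_square algebra_simps)
    moreover have "0 \<le> g t" using c0 by (simp add: g_def)
    ultimately show "norm (g t) \<le> (c + real K * 12) * norm (real t ^ 2)" by simp
  qed
  moreover have "answers_within (cs Main_prog nvar) xs (2 powr g t * real (card (verts G))) (C4_free_bipartition G)"
    if G: "simple_graph G" and nice: "nice_tree_decomposition G T r X" and w: "width T X \<le> int t"
      and d: "card (verts T) \<le> d * card (verts G)" and e: "encodes xs G T r X"
    for G :: "nat ugraph" and T :: "nat ugraph" and r X t xs
  proof -
    obtain adjl chs bags where I: "c4_input T r G X adjl chs bags" "xs = c4_input.xs r adjl chs bags"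
      using encodes_c4_input[OF G nice e] by blast
    interpret c4_input T r G X adjl chs bags by (rule I(1))
    have nN: "card (verts G) = n" "card (verts T) = N" by (simp_all add: verts_G verts_T)
    have "length (bags ! i) \<le> t + 1" if "i < N" for i
    proof -
      have "card (X i) \<le> Max ((\<lambda>i. card (X i)) ` verts T)"
        using that by (intro Max_ge) (auto simp: verts_T)
      then show ?thesis using w card_bag[OF that] by (simp add: width_def)
    qed
    then have "k \<le> t + 1" unfolding k_def by (auto simp: in_set_conv_nth length_bags)
    then have "m \<le> (t + 1) + (t + 1) * (t + 1)" unfolding m_def by (intro add_mono mult_le_mono)
    then have "6 + m \<le> 6 + ((t + 1) + (t + 1) * (t + 1))" by simp
    moreover have "18 * (S + 1) \<le> 2 ^ (6 + m)"
    proof -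
      have "1 \<le> S" by (simp add: S_def)
      then have "18 * (S + 1) \<le> 64 * S" by simp
      then show ?thesis by (simp add: S_def power_add)
    qed
    ultimately have "18 * (S + 1) \<le> 2 ^ (6 + ((t + 1) + (t + 1) * (t + 1)))"
      by (meson le_trans one_le_numeral power_increasing)
    then have "(18 * (S + 1)) ^ K \<le> (2 ^ (6 + ((t + 1) + (t + 1) * (t + 1)))) ^ K"
      by (intro power_mono) auto
    also have "\<dots> = 2 ^ (K * (6 + ((t + 1) + (t + 1) * (t + 1))))" by (simp only: power_mult[symmetric] mult.commute)
    finally have W: "(18 * (S + 1)) ^ K \<le> 2 ^ (K * (6 + ((t + 1) + (t + 1) * (t + 1))))" .
    have "n + N \<le> (d + 1) * n" using d unfolding nN by simp
    then have "4000 * (n + N) * (18 * (S + 1)) ^ K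
        \<le> 4000 * ((d + 1) * n) * 2 ^ (K * (6 + ((t + 1) + (t + 1) * (t + 1))))"
      using W by (intro mult_le_mono) auto
    then have "real (4000 * (n + N) * (18 * (S + 1)) ^ K)
        \<le> real (4000 * ((d + 1) * n) * 2 ^ (K * (6 + ((t + 1) + (t + 1) * (t + 1)))))"
      by (rule of_nat_mono)
    also have "\<dots> = (4000 * (real d + 1)) * 2 powr real (K * (6 + ((t + 1) + (t + 1) * (t + 1)))) * real n"
      by (subst powr_realpow) (simp_all add: algebra_simps)
    also have "4000 * (real d + 1) = 2 powr c" unfolding c_def by simp
    also have "2 powr c * 2 powr real (K * (6 + ((t + 1) + (t + 1) * (t + 1)))) = 2 powr g t"
      by (simp add: g_def powr_add)
    finally show ?thesis
      using Main_prog_answers unfolding I(2) nN(1) K_def by blast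
  qed
  ultimately show "\<exists>g :: nat \<Rightarrow> real. g \<in> O(\<lambda>t. real t ^ 2) \<and>
     (\<forall>(G :: nat ugraph) (T :: nat ugraph) (r :: nat) (X :: nat \<Rightarrow> nat set) (t :: nat) (xs :: nat list).
        simple_graph G \<longrightarrow> treewidth G \<le> int t \<longrightarrow>
        nice_tree_decomposition G T r X \<longrightarrow> width T X \<le> int t \<longrightarrow>
        card (verts T) \<le> d * card (verts G) \<longrightarrow>
        encodes xs G T r X \<longrightarrow>
        answers_within (cs Main_prog nvar) xs (2 powr g t * real (card (verts G))) (C4_free_bipartition G))"
    by blast
qed

end
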